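(* Let $n\ge 1$, $0\le \alpha\le n$, and let $P\in C^\infty(\mathbb{R}^n\setminus\{0\})$ be a real-valued function which is homogeneous of degree $k$ for some real $k\ge 1$, and non-singular in the sense that $\nabla P(\xi)\neq 0$ for all $\xi\in\mathbb{R}^n\setminus\{0\}$. Let $s>(n-\alpha+1)/2$. Then for every $\mu\in M^\alpha(B_1)$ and every $f\in H^s(\mathbb{R}^n)$, $$\lim_{t\to 0}T_tf(x)=f(x)\qquad\text{for } \mu\text{-a.e. } x .$$
   Context: Notation: $e(z)=e^{2\pi i z}$, $\widehat f(\xi)=\int f(x)e(-x\cdot\xi)\,dx$. For a symbol $P$, $T_tf$ denotes the solution of $i\hbar\,\partial_tu+P(D)u=0$, $u(\cdot,0)=f$, with $\hbar=1/(2\pi)$ and $D=-i\hbar\partial$, i.e. $T_tf(x)=\int \widehat f(\xi)\,e(x\cdot\xi+tP(\xi))\,d\xi$. $H^s(\mathbb{R}^n)$ is the $L^2$-based Sobolev space. Pointwise values: for a measurable function $g$ (in particular $g=f$ and $g=T_tf$) the value at $x$ is that of the representative $\lim_{r\to0}|B(x,r)|^{-1}\int_{B(x,r)}g$ whenever the limit exists. $M^\alpha(B_1)$ is the collection of probability measures $\mu$ supported in the unit ball $B_1$ of $\mathbb{R}^n$ for which there is a constant $C$ with $\mu(B_r)\le Cr^\alpha$ for every ball $B_r$ of radius $r$ and all $r>0$. *)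

theory Defs
  imports "HOL-Probability.Probability"
begin

definition ee :: "real \<Rightarrow> complex" where
  "ee z = exp (2 * complex_of_real pi * \<i> * complex_of_real z)"


subsection \<open>The Fourier transform on \<open>L\<^sup>2\<close>\<close>

definition L2 :: "(real^'n \<Rightarrow> complex) set" where
  "L2 = {f. f \<in> borel_measurable lebesgue \<and> integrable lebesgue (\<lambda>x. (cmod (f x))\<^sup>2)}"

definition fourier_integral :: "(real^'n \<Rightarrow> complex) \<Rightarrow> real^'n \<Rightarrow> complex" where
  "fourier_integral f \<xi> = (LINT x|lebesgue. f x * ee (- (x \<bullet> \<xi>)))"

text \<open>
  For a general \<open>f \<in> L\<^sup>2\<close> the Fourier integral need not converge; as usual, the transform is
  the \<open>L\<^sup>2\<close>-limit, as \<open>R \<rightarrow> \<infinity>\<close>, of the Fourier integrals of the truncations of \<open>f\<close> to balls.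
  The limit is determined up to null sets only, and \<open>fourier\<close> picks some representative.
\<close>

definition is_fourier_transform :: "(real^'n \<Rightarrow> complex) \<Rightarrow> (real^'n \<Rightarrow> complex) \<Rightarrow> bool" where
  "is_fourier_transform f g \<longleftrightarrow> g \<in> L2 \<and>
     ((\<lambda>R. \<integral>\<^sup>+ \<xi>. ennreal ((cmod
          (fourier_integral (\<lambda>x. indicator (ball 0 R) x * f x) \<xi> - g \<xi>))\<^sup>2) \<partial>lebesgue)
        \<longlongrightarrow> 0) at_top"

definition fourier :: "(real^'n \<Rightarrow> complex) \<Rightarrow> real^'n \<Rightarrow> complex" where
  "fourier f = (SOME g. is_fourier_transform f g)"

text \<open>
  Replacing \<open>x\<close> by \<open>-x\<close> turns the kernel \<open>ee (- (x \<bullet> \<xi>))\<close> into \<open>ee (x \<bullet> \<xi>)\<close>, so this is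
  \<open>\<integral> g(\<xi>) ee (x \<bullet> \<xi>) d\<xi>\<close> in the \<open>L\<^sup>2\<close> sense.
\<close>

definition inverse_fourier :: "(real^'n \<Rightarrow> complex) \<Rightarrow> real^'n \<Rightarrow> complex" where
  "inverse_fourier g x = fourier g (- x)"

text \<open>For \<open>s \<ge> 0\<close> (the only case used) \<open>H\<^sup>s\<close> is contained in \<open>L\<^sup>2\<close>, so no distributions are needed.\<close>

definition sobolev :: "real \<Rightarrow> (real^'n \<Rightarrow> complex) set" where
  "sobolev s = {f \<in> L2. (\<lambda>\<xi>. complex_of_real ((1 + (norm \<xi>)\<^sup>2) powr (s / 2)) * fourier f \<xi>) \<in> L2}"

definition T_op :: "(real^'n \<Rightarrow> real) \<Rightarrow> real \<Rightarrow> (real^'n \<Rightarrow> complex) \<Rightarrow> real^'n \<Rightarrow> complex" where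
  "T_op P t f = inverse_fourier (\<lambda>\<xi>. fourier f \<xi> * ee (t * P \<xi>))"


subsection \<open>Pointwise values\<close>

definition ball_average :: "(real^'n \<Rightarrow> complex) \<Rightarrow> real^'n \<Rightarrow> real \<Rightarrow> complex" where
  "ball_average g x r = (LINT y:ball x r|lebesgue. g y) / complex_of_real (measure lebesgue (ball x r))"

definition has_value_at :: "(real^'n \<Rightarrow> complex) \<Rightarrow> real^'n \<Rightarrow> bool" where
  "has_value_at g x \<longleftrightarrow> (\<exists>v. (ball_average g x \<longlongrightarrow> v) (at_right 0))"

text \<open>Only meaningful if \<^term>\<open>has_value_at g x\<close>; unchanged when \<open>g\<close> is modified on a null set.\<close>

definition value_at :: "(real^'n \<Rightarrow> complex) \<Rightarrow> real^'n \<Rightarrow> complex" where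
  "value_at g x = Lim (at_right 0) (ball_average g x)"


subsection \<open>Symbols\<close>

definition gradient :: "(real^'n \<Rightarrow> real) \<Rightarrow> real^'n \<Rightarrow> real^'n" where
  "gradient f x = (THE D. GDERIV f x :> D)"

text \<open>For open \<open>S\<close>.\<close>

fun C_on :: "nat \<Rightarrow> (real^'n) set \<Rightarrow> (real^'n \<Rightarrow> real) \<Rightarrow> bool" where
  "C_on 0 S f \<longleftrightarrow> continuous_on S f"
| "C_on (Suc m) S f \<longleftrightarrow> f differentiable_on S \<and> (\<forall>i. C_on m S (\<lambda>x. gradient f x $ i))"

definition smooth_on :: "(real^'n) set \<Rightarrow> (real^'n \<Rightarrow> real) \<Rightarrow> bool" where
  "smooth_on S f \<longleftrightarrow> (\<forall>m. C_on m S f)"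

text \<open>
  Symbols live on the complement of the origin; a function \<open>P\<close> on the whole space represents its
  restriction, and the value \<open>P 0\<close> is immaterial.
\<close>

definition homogeneous :: "real \<Rightarrow> (real^'n \<Rightarrow> real) \<Rightarrow> bool" where
  "homogeneous k P \<longleftrightarrow> (\<forall>c>0. \<forall>\<xi>. \<xi> \<noteq> 0 \<longrightarrow> P (c *\<^sub>R \<xi>) = c powr k * P \<xi>)"

definition nonsingular :: "(real^'n \<Rightarrow> real) \<Rightarrow> bool" where
  "nonsingular P \<longleftrightarrow> (\<forall>\<xi>. \<xi> \<noteq> 0 \<longrightarrow> gradient P \<xi> \<noteq> 0)"


subsection \<open>Fractal measures\<close>

text \<open>Being supported in the unit ball is taken to allow mass on its boundary.\<close>

definition M_meas :: "real \<Rightarrow> (real^'n) measure set" where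
  "M_meas \<alpha> = {\<mu>. sets \<mu> = sets borel \<and> prob_space \<mu> \<and> emeasure \<mu> (- cball 0 1) = 0 \<and>
            (\<exists>C. \<forall>x. \<forall>r>0. measure \<mu> (ball x r) \<le> C * r powr \<alpha>)}"

end

theory Submission
  imports Defs
begin

text \<open>
  The solution is split into dyadic frequency shells \<open>\<bar>\<xi>\<bar> \<sim> \<lambda>\<close>. On a small piece of a shell some
  \<open>\<partial>\<^sub>i P\<close> has size \<open>\<lambda>\<^sup>k\<^sup>-\<^sup>1\<close>, and the map replacing the coordinate \<open>\<xi>\<^sub>i\<close> by \<open>P \<xi>\<close> turns the
  oscillatory integral, for frozen \<open>x\<^sub>i\<close>, into a Fourier integral in the remaining coordinates and
  \<open>t\<close>; Schur's test on a Gaussian regularisation then gives the local smoothing gain \<open>\<lambda>\<^sup>1\<^sup>-\<^sup>k\<close>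
  without any change of variables. Convolving with Gaussians of width \<open>1/\<lambda>\<close> in space and
  \<open>\<lambda>\<^sup>-\<^sup>k\<close> in time reproduces the piece, so that the supremum over all times and over all ball
  averages costs a factor \<open>\<lambda>\<^sup>k\<close>, the fractal measure costs \<open>\<lambda>\<^sup>n\<^sup>-\<^sup>\<alpha>\<close>, and there is a logarithmic loss.
  Altogether the square of the maximal function of a shell has \<open>\<mu>\<close>-integral at most
  \<open>\<lambda>\<^sup>n\<^sup>-\<^sup>\<alpha>\<^sup>+\<^sup>1 log \<lambda>\<close> times the squared \<open>L\<^sup>2\<close> norm, which is summable against \<open>\<lambda>\<^sup>-\<^sup>2\<^sup>s\<close>. Hence almost everywhere
  the shells form a series of continuous functions dominated by a summable sequence, uniformly in
  the time and in the radius of the averages.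
\<close>

subsection \<open>Gaussians and their Fourier transform\<close>

text \<open>Since \<mu> may be singular to Lebesgue measure, neither an L2 limit nor a Lebesgue
  almost everywhere statement about \<open>T_op P t f\<close> says anything at the relevant points.
  Every estimate is therefore made for ball averages, at every point and for all t and all radii r
  \<le> 1 at once, so that the exceptional set depends on neither. Gaussians replace smooth cutoffs
  because their transforms are explicit and positive: the kernel in Schur's test is positive, and a
  piece is reproduced after dividing its data by Gaussian multipliers that are bounded below on the
  shell. On a shell the time frequencies are at most a multiple of \<open>\<lambda>^k\<close>, which
  dictates the width of the time kernel; its peak \<open>\<lambda>^k\<close> times the gain
  \<open>\<lambda>^(1-k)\<close> is \<lambda>, so the degree cancels and leaves the +1 in the
  threshold for s. The logarithm arises because averages over balls wider than
  \<open>1/\<lambda>\<close> are majorised by Gaussians of all coarser dyadic widths together; the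
  strict inequality for s absorbs it.\<close>

lemma ee_add: "ee (a + b) = ee a * ee b"
  by (simp add: ee_def exp_add[symmetric] algebra_simps)

lemma ee_0 [simp]: "ee 0 = 1"
  by (simp add: ee_def)

lemma cmod_ee [simp]: "cmod (ee z) = 1"
  by (simp add: ee_def norm_exp_eq_Re)

lemma cnj_ee: "cnj (ee z) = ee (- z)"
  by (simp add: ee_def exp_cnj)

lemma ee_sum: "finite A \<Longrightarrow> ee (sum f A) = (\<Prod>a\<in>A. ee (f a))"
  by (induction A rule: finite_induct) (auto simp: ee_add)

lemma isCont_ee: "isCont ee z"
  unfolding ee_def by (intro continuous_intros)

lemma measurable_ee [measurable (raw)]: "f \<in> borel_measurable M \<Longrightarrow> (\<lambda>x. ee (f x)) \<in> borel_measurable M"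
  unfolding ee_def by measurable

text \<open>\<rho> is a frequency: the width is \<open>1 / \<rho>\<close>, and the factor
  \<open>\<rho> ^ DIM('a)\<close> makes the total mass 1. With pi in the exponent the transform is
  \<open>exp (- pi * (norm \<xi>)\<^sup>2 / \<rho>\<^sup>2)\<close>, free of constants.\<close>

definition gauss :: "real \<Rightarrow> 'a::euclidean_space \<Rightarrow> real" where
  "gauss \<rho> x = \<rho> ^ DIM('a) * exp (- pi * \<rho>\<^sup>2 * (norm x)\<^sup>2)"

lemma gauss_nonneg [simp]: "\<rho> \<ge> 0 \<Longrightarrow> 0 \<le> gauss \<rho> x"
  by (simp add: gauss_def)

lemma gauss_minus: "gauss \<rho> (- x) = gauss \<rho> x"
  by (simp add: gauss_def)

lemma gauss_minus_commute: "gauss \<rho> (x - y) = gauss \<rho> (y - x)"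
  by (simp add: gauss_def norm_minus_commute)

lemma measurable_gauss [measurable (raw)]:
  "f \<in> borel_measurable M \<Longrightarrow> (\<lambda>x. gauss \<rho> (f x)) \<in> borel_measurable M"
  unfolding gauss_def by measurable

lemma gauss_real: "gauss \<rho> (x::real) = \<rho> * exp (- pi * \<rho>\<^sup>2 * x\<^sup>2)"
  by (simp add: gauss_def)

lemma gauss_real_le: "\<rho> \<ge> 0 \<Longrightarrow> gauss \<rho> (x::real) \<le> \<rho>"
  by (simp add: gauss_real mult_left_le)

text \<open>\<open>lborel\<close> is the image of the product of one-dimensional Lebesgue measures,
  so an integrand that is a product over coordinates factorises.\<close>

lemma integral_lborel_prod:
  fixes f :: "'a::euclidean_space \<Rightarrow> real \<Rightarrow> complex"
  assumes f: "\<And>b. b \<in> Basis \<Longrightarrow> integrable lborel (f b)"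
  shows "(LINT x|lborel. (\<Prod>b\<in>Basis. f b (x \<bullet> b))) = (\<Prod>b\<in>Basis. (LINT x|lborel. f b x))"
proof -
  interpret product_sigma_finite "\<lambda>_::'a. lborel :: real measure" ..
  have [measurable]: "f b \<in> borel_measurable borel" if "b \<in> Basis" for b
    using borel_measurable_integrable[OF f[OF that]] by simp
  have "(LINT x|lborel. (\<Prod>b\<in>Basis. f b (x \<bullet> b)))
      = (LINT g|(\<Pi>\<^sub>M b\<in>Basis. lborel). (\<Prod>b\<in>Basis. f b ((\<Sum>c\<in>Basis. g c *\<^sub>R c) \<bullet> b)))"
    by (subst lborel_eq, subst integral_distr) auto
  also have "\<dots> = (LINT g|(\<Pi>\<^sub>M b\<in>Basis. lborel). (\<Prod>b\<in>Basis. f b (g b)))"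
    by (intro Bochner_Integration.integral_cong prod.cong refl) simp
  also have "\<dots> = (\<Prod>b\<in>Basis. (LINT x|lborel. f b x))"
    by (rule product_integral_prod) (auto intro: f)
  finally show ?thesis .
qed

lemma gauss_prod: "gauss \<rho> (x::'a::euclidean_space) = (\<Prod>b\<in>Basis. gauss \<rho> (x \<bullet> b))"
proof -
  have "(norm x)\<^sup>2 = (\<Sum>b\<in>Basis. (x \<bullet> b)\<^sup>2)"
    by (metis (no_types, lifting) euclidean_inner power2_eq_square power2_norm_eq_inner sum.cong)
  then have "exp (- pi * \<rho>\<^sup>2 * (norm x)\<^sup>2) = (\<Prod>b\<in>Basis. exp (- pi * \<rho>\<^sup>2 * (x \<bullet> b)\<^sup>2))"
    by (simp add: exp_sum[symmetric] sum_distrib_left sum_negf)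
  then show ?thesis
    by (simp add: gauss_def prod.distrib)
qed

lemma gauss_real_normal:
  assumes "\<rho> > 0"
  shows "gauss \<rho> (x::real) = normal_density 0 (1 / (\<rho> * sqrt (2 * pi))) x"
proof -
  have "sqrt (2 * pi * (1 / (\<rho> * sqrt (2 * pi)))\<^sup>2) = 1 / \<rho>"
    using assms by (simp add: power_divide power_mult_distrib real_sqrt_divide real_sqrt_mult)
  then show ?thesis
    using assms by (simp add: gauss_real normal_density_def power_divide power_mult_distrib field_simps)
qed

lemma integrable_gauss_real: "\<rho> > 0 \<Longrightarrow> integrable lborel (gauss \<rho> :: real \<Rightarrow> real)"
  using gauss_real_normal by (subst Bochner_Integration.integrable_cong[OF refl, where g = "normal_density 0 (1 / (\<rho> * sqrt (2 * pi)))"]) auto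

lemma integral_gauss_real: "\<rho> > 0 \<Longrightarrow> (LINT x|lborel. gauss \<rho> (x::real)) = 1"
  by (simp add: gauss_real_normal)

lemma nn_integral_gauss_real: "\<rho> > 0 \<Longrightarrow> (\<integral>\<^sup>+x. gauss \<rho> (x::real) \<partial>lborel) = 1"
  by (subst nn_integral_eq_integral) (auto simp: integrable_gauss_real integral_gauss_real)

lemma fourier_gauss_real:
  fixes \<xi> :: real
  assumes "\<rho> > 0"
  shows "(LINT x|lborel. complex_of_real (gauss \<rho> x) * ee (x * \<xi>)) = exp (- pi * \<xi>\<^sup>2 / \<rho>\<^sup>2)"
proof -
  \<comment> \<open>Standard deviation of the normal density that \<open>gauss \<rho>\<close> is;
    rescaling by it reduces the claim to the characteristic function of the standard normal
    distribution.\<close>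
  define \<sigma> where "\<sigma> = 1 / (\<rho> * sqrt (2 * pi))"
  have \<sigma>: "\<sigma> > 0" using assms by (simp add: \<sigma>_def)
  have eq: "\<sigma> * gauss \<rho> (\<sigma> * x) = std_normal_density x" for x
  proof -
    have "\<rho>\<^sup>2 * \<sigma>\<^sup>2 = 1 / (2 * pi)" "\<sigma> * \<rho> = 1 / sqrt (2 * pi)"
      using assms by (simp_all add: \<sigma>_def power_divide power_mult_distrib)
    then show ?thesis
      by (simp add: gauss_real std_normal_density_def power_mult_distrib mult.assoc[symmetric])
  qed
  have "(LINT x|lborel. complex_of_real (gauss \<rho> x) * ee (x * \<xi>)) =
      \<bar>\<sigma>\<bar> *\<^sub>R (LINT x|lborel. complex_of_real (gauss \<rho> (0 + \<sigma> * x)) * ee ((0 + \<sigma> * x) * \<xi>))"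
    by (rule lborel_integral_real_affine) (use \<sigma> in auto)
  also have "\<dots> = (LINT x|lborel. \<sigma> *\<^sub>R (complex_of_real (gauss \<rho> (\<sigma> * x)) * ee (\<sigma> * x * \<xi>)))"
    using \<sigma> by simp
  also have "\<dots> = (LINT x|lborel. std_normal_density x *\<^sub>R iexp ((2 * pi * \<sigma> * \<xi>) * x))"
    by (intro Bochner_Integration.integral_cong refl)
       (simp add: eq[symmetric] ee_def scaleR_conv_of_real mult_ac)
  also have "\<dots> = char std_normal_distribution (2 * pi * \<sigma> * \<xi>)"
    unfolding char_def by (subst integral_density) (auto simp: normal_density_nonneg)
  also have "\<dots> = exp (- ((2 * pi * \<sigma> * \<xi>)\<^sup>2) / 2)"
    by (simp add: char_std_normal_distribution)
  also have "- ((2 * pi * \<sigma> * \<xi>)\<^sup>2) / 2 = - pi * \<xi>\<^sup>2 / \<rho>\<^sup>2"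
    using assms by (simp add: \<sigma>_def field_simps power2_eq_square)
  finally show ?thesis .
qed

lemma nn_integral_gauss: "\<rho> > 0 \<Longrightarrow> (\<integral>\<^sup>+x. gauss \<rho> (x::'a::euclidean_space) \<partial>lborel) = 1"
proof -
  assume \<rho>: "\<rho> > 0"
  have "(\<integral>\<^sup>+x. gauss \<rho> (x::'a) \<partial>lborel) = (\<integral>\<^sup>+x. (\<Prod>b\<in>(Basis::'a set). ennreal (gauss \<rho> (x \<bullet> b))) \<partial>lborel)"
    using \<rho> by (subst gauss_prod) (simp add: prod_ennreal)
  also have "\<dots> = 1"
    using \<rho> by (subst nn_integral_lborel_prod) (auto simp: nn_integral_gauss_real)
  finally show ?thesis .
qed

lemma integrable_gauss: "\<rho> > 0 \<Longrightarrow> integrable lborel (gauss \<rho> :: 'a::euclidean_space \<Rightarrow> real)"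
  by (rule integrableI_nonneg) (auto simp: nn_integral_gauss)

lemma nn_integral_lborel_translate:
  fixes f :: "'a::euclidean_space \<Rightarrow> ennreal"
  assumes "f \<in> borel_measurable borel"
  shows "(\<integral>\<^sup>+x. f (a + x) \<partial>lborel) = (\<integral>\<^sup>+x. f x \<partial>lborel)"
  by (subst (2) lborel_distr_plus[of a, symmetric]) (simp add: nn_integral_distr assms)

lemma nn_integral_lborel_minus:
  fixes f :: "'a::euclidean_space \<Rightarrow> ennreal"
  assumes "f \<in> borel_measurable borel"
  shows "(\<integral>\<^sup>+x. f (- x) \<partial>lborel) = (\<integral>\<^sup>+x. f x \<partial>lborel)"
proof -
  have *: "distr lborel borel (\<lambda>x. - x) = (lborel :: 'a measure)"
    using lborel_affine[of "-1" "0::'a"] by (simp add: density_1)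
  show ?thesis
    by (subst (2) *[symmetric]) (simp add: nn_integral_distr assms)
qed

lemma nn_integral_gauss_diff: "\<rho> > 0 \<Longrightarrow> (\<integral>\<^sup>+x. gauss \<rho> (a - x::'a::euclidean_space) \<partial>lborel) = 1"
  using nn_integral_lborel_translate[of "\<lambda>x. ennreal (gauss \<rho> x)" "-a"]
  by (subst gauss_minus_commute) (simp add: nn_integral_gauss)

lemma fourier_gauss:
  fixes \<xi> :: "'a::euclidean_space"
  assumes "\<rho> > 0"
  shows "(LINT x|lborel. complex_of_real (gauss \<rho> x) * ee (x \<bullet> \<xi>)) = exp (- pi * (norm \<xi>)\<^sup>2 / \<rho>\<^sup>2)"
proof -
  have "complex_of_real (gauss \<rho> x) * ee (x \<bullet> \<xi>) =
      (\<Prod>b\<in>Basis. (\<lambda>s. complex_of_real (gauss \<rho> s) * ee (s * (\<xi> \<bullet> b))) (x \<bullet> b))" for x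
    by (subst gauss_prod, subst euclidean_inner) (simp add: ee_sum prod.distrib)
  then have "(LINT x|lborel. complex_of_real (gauss \<rho> x) * ee (x \<bullet> \<xi>)) =
     (\<Prod>b\<in>Basis. (LINT s|lborel. complex_of_real (gauss \<rho> s) * ee (s * (\<xi> \<bullet> b))))"
    apply (simp only:)
    apply (rule integral_lborel_prod)
    apply (rule Bochner_Integration.integrable_bound[OF integrable_gauss_real[OF assms]])
    using assms by (auto simp: norm_mult)
  also have "\<dots> = complex_of_real (\<Prod>b\<in>Basis. exp (- pi * (\<xi> \<bullet> b)\<^sup>2 / \<rho>\<^sup>2))"
    by (simp add: fourier_gauss_real[OF assms])
  also have "(\<Prod>b\<in>Basis. exp (- pi * (\<xi> \<bullet> b)\<^sup>2 / \<rho>\<^sup>2)) = exp (- pi * (norm \<xi>)\<^sup>2 / \<rho>\<^sup>2)"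
  proof -
    have "(norm \<xi>)\<^sup>2 = (\<Sum>b\<in>Basis. (\<xi> \<bullet> b)\<^sup>2)"
      by (metis (no_types, lifting) euclidean_inner power2_eq_square power2_norm_eq_inner sum.cong)
    then show ?thesis
      by (simp add: exp_sum[symmetric] sum_distrib_left sum_negf sum_divide_distrib)
  qed
  finally show ?thesis .
qed

lemma fourier_gauss_diff:
  fixes \<xi> :: "'a::euclidean_space"
  assumes "\<rho> > 0"
  shows "(LINT y|lborel. complex_of_real (gauss \<rho> (x - y)) * ee (y \<bullet> \<xi>)) = ee (x \<bullet> \<xi>) * exp (- pi * (norm \<xi>)\<^sup>2 / \<rho>\<^sup>2)"
proof -
  have "(LINT y|lborel. complex_of_real (gauss \<rho> (x - y)) * ee (y \<bullet> \<xi>)) =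
    (LINT y|distr lborel borel (\<lambda>y. x + y). complex_of_real (gauss \<rho> (x - y)) * ee (y \<bullet> \<xi>))"
    by (simp add: lborel_distr_plus)
  also have "\<dots> = (LINT y|lborel. ee (x \<bullet> \<xi>) * (complex_of_real (gauss \<rho> y) * ee (y \<bullet> \<xi>)))"
    by (subst integral_distr) (auto simp: gauss_minus inner_add_left ee_add mult_ac)
  also have "\<dots> = ee (x \<bullet> \<xi>) * exp (- pi * (norm \<xi>)\<^sup>2 / \<rho>\<^sup>2)"
    by (simp only: integral_mult_right_zero fourier_gauss[OF assms])
  finally show ?thesis .
qed

text \<open>The weight without normalising factor tends to 1 as \<epsilon> tends to 0, while its
  transform is an approximate identity. It is the regulariser both in Schur's test and in Parseval's
  identity.\<close>

lemma gauss_inverse: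
  fixes w :: "'a::euclidean_space"
  assumes "\<epsilon> > 0"
  shows "(LINT z|lborel. complex_of_real (exp (- pi * \<epsilon>\<^sup>2 * (norm z)\<^sup>2)) * ee (z \<bullet> w)) = gauss (1 / \<epsilon>) w"
proof -
  have "(LINT z|lborel. complex_of_real (exp (- pi * \<epsilon>\<^sup>2 * (norm z)\<^sup>2)) * ee (z \<bullet> w)) =
    (LINT z|lborel. complex_of_real ((1/\<epsilon>) ^ DIM('a)) * (complex_of_real (gauss \<epsilon> z) * ee (z \<bullet> w)))"
    using assms by (intro Bochner_Integration.integral_cong) (auto simp: gauss_def power_divide)
  also have "\<dots> = complex_of_real ((1/\<epsilon>) ^ DIM('a)) * exp (- pi * (norm w)\<^sup>2 / \<epsilon>\<^sup>2)"
    by (simp only: integral_mult_right_zero fourier_gauss[OF assms])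
  also have "\<dots> = gauss (1 / \<epsilon>) w"
    by (simp add: gauss_def power_divide)
  finally show ?thesis .
qed

subsection \<open>Schur's test for oscillatory integrals\<close>

text \<open>A nonintegrable function has Bochner integral 0, which settles the case outside the
  usual norm bound.\<close>

lemma ennreal_norm_integral_le:
  fixes f :: "'a \<Rightarrow> 'b::{banach, second_countable_topology}"
  shows "ennreal (norm (integral\<^sup>L M f)) \<le> (\<integral>\<^sup>+x. norm (f x) \<partial>M)"
  by (cases "integrable M f") (auto simp: integral_norm_bound_ennreal not_integrable_integral_eq)

lemma measurable_cnj [measurable (raw)]:
  "f \<in> borel_measurable M \<Longrightarrow> (\<lambda>x. cnj (f x)) \<in> borel_measurable M"
  by (rule measurable_compose[OF _ borel_measurable_continuous_onI]) (auto intro: continuous_intros)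

lemma integrable_mult_bounded:
  fixes f g :: "'a \<Rightarrow> complex"
  assumes "integrable M f" "g \<in> borel_measurable M" "\<And>x. cmod (g x) \<le> B"
  shows "integrable M (\<lambda>x. f x * g x)"
proof (rule Bochner_Integration.integrable_bound)
  show "integrable M (\<lambda>x. B *\<^sub>R f x)" using assms by auto
  have "B \<ge> 0" using order_trans[OF norm_ge_zero assms(3)] .
  show "AE x in M. norm (f x * g x) \<le> norm (B *\<^sub>R f x)"
    using assms(3) \<open>B \<ge> 0\<close> by (auto simp: norm_mult mult.commute[of B] intro!: mult_left_mono)
qed (use assms in auto)

text \<open>As \<open>u\<close> is bounded, a multiple of \<open>F x * k y\<close> dominates the
  integrand on the product, so Fubini applies. In the applications \<open>u\<close> is a unimodular
  phase.\<close>

lemma (in pair_sigma_finite) Fubini_kernel: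
  fixes F :: "'a \<Rightarrow> complex" and k :: "'b \<Rightarrow> complex"
  assumes F: "integrable M1 F" and k: "integrable M2 k"
    and u[measurable]: "case_prod u \<in> borel_measurable (M1 \<Otimes>\<^sub>M M2)"
    and B: "\<And>x y. cmod (u x y) \<le> B"
  shows "(LINT y|M2. (LINT x|M1. F x * u x y) * k y) = (LINT x|M1. F x * (LINT y|M2. u x y * k y))"
proof -
  have [measurable]: "F \<in> borel_measurable M1" "k \<in> borel_measurable M2"
    using F k by auto
  have 1: "integrable (M1 \<Otimes>\<^sub>M M2) (\<lambda>(x,y). F x * k y)"
    using F k by (intro Fubini_integrable) (auto simp: norm_mult)
  have "integrable (M1 \<Otimes>\<^sub>M M2) (\<lambda>(x,y). (F x * k y) * u x y)"
    using integrable_mult_bounded[OF 1 u, of B] B by (simp add: case_prod_beta')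
  then have "integrable (M1 \<Otimes>\<^sub>M M2) (\<lambda>(x,y). F x * u x y * k y)"
    by (simp add: mult_ac)
  from Fubini_integral[OF this] show ?thesis
    by (simp add: mult.assoc flip: integral_mult_right_zero integral_mult_left_zero)
qed

lemma integrable_exp_neg_norm_sq:
  assumes "\<epsilon> > 0"
  shows "integrable lborel (\<lambda>z::'b::euclidean_space. exp (- pi * \<epsilon>\<^sup>2 * (norm z)\<^sup>2))"
proof -
  have "(\<lambda>z::'b. exp (- pi * \<epsilon>\<^sup>2 * (norm z)\<^sup>2)) = (\<lambda>z. (1/\<epsilon>)^DIM('b) * gauss \<epsilon> z)"
    using assms by (auto simp: gauss_def power_divide)
  then show ?thesis using integrable_gauss[OF assms, where 'a='b] by simp
qed

abbreviation L2sq :: "('a::euclidean_space \<Rightarrow> complex) \<Rightarrow> ennreal" where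
  "L2sq F \<equiv> \<integral>\<^sup>+x. ennreal ((cmod (F x))\<^sup>2) \<partial>lborel"

text \<open>Regularising with a Gaussian turns the \<open>L\<^sup>2\<close> norm into a quadratic form with a positive kernel,
  to which Schur's test applies.\<close>

lemma schur_gauss_aux:
  fixes \<theta> :: "'a::euclidean_space \<Rightarrow> 'b::euclidean_space" and F :: "'a \<Rightarrow> complex"
  assumes [measurable]: "\<theta> \<in> borel_measurable borel" and F: "integrable lborel F"
    and [measurable]: "S \<in> sets borel" and FS: "\<And>\<xi>. \<xi> \<notin> S \<Longrightarrow> F \<xi> = 0" and \<epsilon>: "\<epsilon> > 0"
    and A: "\<And>\<rho> a. \<rho> > 0 \<Longrightarrow> a \<in> S \<Longrightarrow> (\<integral>\<^sup>+\<eta>. ennreal (gauss \<rho> (\<theta> a - \<theta> \<eta>)) * indicator S \<eta> \<partial>lborel) \<le> A"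
  shows "(\<integral>\<^sup>+z. ennreal (exp (- pi * \<epsilon>\<^sup>2 * (norm z)\<^sup>2) * (cmod (LINT \<xi>|lborel. F \<xi> * ee (z \<bullet> \<theta> \<xi>)))\<^sup>2) \<partial>lborel)
       \<le> A * L2sq F"
proof -
  have [measurable]: "F \<in> borel_measurable borel" using F by auto
  define w where "w z = exp (- pi * \<epsilon>\<^sup>2 * (norm z)\<^sup>2)" for z :: 'b
  define g where "g \<xi> \<eta> = gauss (1 / \<epsilon>) (\<theta> \<xi> - \<theta> \<eta>)" for \<xi> \<eta>
  have g0: "g \<xi> \<eta> \<ge> 0" for \<xi> \<eta> using \<epsilon> by (auto simp: g_def)
  have gs: "g \<eta> \<xi> = g \<xi> \<eta>" for \<xi> \<eta> by (simp add: g_def gauss_minus_commute)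
  have [measurable]: "w \<in> borel_measurable borel" "(\<lambda>(x, y). g x y) \<in> borel_measurable (borel \<Otimes>\<^sub>M borel)"
    unfolding w_def g_def by measurable
  define h where "h z = (LINT \<xi>|lborel. F \<xi> * ee (z \<bullet> \<theta> \<xi>))" for z
  have hm[measurable]: "h \<in> borel_measurable borel"
    unfolding h_def by measurable
  have int_w: "integrable lborel w" unfolding w_def using integrable_exp_neg_norm_sq[OF \<epsilon>] .
  define B where "B = (LINT \<xi>|lborel. cmod (F \<xi>))"
  have hB: "cmod (h z) \<le> B" for z
    unfolding h_def B_def by (rule order_trans[OF integral_norm_bound]) (simp add: norm_mult)
  have int1: "integrable lborel (\<lambda>z. complex_of_real (w z) * cnj (h z))"
    by (rule integrable_mult_bounded[where B=B]) (auto simp: int_w hB)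
  have int2: "integrable lborel (\<lambda>z. complex_of_real (w z) * cnj (h z) * h z)"
    by (rule integrable_mult_bounded[OF int1, where B=B]) (auto simp: hB)
  have w0: "w z \<ge> 0" for z by (simp add: w_def)
  have sq: "complex_of_real (w z) * cnj (h z) * h z = complex_of_real (w z * (cmod (h z))\<^sup>2)" for z
    by (simp only: of_real_mult complex_norm_square) (simp add: mult_ac)
  have int3: "integrable lborel (\<lambda>z. w z * (cmod (h z))\<^sup>2)"
    using int2 unfolding sq complex_of_real_integrable_eq .
  have cnjh: "cnj (h z) = (LINT \<eta>|lborel. cnj (F \<eta>) * ee (- (z \<bullet> \<theta> \<eta>)))" for z
    by (simp add: h_def cnj_ee flip: Bochner_Integration.integral_cnj)
  \<comment> \<open>Integrating out z turns the product of the phases of \<xi> and \<eta> into the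
    positive kernel \<open>g \<xi> \<eta>\<close>, by \<open>gauss_inverse\<close>.\<close>
  have inner: "(LINT z|lborel. ee (z \<bullet> \<theta> \<xi>) * (complex_of_real (w z) * cnj (h z)))
      = (LINT \<eta>|lborel. cnj (F \<eta>) * g \<xi> \<eta>)" for \<xi>
  proof -
    have e: "ee (- (z \<bullet> \<theta> \<eta>)) * (complex_of_real (w z) * ee (z \<bullet> \<theta> \<xi>))
        = complex_of_real (w z) * ee (z \<bullet> (\<theta> \<xi> - \<theta> \<eta>))" for z \<eta>
      using ee_add[of "z \<bullet> \<theta> \<xi>" "- (z \<bullet> \<theta> \<eta>)"] by (simp add: inner_diff_right mult_ac)
    have "(LINT z|lborel. ee (z \<bullet> \<theta> \<xi>) * (complex_of_real (w z) * cnj (h z)))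
        = (LINT z|lborel. (LINT \<eta>|lborel. cnj (F \<eta>) * ee (- (z \<bullet> \<theta> \<eta>))) * (complex_of_real (w z) * ee (z \<bullet> \<theta> \<xi>)))"
      by (simp add: cnjh mult_ac)
    also have "\<dots> = (LINT \<eta>|lborel. cnj (F \<eta>) * (LINT z|lborel. ee (- (z \<bullet> \<theta> \<eta>)) * (complex_of_real (w z) * ee (z \<bullet> \<theta> \<xi>))))"
      by (rule lborel_pair.Fubini_kernel[where B=1])
         (auto simp: F int_w intro!: integrable_mult_bounded[where B=1])
    also have "\<dots> = (LINT \<eta>|lborel. cnj (F \<eta>) * (LINT z|lborel. complex_of_real (w z) * ee (z \<bullet> (\<theta> \<xi> - \<theta> \<eta>))))"
      by (simp only: e)
    also have "\<dots> = (LINT \<eta>|lborel. cnj (F \<eta>) * g \<xi> \<eta>)"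
      by (simp only: w_def gauss_inverse[OF \<epsilon>] g_def)
    finally show ?thesis .
  qed
  have Fub: "(LINT z|lborel. h z * (complex_of_real (w z) * cnj (h z)))
      = (LINT \<xi>|lborel. F \<xi> * (LINT z|lborel. ee (z \<bullet> \<theta> \<xi>) * (complex_of_real (w z) * cnj (h z))))"
    using lborel_pair.Fubini_kernel[OF F int1, of "\<lambda>\<xi> z. ee (z \<bullet> \<theta> \<xi>)" 1] by (simp add: h_def)
  have "complex_of_real (LINT z|lborel. w z * (cmod (h z))\<^sup>2) = (LINT z|lborel. h z * (complex_of_real (w z) * cnj (h z)))"
    unfolding integral_complex_of_real[symmetric] sq[symmetric] by (simp add: mult_ac)
  also have "\<dots> = (LINT \<xi>|lborel. F \<xi> * (LINT z|lborel. ee (z \<bullet> \<theta> \<xi>) * (complex_of_real (w z) * cnj (h z))))"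
    unfolding h_def[symmetric] by (rule Fub)
  also have "\<dots> = (LINT \<xi>|lborel. F \<xi> * (LINT \<eta>|lborel. cnj (F \<eta>) * g \<xi> \<eta>))"
    by (simp only: inner)
  finally have eq: "complex_of_real (LINT z|lborel. w z * (cmod (h z))\<^sup>2) = \<dots>" .
  have "(\<integral>\<^sup>+z. ennreal (w z * (cmod (h z))\<^sup>2) \<partial>lborel) = ennreal (LINT z|lborel. w z * (cmod (h z))\<^sup>2)"
    using int3 w0 by (intro nn_integral_eq_integral) auto
  also have "\<dots> \<le> ennreal (cmod (complex_of_real (LINT z|lborel. w z * (cmod (h z))\<^sup>2)))"
    by (simp add: ennreal_leI)
  also have "\<dots> \<le> (\<integral>\<^sup>+\<xi>. cmod (F \<xi> * (LINT \<eta>|lborel. cnj (F \<eta>) * g \<xi> \<eta>)) \<partial>lborel)"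
    unfolding eq by (rule ennreal_norm_integral_le)
  also have "\<dots> \<le> (\<integral>\<^sup>+\<xi>. ennreal (cmod (F \<xi>)) * (\<integral>\<^sup>+\<eta>. cmod (F \<eta>) * g \<xi> \<eta> \<partial>lborel) \<partial>lborel)"
  proof (rule nn_integral_mono)
    fix \<xi>
    have "ennreal (cmod (LINT \<eta>|lborel. cnj (F \<eta>) * g \<xi> \<eta>)) \<le> (\<integral>\<^sup>+\<eta>. cmod (F \<eta>) * g \<xi> \<eta> \<partial>lborel)"
      using ennreal_norm_integral_le[of lborel "\<lambda>\<eta>. cnj (F \<eta>) * g \<xi> \<eta>"] g0 by (simp add: norm_mult)
    then show "ennreal (cmod (F \<xi> * (LINT \<eta>|lborel. cnj (F \<eta>) * g \<xi> \<eta>))) \<le> ennreal (cmod (F \<xi>)) * (\<integral>\<^sup>+\<eta>. cmod (F \<eta>) * g \<xi> \<eta> \<partial>lborel)"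
      by (simp add: norm_mult ennreal_mult mult_left_mono)
  qed
  also have "\<dots> = (\<integral>\<^sup>+\<xi>. (\<integral>\<^sup>+\<eta>. ennreal (cmod (F \<xi>) * cmod (F \<eta>) * g \<xi> \<eta>) \<partial>lborel) \<partial>lborel)"
    using g0 by (subst nn_integral_cmult[symmetric]) (auto simp: ennreal_mult[symmetric] mult.assoc)
  \<comment> \<open>Arithmetic-geometric mean: each square is then integrated against
    \<open>g\<close> in the other variable, where the hypothesis on \<open>A\<close> applies. The
    indicators are kept because that hypothesis integrates over \<open>S\<close> only; they cost
    nothing, as \<open>F\<close> vanishes off \<open>S\<close>.\<close>
  also have "\<dots> \<le> (\<integral>\<^sup>+\<xi>. (\<integral>\<^sup>+\<eta>. ennreal ((cmod (F \<xi>))\<^sup>2 / 2) * (ennreal (g \<xi> \<eta>) * indicator S \<eta>)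
        + ennreal ((cmod (F \<eta>))\<^sup>2 / 2) * (ennreal (g \<eta> \<xi>) * indicator S \<xi>) \<partial>lborel) \<partial>lborel)"
  proof (intro nn_integral_mono)
    fix \<xi> \<eta>
    have "cmod (F \<xi>) * cmod (F \<eta>) \<le> (cmod (F \<xi>))\<^sup>2 / 2 + (cmod (F \<eta>))\<^sup>2 / 2"
      using sum_squares_bound[of "cmod (F \<xi>)" "cmod (F \<eta>)"] by (simp add: field_simps)
    then have *: "cmod (F \<xi>) * cmod (F \<eta>) * g \<xi> \<eta> \<le> (cmod (F \<xi>))\<^sup>2 / 2 * g \<xi> \<eta> + (cmod (F \<eta>))\<^sup>2 / 2 * g \<eta> \<xi>"
      unfolding gs[of \<eta> \<xi>] distrib_right[symmetric] by (rule mult_right_mono) (rule g0)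
    show "ennreal (cmod (F \<xi>) * cmod (F \<eta>) * g \<xi> \<eta>) \<le> ennreal ((cmod (F \<xi>))\<^sup>2 / 2) * (ennreal (g \<xi> \<eta>) * indicator S \<eta>)
        + ennreal ((cmod (F \<eta>))\<^sup>2 / 2) * (ennreal (g \<eta> \<xi>) * indicator S \<xi>)"
    proof (cases "\<xi> \<in> S \<and> \<eta> \<in> S")
      case True
      then show ?thesis using ennreal_leI[OF *] g0 by (simp add: ennreal_mult[symmetric] ennreal_plus[symmetric] del: ennreal_plus)
    qed (auto simp: FS)
  qed
  also have "\<dots> = (\<integral>\<^sup>+\<xi>. (\<integral>\<^sup>+\<eta>. ennreal ((cmod (F \<xi>))\<^sup>2 / 2) * (ennreal (g \<xi> \<eta>) * indicator S \<eta>) \<partial>lborel) \<partial>lborel)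
        + (\<integral>\<^sup>+\<xi>. (\<integral>\<^sup>+\<eta>. ennreal ((cmod (F \<eta>))\<^sup>2 / 2) * (ennreal (g \<eta> \<xi>) * indicator S \<xi>) \<partial>lborel) \<partial>lborel)"
    by (simp add: nn_integral_add)
  also have "(\<integral>\<^sup>+\<xi>. (\<integral>\<^sup>+\<eta>. ennreal ((cmod (F \<eta>))\<^sup>2 / 2) * (ennreal (g \<eta> \<xi>) * indicator S \<xi>) \<partial>lborel) \<partial>lborel)
     = (\<integral>\<^sup>+\<eta>. (\<integral>\<^sup>+\<xi>. ennreal ((cmod (F \<eta>))\<^sup>2 / 2) * (ennreal (g \<eta> \<xi>) * indicator S \<xi>) \<partial>lborel) \<partial>lborel)"
    by (rule lborel_pair.Fubini') measurable
  also have "(\<integral>\<^sup>+\<xi>. (\<integral>\<^sup>+\<eta>. ennreal ((cmod (F \<xi>))\<^sup>2 / 2) * (ennreal (g \<xi> \<eta>) * indicator S \<eta>) \<partial>lborel) \<partial>lborel)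
     \<le> (\<integral>\<^sup>+\<xi>. ennreal ((cmod (F \<xi>))\<^sup>2 / 2) * A \<partial>lborel)"
  proof (rule nn_integral_mono)
    fix \<xi>
    have "(\<integral>\<^sup>+\<eta>. ennreal ((cmod (F \<xi>))\<^sup>2 / 2) * (ennreal (g \<xi> \<eta>) * indicator S \<eta>) \<partial>lborel) =
       ennreal ((cmod (F \<xi>))\<^sup>2 / 2) * (\<integral>\<^sup>+\<eta>. (ennreal (g \<xi> \<eta>) * indicator S \<eta>) \<partial>lborel)"
      by (rule nn_integral_cmult) measurable
    also have "\<dots> \<le> ennreal ((cmod (F \<xi>))\<^sup>2 / 2) * A"
      using A[of "1/\<epsilon>" \<xi>] FS[of \<xi>] \<epsilon> by (cases "\<xi> \<in> S") (auto simp: g_def intro!: mult_left_mono)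
    finally show "(\<integral>\<^sup>+\<eta>. ennreal ((cmod (F \<xi>))\<^sup>2 / 2) * (ennreal (g \<xi> \<eta>) * indicator S \<eta>) \<partial>lborel)
       \<le> ennreal ((cmod (F \<xi>))\<^sup>2 / 2) * A" .
  qed
  also have "(\<integral>\<^sup>+\<xi>. ennreal ((cmod (F \<xi>))\<^sup>2 / 2) * A \<partial>lborel) + (\<integral>\<^sup>+\<xi>. ennreal ((cmod (F \<xi>))\<^sup>2 / 2) * A \<partial>lborel)
      = A * L2sq F"
  proof -
    have "(\<integral>\<^sup>+\<xi>. ennreal ((cmod (F \<xi>))\<^sup>2 / 2) * A \<partial>lborel) + (\<integral>\<^sup>+\<xi>. ennreal ((cmod (F \<xi>))\<^sup>2 / 2) * A \<partial>lborel)
      = (\<integral>\<^sup>+\<xi>. ennreal ((cmod (F \<xi>))\<^sup>2) * A \<partial>lborel)"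
      by (subst nn_integral_add[symmetric])
        (auto simp: distrib_right[symmetric] ennreal_plus[symmetric] simp del: ennreal_plus)
    also have "\<dots> = A * L2sq F"
      by (subst nn_integral_multc) (auto simp: mult.commute)
    finally show ?thesis .
  qed
  finally show ?thesis by (simp add: w_def h_def add_mono)
qed

text \<open>Fatou's lemma removes the weight: with \<open>\<epsilon> = 1 / Suc n\<close> it tends to
  1, and \<open>A\<close> is uniform in the width of the Gaussian.\<close>

lemma schur_gauss:
  fixes \<theta> :: "'a::euclidean_space \<Rightarrow> 'b::euclidean_space" and F :: "'a \<Rightarrow> complex"
  assumes [measurable]: "\<theta> \<in> borel_measurable borel" and F: "integrable lborel F"
    and [measurable]: "S \<in> sets borel" and FS: "\<And>\<xi>. \<xi> \<notin> S \<Longrightarrow> F \<xi> = 0"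
    and A: "\<And>\<rho> a. \<rho> > 0 \<Longrightarrow> a \<in> S \<Longrightarrow> (\<integral>\<^sup>+\<eta>. ennreal (gauss \<rho> (\<theta> a - \<theta> \<eta>)) * indicator S \<eta> \<partial>lborel) \<le> A"
  shows "L2sq (\<lambda>z. LINT \<xi>|lborel. F \<xi> * ee (z \<bullet> \<theta> \<xi>))
       \<le> A * L2sq F"
proof -
  have [measurable]: "F \<in> borel_measurable borel" using F by auto
  define h where "h z = (cmod (LINT \<xi>|lborel. F \<xi> * ee (z \<bullet> \<theta> \<xi>)))\<^sup>2" for z
  define u where "u n z = ennreal (exp (- pi * (1 / Suc n)\<^sup>2 * (norm z)\<^sup>2) * h z)" for n z
  have [measurable]: "h \<in> borel_measurable borel"
    unfolding h_def by measurable
  have [measurable]: "u n \<in> borel_measurable borel" for n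
    unfolding u_def by measurable
  have lim: "(\<lambda>n. u n z) \<longlonglongrightarrow> ennreal (h z)" for z
  proof -
    have "(\<lambda>n. exp (- pi * (1 / Suc n)\<^sup>2 * (norm z)\<^sup>2) * h z) \<longlonglongrightarrow> exp (- pi * 0\<^sup>2 * (norm z)\<^sup>2) * h z"
      using LIMSEQ_inverse_real_of_nat by (intro tendsto_intros) (simp add: inverse_eq_divide)
    then show ?thesis unfolding u_def by (intro tendsto_ennrealI) simp
  qed
  have "(\<integral>\<^sup>+z. ennreal (h z) \<partial>lborel) = (\<integral>\<^sup>+z. liminf (\<lambda>n. u n z) \<partial>lborel)"
    by (simp add: lim_imp_Liminf[OF _ lim])
  also have "\<dots> \<le> liminf (\<lambda>n. \<integral>\<^sup>+z. u n z \<partial>lborel)"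
    by (rule nn_integral_liminf) simp
  also have "\<dots> \<le> A * L2sq F"
    unfolding u_def h_def
    by (intro Liminf_le always_eventually allI schur_gauss_aux[where S=S] F FS A) auto
  finally show ?thesis by (simp add: h_def)
qed

subsection \<open>Local smoothing\<close>

text \<open>It serves three purposes: it moves a frequency along the i-th axis, puts a frozen value
  into the i-th slot of a point, and, as \<open>upd \<xi> i (P \<xi>)\<close>, is the map that
  replaces a frequency coordinate by the symbol.\<close>

definition upd :: "real^'n \<Rightarrow> 'n \<Rightarrow> real \<Rightarrow> real^'n" where
  "upd z i s = (\<chi> j. if j = i then s else z $ j)"

lemma upd_nth: "upd z i s $ j = (if j = i then s else z $ j)"
  by (simp add: upd_def)

lemma upd_same [simp]: "upd z i s $ i = s"
  by (simp add: upd_def)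

lemma upd_upd [simp]: "upd (upd z i s) i t = upd z i t"
  by (simp add: upd_def vec_eq_iff)

lemma bij_betw_axis: "bij_betw (\<lambda>j. axis j (1::real)) UNIV (Basis :: (real^'n) set)"
  by (auto simp: bij_betw_def inj_on_def axis_eq_axis Basis_vec_def)

lemma prod_Basis_vec: "(\<Prod>b\<in>(Basis :: (real^'n) set). f b) = (\<Prod>j\<in>UNIV. f (axis j 1))"
  by (rule prod.reindex_bij_betw[OF bij_betw_axis, symmetric])

lemma measurable_vec_nth [measurable (raw)]:
  "f \<in> borel_measurable M \<Longrightarrow> (\<lambda>x. (f x :: real^'n) $ j) \<in> borel_measurable M"
  by (rule measurable_compose[OF _ borel_measurable_continuous_onI]) (auto intro: continuous_intros)

lemma measurable_upd [measurable (raw)]: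
  fixes f :: "'b \<Rightarrow> real^'n"
  assumes [measurable]: "f \<in> borel_measurable M" "g \<in> borel_measurable M"
  shows "(\<lambda>x. upd (f x) i (g x)) \<in> borel_measurable M"
  unfolding borel_measurable_euclidean_space[of "\<lambda>x. upd (f x) i (g x)"]
proof
  fix b :: "real^'n" assume "b \<in> Basis"
  then obtain j where b: "b = axis j 1" by (auto simp: Basis_vec_def)
  show "(\<lambda>x. upd (f x) i (g x) \<bullet> b) \<in> borel_measurable M"
    unfolding b inner_axis upd_nth by (cases "j = i") auto
qed

lemma emeasure_box_vec:
  fixes l u :: "real^'n"
  assumes "\<And>j. l $ j \<le> u $ j"
  shows "emeasure lborel (box l u) = (\<Prod>j\<in>UNIV. ennreal (u $ j - l $ j))"
proof -
  have "emeasure lborel (box l u) = ennreal (\<Prod>b\<in>Basis. (u - l) \<bullet> b)"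
    using assms by (intro emeasure_lborel_box) (auto simp: Basis_vec_def inner_axis)
  also have "\<dots> = (\<Prod>j\<in>UNIV. ennreal (u $ j - l $ j))"
    using assms by (simp add: prod_Basis_vec inner_axis prod_ennreal)
  finally show ?thesis .
qed

lemma box_Pair_eq: "box (a, b) (c, d) = box a c \<times> box b d"
  by (force simp: box_def Basis_prod_def)

text \<open>The map transposes two of the n + 1 coordinates, so the preimage of a box is a box with
  the same side lengths in another order. It exchanges the i-th space coordinate with an extra real
  variable such as time.\<close>

lemma lborel_swap_coordinate:
  "lborel = distr (lborel :: ((real^'n) \<times> real) measure) borel (\<lambda>(z, s). (upd z i s, z $ i))"
proof (rule lborel_eqI)
  let ?T = "\<lambda>(z, s). (upd z i s, z $ i)"
  fix l u :: "(real^'n) \<times> real"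
  assume lu: "\<And>b. b \<in> Basis \<Longrightarrow> l \<bullet> b \<le> u \<bullet> b"
  obtain l1 l2 u1 u2 where l: "l = (l1, l2)" and u: "u = (u1, u2)" by (cases l; cases u)
  have 1: "l1 $ j \<le> u1 $ j" for j
    using lu[of "(axis j 1, 0)"] by (auto simp: l u Basis_prod_def inner_axis)
  have 2: "l2 \<le> u2"
    using lu[of "(0, 1)"] by (auto simp: l u Basis_prod_def)
  have T[measurable]: "?T \<in> borel_measurable (borel :: ((real^'n) \<times> real) measure)"
    unfolding borel_prod[symmetric] by measurable
  have vim: "?T -` box l u = box (upd l1 i l2) (upd u1 i u2) \<times> box (l1 $ i) (u1 $ i)"
    unfolding l u box_Pair_eq
    by (auto simp: mem_box_cart upd_nth split: if_splits)
  have em: "emeasure lborel (A \<times> B) = emeasure lborel A * emeasure lborel B"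
    if "A \<in> sets borel" "B \<in> sets borel" for A :: "(real^'n) set" and B :: "real set"
    unfolding lborel_prod[symmetric] using that by (subst lborel.emeasure_pair_measure_Times) auto
  have up: "(\<Prod>j\<in>UNIV. f j) = f i * (\<Prod>j\<in>UNIV - {i}. f j)" for f :: "'n \<Rightarrow> ennreal"
    by (rule prod.remove) auto
  have bas: "(\<Prod>b\<in>Basis. (u - l) \<bullet> b) = (\<Prod>j\<in>UNIV. (u1 $ j - l1 $ j)) * (u2 - l2)"
  proof -
    have "(\<Prod>b\<in>Basis. (u - l) \<bullet> b) = (\<Prod>b\<in>Basis. (u1 - l1) \<bullet> b) * (u2 - l2)"
      unfolding Basis_prod_def
      by (subst prod.union_disjoint) (auto simp: l u prod.reindex inj_on_def)
    then show ?thesis by (simp add: prod_Basis_vec inner_axis)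
  qed
  have "emeasure (distr lborel borel ?T) (box l u) = emeasure lborel (?T -` box l u)"
    by (subst emeasure_distr) auto
  also have "\<dots> = emeasure lborel (box (upd l1 i l2) (upd u1 i u2)) * emeasure lborel (box (l1 $ i) (u1 $ i))"
    unfolding vim by (rule em) auto
  also have "\<dots> = (ennreal (u2 - l2) * (\<Prod>j\<in>UNIV - {i}. ennreal (u1 $ j - l1 $ j))) * ennreal (u1 $ i - l1 $ i)"
    using 1 2 by (subst emeasure_box_vec) (auto simp: upd_nth up box_real)
  also have "\<dots> = (\<Prod>j\<in>UNIV. ennreal (u1 $ j - l1 $ j)) * ennreal (u2 - l2)"
    by (simp add: up mult_ac)
  also have "\<dots> = ennreal (\<Prod>b\<in>Basis. (u - l) \<bullet> b)"
    unfolding bas using 1 2 by (simp add: prod_ennreal ennreal_mult prod_nonneg)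
  finally show "emeasure (distr lborel borel ?T) (box l u) = ennreal (\<Prod>b\<in>Basis. (u - l) \<bullet> b)" .
qed simp

lemma nn_integral_swap_coordinate:
  fixes h :: "real^'n \<Rightarrow> real \<Rightarrow> ennreal"
  assumes [measurable]: "case_prod h \<in> borel_measurable (borel \<Otimes>\<^sub>M borel)"
  shows "(\<integral>\<^sup>+z. \<integral>\<^sup>+s. h z s \<partial>lborel \<partial>lborel) = (\<integral>\<^sup>+z. \<integral>\<^sup>+s. h (upd z i s) (z $ i) \<partial>lborel \<partial>lborel)"
proof -
  have T[measurable]: "(\<lambda>(z, s). (upd z i s, z $ i)) \<in> borel_measurable (borel :: ((real^'n) \<times> real) measure)"
    unfolding borel_prod[symmetric] by measurable
  have hm: "case_prod h \<in> borel_measurable borel" using assms by (simp add: borel_prod)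
  have "(\<integral>\<^sup>+z. \<integral>\<^sup>+s. h z s \<partial>lborel \<partial>lborel) = (\<integral>\<^sup>+p. case_prod h p \<partial>lborel)"
    unfolding lborel_prod[symmetric] by (subst lborel.nn_integral_fst[symmetric]) auto
  also have "\<dots> = (\<integral>\<^sup>+p. case_prod h (case p of (z, s) \<Rightarrow> (upd z i s, z $ i)) \<partial>lborel)"
    by (subst lborel_swap_coordinate[of i], subst nn_integral_distr) (auto simp: hm)
  also have "\<dots> = (\<integral>\<^sup>+z. \<integral>\<^sup>+s. h (upd z i s) (z $ i) \<partial>lborel \<partial>lborel)"
    unfolding lborel_prod[symmetric] by (subst lborel.nn_integral_fst[symmetric]) auto
  finally show ?thesis .
qed

text \<open>If \<open>p\<close> expands distances by a factor \<open>c\<close> and \<open>s\<^sub>0\<close> minimises \<open>\<bar>b - p s\<bar>\<close>, then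
  \<open>\<bar>b - p s\<bar> \<ge> c \<bar>s - s\<^sub>0\<bar> / 2\<close>; no change of variables is needed.\<close>

lemma nn_integral_gauss_expanding:
  fixes p :: "real \<Rightarrow> real"
  assumes T: "compact T" and p: "continuous_on T p" and c: "c > 0" and \<rho>: "\<rho> > 0"
    and ex: "\<And>s s'. s \<in> T \<Longrightarrow> s' \<in> T \<Longrightarrow> c * \<bar>s - s'\<bar> \<le> \<bar>p s - p s'\<bar>"
  shows "(\<integral>\<^sup>+s. ennreal (gauss \<rho> (b - p s)) * indicator T s \<partial>lborel) \<le> ennreal (2 / c)"
proof (cases "T = {}")
  case False
  have "continuous_on T (\<lambda>s. \<bar>b - p s\<bar>)" using p by (intro continuous_intros)
  from continuous_attains_inf[OF T False this] obtain s0 where s0: "s0 \<in> T"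
    and min: "\<And>s. s \<in> T \<Longrightarrow> \<bar>b - p s0\<bar> \<le> \<bar>b - p s\<bar>" by auto
  have "(\<integral>\<^sup>+s. ennreal (gauss \<rho> (b - p s)) * indicator T s \<partial>lborel) \<le>
     (\<integral>\<^sup>+s. ennreal (2 / c) * ennreal (gauss (\<rho> * c / 2) (s0 - s)) \<partial>lborel)"
  proof (rule nn_integral_mono)
    fix s
    show "ennreal (gauss \<rho> (b - p s)) * indicator T s \<le> ennreal (2 / c) * ennreal (gauss (\<rho> * c / 2) (s0 - s))"
    proof (cases "s \<in> T")
      case True
      have "c * \<bar>s - s0\<bar> \<le> 2 * \<bar>b - p s\<bar>"
      proof -
        have "c * \<bar>s - s0\<bar> \<le> \<bar>p s - p s0\<bar>" by (rule ex[OF True s0])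
        also have "\<dots> \<le> \<bar>b - p s\<bar> + \<bar>b - p s0\<bar>" by arith
        also have "\<dots> \<le> 2 * \<bar>b - p s\<bar>" using min[OF True] by simp
        finally show ?thesis .
      qed
      then have "\<bar>c / 2 * (s0 - s)\<bar> \<le> \<bar>b - p s\<bar>"
        using c by (simp add: abs_mult abs_minus_commute)
      then have "(c / 2 * (s0 - s))\<^sup>2 \<le> (b - p s)\<^sup>2"
        by (simp only: abs_le_square_iff)
      then have "pi * \<rho>\<^sup>2 * (c / 2 * (s0 - s))\<^sup>2 \<le> pi * \<rho>\<^sup>2 * (b - p s)\<^sup>2"
        by (intro mult_left_mono) auto
      then have "gauss \<rho> (b - p s) \<le> 2 / c * gauss (\<rho> * c / 2) (s0 - s)"
      proof -
        \<comment> \<open>Dilation by \<open>c / 2\<close> changes the normalisation of the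
          Gaussian; \<open>2 / c\<close> restores it and becomes the final bound, since the dilated
          Gaussian has mass 1.\<close>
        have 1: "2 / c * gauss (\<rho> * c / 2) (s0 - s) = \<rho> * exp (- (pi * \<rho>\<^sup>2 * (c / 2 * (s0 - s))\<^sup>2))"
          using c by (simp add: gauss_real power_mult_distrib power_divide)
        have 2: "gauss \<rho> (b - p s) = \<rho> * exp (- (pi * \<rho>\<^sup>2 * (b - p s)\<^sup>2))"
          by (simp add: gauss_real)
        have "exp (- (pi * \<rho>\<^sup>2 * (b - p s)\<^sup>2)) \<le> exp (- (pi * \<rho>\<^sup>2 * (c / 2 * (s0 - s))\<^sup>2))"
          using \<open>pi * _ * _ \<le> _\<close> by simp
        then show ?thesis unfolding 1 2 using \<rho> by (intro mult_left_mono) auto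
      qed
      then show ?thesis using True c \<rho> by (simp add: ennreal_mult[symmetric])
    qed simp
  qed
  also have "\<dots> = ennreal (2 / c)"
    using \<rho> c by (subst nn_integral_cmult) (auto simp: nn_integral_gauss_diff)
  finally show ?thesis .
qed simp

text \<open>This is the kernel bound for Schur's test with
  \<open>\<theta> \<xi> = upd \<xi> i (P \<xi>)\<close>. On each line parallel to the i-th axis it
  reduces to \<open>nn_integral_gauss_expanding\<close>, and the lines are averaged with total
  weight 1.\<close>

lemma nn_integral_gauss_slab:
  fixes P :: "real^'n \<Rightarrow> real"
  assumes P[measurable]: "P \<in> borel_measurable borel" and S: "compact S" and cont: "continuous_on S P"
    and c: "c > 0" and \<rho>: "\<rho> > 0"
    and ex: "\<And>\<xi> s. \<xi> \<in> S \<Longrightarrow> upd \<xi> i s \<in> S \<Longrightarrow> c * \<bar>s - \<xi> $ i\<bar> \<le> \<bar>P (upd \<xi> i s) - P \<xi>\<bar>"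
  shows "(\<integral>\<^sup>+\<eta>. ennreal (gauss \<rho> (x - upd \<eta> i (P \<eta>))) * indicator S \<eta> \<partial>lborel) \<le> ennreal (2 / c)"
proof -
  have [measurable]: "S \<in> sets borel" using S by (simp add: compact_imp_closed)
  define G where "G \<eta> = (\<Prod>j\<in>UNIV - {i}. gauss \<rho> (x $ j - \<eta> $ j))" for \<eta> :: "real^'n"
  have G0: "G \<eta> \<ge> 0" for \<eta> using \<rho> by (auto simp: G_def intro!: prod_nonneg)
  have [measurable]: "G \<in> borel_measurable borel" unfolding G_def by measurable
  have G1: "gauss \<rho> (x - \<eta>) = gauss \<rho> (x $ i - \<eta> $ i) * G \<eta>" for \<eta>
    unfolding G_def
    by (simp add: gauss_prod[of _ "x - \<eta>"] prod_Basis_vec inner_axis prod.remove[of UNIV i])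
  have G2: "G (upd \<eta> i s) = G \<eta>" for \<eta> s
    by (auto simp: G_def upd_nth intro!: prod.cong)
  have G3: "gauss \<rho> (x - upd \<eta> i s) = gauss \<rho> (x $ i - s) * G \<eta>" for \<eta> s
    by (simp add: G1 G2)
  define H where "H \<eta> = ennreal (gauss \<rho> (x - upd \<eta> i (P \<eta>))) * indicator S \<eta>" for \<eta>
  have [measurable]: "H \<in> borel_measurable borel" unfolding H_def by measurable
  have inner: "(\<integral>\<^sup>+s. ennreal (gauss \<rho> (x $ i - P (upd \<eta> i s))) * indicator S (upd \<eta> i s) \<partial>lborel) \<le> ennreal (2 / c)" for \<eta>
  proof -
    \<comment> \<open>The slice of \<open>S\<close> along the i-th axis. Its compactness provides
      the minimising point on which the one-dimensional estimate rests.\<close>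
    define T where "T = {s. upd \<eta> i s \<in> S}"
    have cu: "continuous_on A (\<lambda>s. upd \<eta> i s)" for A
      unfolding upd_def continuous_on_vec_lambda
      apply (rule continuous_on_vec_lambda)
      subgoal for j by (cases "j = i") auto
      done
    have "closed T"
      unfolding T_def using compact_imp_closed[OF S] cu[of UNIV]
      by (metis closed_vimage vimage_def)
    moreover have "bounded T"
    proof -
      obtain B where "\<And>\<xi>. \<xi> \<in> S \<Longrightarrow> norm \<xi> \<le> B" using compact_imp_bounded[OF S] by (auto simp: bounded_iff)
      then have "\<bar>s\<bar> \<le> B" if "s \<in> T" for s
        using that component_le_norm_cart[of "upd \<eta> i s" i] by (auto simp: T_def intro: order_trans)
      then show ?thesis by (auto simp: bounded_iff)
    qed
    ultimately have "compact T" by (simp add: compact_eq_bounded_closed)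
    moreover have "continuous_on T (\<lambda>s. P (upd \<eta> i s))"
      by (rule continuous_on_compose2[OF cont cu]) (auto simp: T_def)
    moreover have "c * \<bar>s - s'\<bar> \<le> \<bar>P (upd \<eta> i s) - P (upd \<eta> i s')\<bar>" if "s \<in> T" "s' \<in> T" for s s'
      using ex[of "upd \<eta> i s'" s] that by (auto simp: T_def)
    ultimately have "(\<integral>\<^sup>+s. ennreal (gauss \<rho> (x $ i - P (upd \<eta> i s))) * indicator T s \<partial>lborel) \<le> ennreal (2 / c)"
      using c \<rho> by (intro nn_integral_gauss_expanding)
    then show ?thesis by (simp add: T_def indicator_def)
  qed
  \<comment> \<open>A dummy variable s carrying a Gaussian of mass 1 is inserted and exchanged with
    the i-th coordinate of \<eta>. The inner integral then runs along a line, and the dummy factor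
    completes \<open>G\<close> to the full Gaussian
    \<open>gauss \<rho> (x - \<eta>)\<close>.\<close>
  have "(\<integral>\<^sup>+\<eta>. H \<eta> \<partial>lborel) = (\<integral>\<^sup>+\<eta>. \<integral>\<^sup>+s. H \<eta> * ennreal (gauss \<rho> (x $ i - s)) \<partial>lborel \<partial>lborel)"
    using \<rho> by (simp add: nn_integral_cmult nn_integral_gauss_diff)
  also have "\<dots> = (\<integral>\<^sup>+\<eta>. \<integral>\<^sup>+s. H (upd \<eta> i s) * ennreal (gauss \<rho> (x $ i - \<eta> $ i)) \<partial>lborel \<partial>lborel)"
    by (rule nn_integral_swap_coordinate) measurable
  also have "\<dots> = (\<integral>\<^sup>+\<eta>. \<integral>\<^sup>+s. ennreal (gauss \<rho> (x - \<eta>)) *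
        (ennreal (gauss \<rho> (x $ i - P (upd \<eta> i s))) * indicator S (upd \<eta> i s)) \<partial>lborel \<partial>lborel)"
    using G0 \<rho> by (simp add: H_def G1[of "_"] G3 G2 ennreal_mult mult_ac)
  also have "\<dots> = (\<integral>\<^sup>+\<eta>. ennreal (gauss \<rho> (x - \<eta>)) * (\<integral>\<^sup>+s.
        (ennreal (gauss \<rho> (x $ i - P (upd \<eta> i s))) * indicator S (upd \<eta> i s)) \<partial>lborel) \<partial>lborel)"
    by (simp add: nn_integral_cmult)
  also have "\<dots> \<le> (\<integral>\<^sup>+\<eta>. ennreal (gauss \<rho> (x - \<eta>)) * ennreal (2 / c) \<partial>lborel)"
    by (intro nn_integral_mono mult_left_mono inner) auto
  also have "\<dots> = ennreal (2 / c)"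
    using \<rho> by (simp add: nn_integral_multc nn_integral_gauss_diff)
  finally show ?thesis by (simp add: H_def)
qed

text \<open>The solution with Fourier data \<open>F\<close>, written as an ordinary integral. For
  integrable \<open>F\<close> it is continuous in t and x, so it has genuine values at every point
  and can be tested against \<mu>.\<close>

definition wave :: "(real^'n \<Rightarrow> real) \<Rightarrow> (real^'n \<Rightarrow> complex) \<Rightarrow> real \<Rightarrow> real^'n \<Rightarrow> complex" where
  "wave P F t x = (LINT \<xi>|lborel. F \<xi> * ee (x \<bullet> \<xi> + t * P \<xi>))"

lemma measurable_wave [measurable (raw)]:
  assumes [measurable]: "P \<in> borel_measurable borel" "F \<in> borel_measurable borel"
    "f \<in> borel_measurable M" "g \<in> borel_measurable M"
  shows "(\<lambda>z. wave P F (f z) (g z)) \<in> borel_measurable M"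
  unfolding wave_def by measurable

text \<open>With \<open>y $ i = s\<close> frozen, the phase is \<open>s * \<xi> $ i\<close> plus a
  linear form in \<open>upd \<xi> i (P \<xi>)\<close>; the first term contributes a unimodular
  factor, absorbed into \<open>F\<close>. Schur's test in t and the remaining coordinates bounds
  every slice by the same multiple of \<open>L2sq F\<close>. A weight that depends on
  \<open>y $ i\<close> alone therefore factors out, which is why \<open>w\<close> is compared with
  \<omega>.\<close>

lemma local_smoothing:
  fixes P :: "real^'n \<Rightarrow> real"
  assumes P[measurable]: "P \<in> borel_measurable borel" and F: "integrable lborel F"
    and S: "compact S" and FS: "\<And>\<xi>. \<xi> \<notin> S \<Longrightarrow> F \<xi> = 0" and cont: "continuous_on S P"
    and c: "c > 0"
    and ex: "\<And>\<xi> s. \<xi> \<in> S \<Longrightarrow> upd \<xi> i s \<in> S \<Longrightarrow> c * \<bar>s - \<xi> $ i\<bar> \<le> \<bar>P (upd \<xi> i s) - P \<xi>\<bar>"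
    and [measurable]: "w \<in> borel_measurable borel" "\<omega> \<in> borel_measurable borel"
    and w\<omega>: "\<And>y. w y \<le> \<omega> (y $ i)"
  shows "(\<integral>\<^sup>+y. w y * L2sq (\<lambda>t. wave P F t y) \<partial>lborel)
     \<le> (\<integral>\<^sup>+s. \<omega> s \<partial>lborel) * (ennreal (2 / c) * L2sq F)"
proof -
  have [measurable]: "F \<in> borel_measurable borel" using F by auto
  have [measurable]: "S \<in> sets borel" using S by (simp add: compact_imp_closed)
  define I where "I = L2sq F"
  \<comment> \<open>The vector z holds the time in its i-th slot, while \<open>upd z i s\<close> is
    the point in space that has s there.\<close>
  have phase: "upd z i s \<bullet> \<xi> + z $ i * P \<xi> = s * \<xi> $ i + z \<bullet> upd \<xi> i (P \<xi>)" for z s \<xi>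
    unfolding inner_vec_def upd_nth
    by (simp add: sum.remove[of UNIV i] cong: if_cong)
  have slice: "L2sq (\<lambda>z. wave P F (z $ i) (upd z i s)) \<le> ennreal (2 / c) * I" for s
  proof -
    define F' where "F' \<xi> = F \<xi> * ee (s * \<xi> $ i)" for \<xi>
    have "wave P F (z $ i) (upd z i s) = (LINT \<xi>|lborel. F' \<xi> * ee (z \<bullet> upd \<xi> i (P \<xi>)))" for z
      unfolding wave_def phase ee_add F'_def by (simp add: mult.assoc)
    moreover have "L2sq (\<lambda>z. LINT \<xi>|lborel. F' \<xi> * ee (z \<bullet> upd \<xi> i (P \<xi>)))
        \<le> ennreal (2 / c) * L2sq F'"
    proof (rule schur_gauss[where S=S])
      show "integrable lborel F'"
        unfolding F'_def by (rule integrable_mult_bounded[OF F, where B=1]) auto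
      show "F' \<xi> = 0" if "\<xi> \<notin> S" for \<xi> using FS[OF that] by (simp add: F'_def)
      show "(\<integral>\<^sup>+\<eta>. ennreal (gauss \<rho> (upd a i (P a) - upd \<eta> i (P \<eta>))) * indicator S \<eta> \<partial>lborel) \<le> ennreal (2 / c)"
        if "\<rho> > 0" for \<rho> a
        by (rule nn_integral_gauss_slab[OF P S cont c that ex])
    qed auto
    ultimately show ?thesis by (simp add: I_def F'_def norm_mult)
  qed
  have "(\<integral>\<^sup>+y. w y * L2sq (\<lambda>t. wave P F t y) \<partial>lborel)
     \<le> (\<integral>\<^sup>+y. \<omega> (y $ i) * L2sq (\<lambda>t. wave P F t y) \<partial>lborel)"
    by (intro nn_integral_mono mult_right_mono w\<omega>) auto
  also have "\<dots> = (\<integral>\<^sup>+y. \<integral>\<^sup>+t. \<omega> (y $ i) * ennreal ((cmod (wave P F t y))\<^sup>2) \<partial>lborel \<partial>lborel)"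
    by (simp add: nn_integral_cmult)
  also have "\<dots> = (\<integral>\<^sup>+z. \<integral>\<^sup>+s. \<omega> (upd z i s $ i) * ennreal ((cmod (wave P F (z $ i) (upd z i s)))\<^sup>2) \<partial>lborel \<partial>lborel)"
    by (rule nn_integral_swap_coordinate) measurable
  also have "\<dots> = (\<integral>\<^sup>+s. \<integral>\<^sup>+z. \<omega> s * ennreal ((cmod (wave P F (z $ i) (upd z i s)))\<^sup>2) \<partial>lborel \<partial>lborel)"
    unfolding upd_same by (rule lborel_pair.Fubini'[symmetric]) measurable
  also have "\<dots> = (\<integral>\<^sup>+s. \<omega> s * L2sq (\<lambda>z. wave P F (z $ i) (upd z i s)) \<partial>lborel)"
    by (simp add: nn_integral_cmult)
  also have "\<dots> \<le> (\<integral>\<^sup>+s. \<omega> s * (ennreal (2 / c) * I) \<partial>lborel)"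
    by (intro nn_integral_mono mult_left_mono slice) auto
  also have "\<dots> = (\<integral>\<^sup>+s. \<omega> s \<partial>lborel) * (ennreal (2 / c) * I)"
    by (rule nn_integral_multc) simp
  finally show ?thesis by (simp add: I_def)
qed

subsection \<open>Gaussian averages over balls and against fractal measures\<close>

text \<open>Completing the square replaces the quadratic exponent by the linear one
  \<open>m * a\<close> at the price of the constant; then \<open>exp a \<ge> 1 + a\<close>.\<close>

lemma exp_neg_square_le:
  fixes a :: real and m :: nat
  assumes "a \<ge> 0"
  shows "exp (- pi * a\<^sup>2 / 2) \<le> exp ((real m)\<^sup>2 / (2 * pi)) / (1 + a) ^ m"
proof -
  have "0 \<le> (pi * a - real m)\<^sup>2 / (2 * pi)" by simp
  also have "\<dots> = pi * a\<^sup>2 / 2 - real m * a + (real m)\<^sup>2 / (2 * pi)"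
    by (simp add: power2_eq_square field_simps)
  finally have "- pi * a\<^sup>2 / 2 \<le> (real m)\<^sup>2 / (2 * pi) - real m * a" by simp
  then have "exp (- pi * a\<^sup>2 / 2) \<le> exp ((real m)\<^sup>2 / (2 * pi)) / exp (real m * a)"
    by (simp add: exp_diff[symmetric])
  also have "\<dots> \<le> exp ((real m)\<^sup>2 / (2 * pi)) / (1 + a) ^ m"
    using assms exp_ge_add_one_self[of a]
    by (intro divide_left_mono) (auto simp: exp_of_nat_mult intro!: power_mono)
  finally show ?thesis .
qed

text \<open>The least power of 2 above a is at most \<open>2 * (1 + a)\<close>, so polynomial decay
  in a becomes a power of \<open>1 / 2 ^ q\<close> up to the factor \<open>2 ^ m\<close>.\<close>

lemma exp_neg_square_le_dyadic:
  fixes a :: real and m :: nat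
  assumes "a \<ge> 0"
  obtains q :: nat where "a < 2 ^ q" "exp (- pi * a\<^sup>2 / 2) \<le> exp ((real m)\<^sup>2 / (2 * pi)) * 2 ^ m * (1 / 2 ^ q) ^ m"
proof -
  obtain q0 :: nat where "a < 2 ^ q0" using real_arch_pow[of 2 a] by auto
  define q where "q = (LEAST q. a < 2 ^ q)"
  have q: "a < 2 ^ q" unfolding q_def by (rule LeastI) fact
  have "2 ^ q \<le> 2 * (1 + a)"
  proof (cases q)
    case 0 then show ?thesis using assms by simp
  next
    case (Suc p)
    then have "\<not> a < 2 ^ p" using not_less_Least[of p "\<lambda>q. a < 2 ^ q"] by (simp add: q_def)
    then show ?thesis using Suc by simp
  qed
  then have "1 / (1 + a) \<le> 2 * (1 / 2 ^ q)" using assms by (simp add: field_simps)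
  then have "(1 / (1 + a)) ^ m \<le> (2 * (1 / 2 ^ q)) ^ m" using assms by (intro power_mono) auto
  then have "exp ((real m)\<^sup>2 / (2 * pi)) * (1 / (1 + a)) ^ m \<le> exp ((real m)\<^sup>2 / (2 * pi)) * (2 * (1 / 2 ^ q)) ^ m"
    by (intro mult_left_mono) auto
  with exp_neg_square_le[OF assms, of m, unfolded divide_inverse[of _ "(1 + a) ^ m"]]
  have "exp (- pi * a\<^sup>2 / 2) \<le> exp ((real m)\<^sup>2 / (2 * pi)) * (2 * (1 / 2 ^ q)) ^ m"
    by (simp add: power_one_over inverse_eq_divide)
  then show ?thesis by (intro that[OF q]) (simp only: power_mult_distrib mult.assoc)
qed

text \<open>The measure is summed over concentric balls of radius \<open>2 ^ q / \<rho>\<close>.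
  Only half of the exponent of \<open>gauss\<close> occurs here; the other half is saved for decay
  in one coordinate of y.\<close>

lemma nn_integral_exp_fractal:
  fixes \<mu> :: "(real^'n) measure"
  assumes \<mu>: "\<mu> \<in> M_meas \<alpha>" and \<alpha>: "0 \<le> \<alpha>" "\<alpha> \<le> real CARD('n)"
  shows "\<exists>C\<ge>0. \<forall>\<rho>>0. \<forall>y. (\<integral>\<^sup>+x. ennreal (exp (- pi * (\<rho> * norm (x - y))\<^sup>2 / 2)) \<partial>\<mu>) \<le> ennreal (C * \<rho> powr (- \<alpha>))"
proof -
  from \<mu> obtain C where [measurable_cong]: "sets \<mu> = sets borel" and ps: "prob_space \<mu>"
    and C: "\<And>x r. r > 0 \<Longrightarrow> measure \<mu> (ball x r) \<le> C * r powr \<alpha>"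
    by (auto simp: M_meas_def)
  interpret prob_space \<mu> by fact
  have C0: "C \<ge> 0" using order_trans[OF measure_nonneg C[of 1 0]] by simp
  \<comment> \<open>One more than the dimension, hence at least \<alpha> + 1: the decay of order m
    beats the growth of the measures of the balls and leaves a geometric series of ratio
    1/2.\<close>
  define m where "m = Suc (CARD('n))"
  define K where "K = exp ((real m)\<^sup>2 / (2 * pi)) * 2 ^ m"
  have K0: "K > 0" by (simp add: K_def)
  have "(\<integral>\<^sup>+x. ennreal (exp (- pi * (\<rho> * norm (x - y))\<^sup>2 / 2)) \<partial>\<mu>) \<le> ennreal (2 * K * C * \<rho> powr (- \<alpha>))"
    if \<rho>: "\<rho> > 0" for \<rho> y
  proof -
    define B where "B q = ball y (2 ^ q / \<rho>)" for q :: nat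
    have [measurable]: "B q \<in> sets \<mu>" for q by (simp add: B_def)
    have "(\<integral>\<^sup>+x. ennreal (exp (- pi * (\<rho> * norm (x - y))\<^sup>2 / 2)) \<partial>\<mu>)
        \<le> (\<integral>\<^sup>+x. (\<Sum>q. ennreal (K * (1 / 2 ^ q) ^ m) * indicator (B q) x) \<partial>\<mu>)"
    proof (rule nn_integral_mono)
      fix x
      obtain q where q: "\<rho> * norm (x - y) < 2 ^ q"
        "exp (- pi * (\<rho> * norm (x - y))\<^sup>2 / 2) \<le> K * (1 / 2 ^ q) ^ m"
        unfolding K_def by (rule exp_neg_square_le_dyadic[of "\<rho> * norm (x - y)" m]) (use \<rho> in auto)
      have "x \<in> B q" using q(1) \<rho> by (simp add: B_def dist_norm norm_minus_commute field_simps)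
      then have "ennreal (exp (- pi * (\<rho> * norm (x - y))\<^sup>2 / 2)) \<le> ennreal (K * (1 / 2 ^ q) ^ m) * indicator (B q) x"
        using q(2) by (simp add: ennreal_leI)
      also have "\<dots> \<le> (\<Sum>q. ennreal (K * (1 / 2 ^ q) ^ m) * indicator (B q) x)"
        using sum_le_suminf[of "\<lambda>q. ennreal (K * (1 / 2 ^ q) ^ m) * indicator (B q) x" "{q}"] by (simp del: sum_mult_indicator)
      finally show "ennreal (exp (- pi * (\<rho> * norm (x - y))\<^sup>2 / 2)) \<le> \<dots>" .
    qed
    also have "\<dots> = (\<Sum>q. ennreal (K * (1 / 2 ^ q) ^ m) * emeasure \<mu> (B q))"
      by (subst nn_integral_suminf) (auto simp: nn_integral_cmult_indicator)
    also have "\<dots> \<le> (\<Sum>q. ennreal (K * C * \<rho> powr (- \<alpha>) * (1 / 2) ^ q))"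
    proof (rule suminf_le)
      fix q
      have "(1 / 2 ^ q) ^ m * (2 ^ q / \<rho>) powr \<alpha> = \<rho> powr (- \<alpha>) * ((1 / 2 ^ q) ^ CARD('n) * (2 ^ q) powr \<alpha>) * (1 / 2) ^ q"
        using \<rho> by (simp add: m_def powr_divide powr_minus_divide power_one_over)
      also have "(2 ^ q) powr \<alpha> \<le> (2 ^ q) powr (real CARD('n))"
        using \<alpha> by (intro powr_mono) auto
      also have "(2 ^ q) powr (real CARD('n)) = (2 ^ q) ^ CARD('n)" by (simp add: powr_realpow)
      also have "(1 / 2 ^ q) ^ CARD('n) * (2 ^ q :: real) ^ CARD('n) = 1"
        by (simp add: power_mult_distrib[symmetric])
      finally have *: "(1 / 2 ^ q) ^ m * (2 ^ q / \<rho>) powr \<alpha> \<le> \<rho> powr (- \<alpha>) * (1 / 2) ^ q"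
        using \<rho> by (simp add: mult_left_mono mult_right_mono)
      have "K * (1 / 2 ^ q) ^ m * measure \<mu> (B q) \<le> K * (1 / 2 ^ q) ^ m * (C * (2 ^ q / \<rho>) powr \<alpha>)"
        unfolding B_def using K0 \<rho> by (intro mult_left_mono C) auto
      also have "\<dots> = K * C * ((1 / 2 ^ q) ^ m * (2 ^ q / \<rho>) powr \<alpha>)" by simp
      also have "\<dots> \<le> K * C * (\<rho> powr (- \<alpha>) * (1 / 2) ^ q)"
        using K0 C0 by (intro mult_left_mono *) auto
      finally show "ennreal (K * (1 / 2 ^ q) ^ m) * emeasure \<mu> (B q) \<le> ennreal (K * C * \<rho> powr (- \<alpha>) * (1 / 2) ^ q)"
        using K0 by (simp add: emeasure_eq_measure ennreal_mult'[symmetric] ennreal_leI mult.assoc)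
    qed auto
    also have "\<dots> = ennreal (K * C * \<rho> powr (- \<alpha>) * 2)"
    proof (rule suminf_ennreal_eq)
      show "(\<lambda>q. K * C * \<rho> powr (- \<alpha>) * (1 / 2) ^ q) sums (K * C * \<rho> powr (- \<alpha>) * 2)"
        using sums_mult[OF geometric_sums[of "1/2::real"]] by simp
    qed (use K0 C0 in auto)
    finally show ?thesis by (simp add: mult_ac)
  qed
  then show ?thesis using K0 C0 by (intro exI[of _ "2 * K * C"]) auto
qed

text \<open>Half of the exponent is spent on the dimension of \<mu> and yields
  \<open>\<rho> powr (- \<alpha>)\<close>. As \<mu> lives on the unit ball, the other half yields
  decay in y, recorded in a single coordinate because local smoothing freezes one coordinate. The
  condition \<open>\<rho> \<ge> 1/2\<close> keeps this decay uniform; the coarsest Gaussian to come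
  has frequency 1/2.\<close>

lemma nn_integral_gauss_fractal:
  fixes \<mu> :: "(real^'n) measure"
  assumes \<mu>: "\<mu> \<in> M_meas \<alpha>" and \<alpha>: "0 \<le> \<alpha>" "\<alpha> \<le> real CARD('n)"
  shows "\<exists>C\<ge>0. \<forall>\<rho>\<ge>1/2. \<forall>i y. (\<integral>\<^sup>+x. ennreal (gauss \<rho> (x - y)) \<partial>\<mu>)
     \<le> ennreal (C * \<rho> powr (real CARD('n) - \<alpha>) * gauss (1/4) (y $ i))"
proof -
  from nn_integral_exp_fractal[OF assms] obtain C where C0: "C \<ge> 0"
    and C: "\<And>\<rho> y. \<rho> > 0 \<Longrightarrow> (\<integral>\<^sup>+x. ennreal (exp (- pi * (\<rho> * norm (x - y))\<^sup>2 / 2)) \<partial>\<mu>) \<le> ennreal (C * \<rho> powr (- \<alpha>))"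
    by auto
  from \<mu> have [measurable_cong]: "sets \<mu> = sets borel" and supp: "emeasure \<mu> (- cball 0 1) = 0"
    by (auto simp: M_meas_def)
  have ae: "AE x in \<mu>. norm x \<le> 1"
    using supp by (intro AE_I[where N="- cball 0 1"]) auto
  \<comment> \<open>The factor 4 cancels the normalisation of \<open>gauss (1/4)\<close>, and
    \<open>exp (pi / 8)\<close> pays for the constant term in
    \<open>(y $ i)\<^sup>2 \<le> 2 + 2 * d\<^sup>2\<close> after multiplication by
    \<open>pi / 16\<close>.\<close>
  define K where "K = 4 * exp (pi / 8)"
  have "(\<integral>\<^sup>+x. ennreal (gauss \<rho> (x - y)) \<partial>\<mu>) \<le> ennreal (K * C * \<rho> powr (real CARD('n) - \<alpha>) * gauss (1/4) (y $ i))"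
    if \<rho>: "\<rho> \<ge> 1/2" for \<rho> i y
  proof -
    have ge: "gauss \<rho> (x - y) \<le> \<rho> ^ CARD('n) * (K * gauss (1/4) (y $ i)) * exp (- pi * (\<rho> * norm (x - y))\<^sup>2 / 2)"
      if "norm x \<le> 1" for x
    proof -
      define d where "d = norm (x - y)"
      have "\<bar>y $ i\<bar> \<le> \<bar>x $ i\<bar> + \<bar>(x - y) $ i\<bar>" by simp
      also have "\<dots> \<le> 1 + d"
        using component_le_norm_cart[of x i] component_le_norm_cart[of "x - y" i] that by (simp add: d_def)
      finally have "(y $ i)\<^sup>2 \<le> (1 + d)\<^sup>2" by (simp add: abs_le_square_iff[symmetric])
      also have "\<dots> \<le> 2 + 2 * d\<^sup>2" using sum_squares_bound[of 1 d] by (simp add: power2_sum)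
      finally have 1: "(y $ i)\<^sup>2 \<le> 2 + 2 * d\<^sup>2" .
      have 2: "(1/4) * d\<^sup>2 \<le> \<rho>\<^sup>2 * d\<^sup>2"
        using power_mono[OF \<rho>, of 2] by (intro mult_right_mono) (auto simp: power_divide)
      have 3: "(y $ i)\<^sup>2 / 16 - 1 / 8 \<le> \<rho>\<^sup>2 * d\<^sup>2 / 2" using 1 2 by simp
      have "pi * ((y $ i)\<^sup>2 / 16 - 1 / 8) \<le> pi * (\<rho>\<^sup>2 * d\<^sup>2 / 2)"
        using 3 by (intro mult_left_mono) auto
      then have "- pi * \<rho>\<^sup>2 * d\<^sup>2 \<le> pi / 8 + (- pi * (y $ i)\<^sup>2 / 16) + (- pi * (\<rho> * d)\<^sup>2 / 2)"
        by (simp add: power_mult_distrib algebra_simps)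
      then have "exp (- pi * \<rho>\<^sup>2 * d\<^sup>2) \<le> exp (pi / 8 + (- pi * (y $ i)\<^sup>2 / 16) + (- pi * (\<rho> * d)\<^sup>2 / 2))"
        by simp
      also have "\<dots> = exp (pi / 8) * exp (- pi * (y $ i)\<^sup>2 / 16) * exp (- pi * (\<rho> * d)\<^sup>2 / 2)"
        by (simp only: exp_add)
      finally have "\<rho> ^ CARD('n) * exp (- pi * \<rho>\<^sup>2 * d\<^sup>2) \<le> \<rho> ^ CARD('n) * (exp (pi / 8) * exp (- pi * (y $ i)\<^sup>2 / 16) * exp (- pi * (\<rho> * d)\<^sup>2 / 2))"
        using \<rho> by (intro mult_left_mono) auto
      then show ?thesis by (simp add: gauss_def K_def d_def power_divide mult_ac)
    qed
    have "(\<integral>\<^sup>+x. ennreal (gauss \<rho> (x - y)) \<partial>\<mu>) \<le>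
       (\<integral>\<^sup>+x. ennreal (\<rho> ^ CARD('n) * (K * gauss (1/4) (y $ i))) * ennreal (exp (- pi * (\<rho> * norm (x - y))\<^sup>2 / 2)) \<partial>\<mu>)"
      using ae by (intro nn_integral_mono_AE, eventually_elim)
        (use ge \<rho> in \<open>auto simp: ennreal_mult'[symmetric] K_def intro!: ennreal_leI\<close>)
    also have "\<dots> = ennreal (\<rho> ^ CARD('n) * (K * gauss (1/4) (y $ i))) * (\<integral>\<^sup>+x. ennreal (exp (- pi * (\<rho> * norm (x - y))\<^sup>2 / 2)) \<partial>\<mu>)"
      by (rule nn_integral_cmult) measurable
    also have "\<dots> \<le> ennreal (\<rho> ^ CARD('n) * (K * gauss (1/4) (y $ i))) * ennreal (C * \<rho> powr (- \<alpha>))"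
      using \<rho> by (intro mult_left_mono C) auto
    also have "\<dots> = ennreal ((\<rho> ^ CARD('n) * (K * gauss (1/4) (y $ i))) * (C * \<rho> powr (- \<alpha>)))"
      using \<rho> by (intro ennreal_mult[symmetric]) (auto simp: K_def C0)
    also have "(\<rho> ^ CARD('n) * (K * gauss (1/4) (y $ i))) * (C * \<rho> powr (- \<alpha>))
       = K * C * \<rho> powr (real CARD('n) - \<alpha>) * gauss (1/4) (y $ i)"
    proof -
      have "\<rho> powr (real CARD('n) - \<alpha>) = \<rho> ^ CARD('n) * \<rho> powr (- \<alpha>)"
        using \<rho> powr_add[of \<rho> "real CARD('n)" "- \<alpha>"] by (simp add: powr_realpow)
      then show ?thesis by simp
    qed
    finally show ?thesis .
  qed
  then show ?thesis using C0 by (intro exI[of _ "K * C"]) (auto simp: K_def)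
qed

text \<open>For \<open>\<bar>x - y\<bar> \<ge> 2 r\<close> and for \<open>r \<le> 2\<^sup>-\<^sup>j\<close> the Gaussian of width \<open>2\<^sup>-\<^sup>j\<close> is
  essentially constant on the ball; otherwise its total mass is spread over a ball of radius
  comparable to \<open>2\<^sup>-\<^sup>m\<close> for some \<open>m \<le> j\<close>.\<close>

lemma nn_integral_gauss_ball:
  "\<exists>C\<ge>0. \<forall>j r x y. 0 < r \<longrightarrow> r \<le> 1 \<longrightarrow>
     (\<integral>\<^sup>+u. ennreal (gauss (2 ^ j) (u - y)) * indicator (ball x r) u \<partial>lborel)
      \<le> ennreal (C * (\<Sum>m\<le>j. gauss (2 ^ m / 2) (x - y))) * emeasure lborel (ball (x :: 'a::euclidean_space) r)"
proof -
  define n where "n = DIM('a)"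
  define V where "V = unit_ball_vol (real n)"
  have V: "V > 0" by (simp add: V_def)
  \<comment> \<open>One summand for each mechanism: pointwise comparison on the ball, and comparison
    of the total mass with the volume of the ball.\<close>
  define C where "C = 2 ^ n * exp pi + 4 ^ n * exp pi / V"
  have "C \<ge> 0" using V by (simp add: C_def)
  have "(\<integral>\<^sup>+u. ennreal (gauss (2 ^ j) (u - y)) * indicator (ball x r) u \<partial>lborel)
      \<le> ennreal (C * (\<Sum>m\<le>j. gauss (2 ^ m / 2) (x - y))) * emeasure lborel (ball x r)"
    if r: "0 < r" "r \<le> 1" for j :: nat and r and x y :: 'a
  proof -
    define d where "d = norm (x - y)"
    define \<Sigma> where "\<Sigma> = (\<Sum>m\<le>j. gauss (2 ^ m / 2) (x - y))"
    have g: "gauss (2 ^ m / 2) (x - y) = 2 ^ (m * n) / 2 ^ n * exp (- pi * (2 ^ m * d / 2)\<^sup>2)" for m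
      by (simp add: gauss_def n_def[symmetric] d_def power_divide power_mult power_mult_distrib mult_ac)
    have S: "gauss (2 ^ m / 2) (x - y) \<le> \<Sigma>" if "m \<le> j" for m
      unfolding \<Sigma>_def using that by (intro member_le_sum) auto
    have \<Sigma>0: "\<Sigma> \<ge> 0" unfolding \<Sigma>_def by (intro sum_nonneg) auto
    have gu: "gauss (2 ^ j) v = 2 ^ (j * n) * exp (- pi * (2 ^ j * norm v)\<^sup>2)" for v :: 'a
      by (simp add: gauss_def n_def[symmetric] power_mult power_mult_distrib mult_ac)
    have pointwise: ?thesis if "\<And>u. u \<in> ball x r \<Longrightarrow> gauss (2 ^ j) (u - y) \<le> 2 ^ n * exp pi * gauss (2 ^ j / 2) (x - y)"
    proof -
      have "2 ^ n * exp pi * gauss (2 ^ j / 2) (x - y) \<le> C * \<Sigma>"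
        using V S[of j] by (intro mult_mono) (auto simp: C_def)
      then have "(\<integral>\<^sup>+u. ennreal (gauss (2 ^ j) (u - y)) * indicator (ball x r) u \<partial>lborel)
         \<le> (\<integral>\<^sup>+u. ennreal (C * \<Sigma>) * indicator (ball x r) u \<partial>lborel)"
        using that by (intro nn_integral_mono) (auto split: split_indicator intro!: ennreal_leI intro: order_trans)
      also have "\<dots> = ennreal (C * \<Sigma>) * emeasure lborel (ball x r)"
        by (simp add: nn_integral_cmult_indicator)
      finally show ?thesis by (simp add: \<Sigma>_def)
    qed
    show ?thesis
    proof (cases "d \<ge> 2 * r")
      case True
      show ?thesis
      proof (rule pointwise)
        fix u assume "u \<in> ball x r"
        then have "norm (x - u) < r" by (simp add: dist_norm)
        moreover have "d \<le> norm (x - u) + norm (u - y)"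
          unfolding d_def using norm_triangle_ineq[of "x - u" "u - y"] by simp
        \<comment> \<open>Only half of the distance survives, which is why the majorant uses the
          frequencies \<open>2 ^ m / 2\<close>; the factor \<open>2 ^ n\<close> repairs the
          normalisation.\<close>
        ultimately have "d / 2 \<le> norm (u - y)" using True by linarith
        then have "(2 ^ j * d / 2)\<^sup>2 \<le> (2 ^ j * norm (u - y))\<^sup>2"
          by (intro power_mono) (auto simp: d_def)
        then have "gauss (2 ^ j) (u - y) \<le> 2 ^ n * gauss (2 ^ j / 2) (x - y)"
          unfolding gu g by simp
        also have "\<dots> \<le> 2 ^ n * exp pi * gauss (2 ^ j / 2) (x - y)"
          by (intro mult_right_mono) auto
        finally show "gauss (2 ^ j) (u - y) \<le> 2 ^ n * exp pi * gauss (2 ^ j / 2) (x - y)" .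
      qed
    next
      case d: False
      show ?thesis
      proof (cases "r \<le> 1 / 2 ^ j")
        case True
        show ?thesis
        proof (rule pointwise)
          fix u
          have "2 ^ j * d / 2 \<le> 2 ^ j * r" using d by simp
          also have "\<dots> \<le> 1" using True by (simp add: field_simps)
          finally have "(2 ^ j * d / 2)\<^sup>2 \<le> 1\<^sup>2" by (intro power_mono) (auto simp: d_def)
          then have "1 \<le> exp pi * exp (- pi * (2 ^ j * d / 2)\<^sup>2)"
            by (simp add: exp_add[symmetric])
          then have "2 ^ (j * n) * 1 \<le> 2 ^ (j * n) * (exp pi * exp (- pi * (2 ^ j * d / 2)\<^sup>2))"
            by (intro mult_left_mono) auto
          with order_trans[OF _ this, of "gauss (2 ^ j) (u - y)"]
          have "gauss (2 ^ j) (u - y) \<le> 2 ^ (j * n) * (exp pi * exp (- pi * (2 ^ j * d / 2)\<^sup>2))"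
            unfolding gu by simp
          then show "gauss (2 ^ j) (u - y) \<le> 2 ^ n * exp pi * gauss (2 ^ j / 2) (x - y)"
            unfolding g by (simp add: mult_ac)
        qed
      next
        case False
        \<comment> \<open>The dyadic scale of the radius: \<open>1 / 2 ^ Suc m < r\<close> and
          \<open>r \<le> 1 / 2 ^ m\<close>. Since y is within \<open>2 * r\<close> of x, the m-th
          Gaussian at x - y is within a factor \<open>exp pi\<close> of its peak.\<close>
        define m where "m = (LEAST m. 1 / 2 ^ Suc m < r)"
        have ex: "1 / 2 ^ Suc j < r" using False by (rule_tac le_less_trans[of _ "1 / 2 ^ j"]) (auto simp: field_simps)
        have m1: "1 / 2 ^ Suc m < r" unfolding m_def by (rule LeastI[where P="\<lambda>m. 1 / 2 ^ Suc m < r"]) (rule ex)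
        have mj: "m \<le> j" unfolding m_def by (rule Least_le) (rule ex)
        have m2: "r \<le> 1 / 2 ^ m"
        proof (cases m)
          case 0 then show ?thesis using r by simp
        next
          case (Suc p)
          then have "\<not> 1 / 2 ^ Suc p < r" using not_less_Least[of p "\<lambda>m. 1 / 2 ^ Suc m < r"] by (simp add: m_def)
          then show ?thesis using Suc by simp
        qed
        have "2 ^ m * d / 2 \<le> 2 ^ m * r" using d by simp
        also have "\<dots> \<le> 1" using m2 by (simp add: field_simps)
        finally have "(2 ^ m * d / 2)\<^sup>2 \<le> 1\<^sup>2" by (intro power_mono) (auto simp: d_def)
        then have "1 \<le> exp pi * exp (- pi * (2 ^ m * d / 2)\<^sup>2)"
          by (simp add: exp_add[symmetric])
        then have "2 ^ (m * n) / 2 ^ n * 1 \<le> 2 ^ (m * n) / 2 ^ n * (exp pi * exp (- pi * (2 ^ m * d / 2)\<^sup>2))"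
          by (intro mult_left_mono) auto
        also have "\<dots> = exp pi * gauss (2 ^ m / 2) (x - y)" unfolding g by simp
        also have "\<dots> \<le> exp pi * \<Sigma>" using S[OF mj] by simp
        finally have 1: "2 ^ (m * n) / 2 ^ n \<le> exp pi * \<Sigma>" by simp
        have 2: "1 / 2 ^ (m * n) / 2 ^ n \<le> r ^ n"
          using power_mono[OF less_imp_le[OF m1], of n] by (simp add: power_one_over power_mult power_mult_distrib mult_ac)
        \<comment> \<open>The peak \<open>2 ^ (m * n) / 2 ^ n\<close> times the lower bound
          \<open>V * (1 / 2 ^ (m * n) / 2 ^ n)\<close> for the volume of the ball is
          \<open>V / 4 ^ n\<close>, whence the second constant in \<open>C\<close>.\<close>
        have "1 = (4 ^ n / V) * (2 ^ (m * n) / 2 ^ n) * (V * (1 / 2 ^ (m * n) / 2 ^ n))"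
        proof -
          have "(4::real) ^ n = 2 ^ n * 2 ^ n" by (simp add: power_mult_distrib[symmetric])
          then show ?thesis using V by simp
        qed
        also have "\<dots> \<le> (4 ^ n / V) * (exp pi * \<Sigma>) * (V * r ^ n)"
          using V 1 2 \<Sigma>0 by (intro mult_mono mult_nonneg_nonneg) auto
        also have "\<dots> = (4 ^ n * exp pi / V) * \<Sigma> * (V * r ^ n)" by simp
        also have "\<dots> \<le> C * \<Sigma> * (V * r ^ n)"
          using V r \<Sigma>0 by (intro mult_right_mono) (auto simp: C_def)
        finally have 3: "1 \<le> C * \<Sigma> * (V * r ^ n)" .
        have "(\<integral>\<^sup>+u. ennreal (gauss (2 ^ j) (u - y)) * indicator (ball x r) u \<partial>lborel) \<le>
           (\<integral>\<^sup>+u. ennreal (gauss (2 ^ j) (y - u)) \<partial>lborel)"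
          by (intro nn_integral_mono) (auto split: split_indicator simp: gauss_minus_commute)
        also have "\<dots> = 1" by (simp add: nn_integral_gauss_diff)
        also have "\<dots> \<le> ennreal (C * \<Sigma> * (V * r ^ n))" using ennreal_leI[OF 3] by simp
        also have "\<dots> = ennreal (C * \<Sigma>) * emeasure lborel (ball x r)"
          using r V \<Sigma>0 \<open>C \<ge> 0\<close> by (subst emeasure_ball) (auto simp: V_def n_def ennreal_mult')
        finally show ?thesis by (simp add: \<Sigma>_def)
      qed
    qed
  qed
  with \<open>C \<ge> 0\<close> show ?thesis by blast
qed

subsection \<open>The maximal estimate for one frequency piece\<close>

lemma integrable_gauss_diff: "\<rho> > 0 \<Longrightarrow> integrable lborel (\<lambda>x. gauss \<rho> (a - x :: 'a::euclidean_space))"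
  by (rule integrableI_nonneg) (auto simp: nn_integral_gauss_diff)

lemma wave_time_convolution:
  fixes P :: "real^'n \<Rightarrow> real" and G :: "real^'n \<Rightarrow> complex"
  assumes P[measurable]: "P \<in> borel_measurable borel" and G: "integrable lborel G" and \<Lambda>: "\<Lambda> > 0"
  shows "(LINT \<tau>|lborel. wave P G \<tau> y * complex_of_real (gauss \<Lambda> (t - \<tau>)))
    = wave P (\<lambda>\<xi>. G \<xi> * exp (- pi * (P \<xi>)\<^sup>2 / \<Lambda>\<^sup>2)) t y"
proof -
  have "(LINT \<tau>|lborel. wave P G \<tau> y * complex_of_real (gauss \<Lambda> (t - \<tau>)))
     = (LINT \<xi>|lborel. G \<xi> * (LINT \<tau>|lborel. ee (y \<bullet> \<xi> + \<tau> * P \<xi>) * complex_of_real (gauss \<Lambda> (t - \<tau>))))"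
    unfolding wave_def
    by (rule lborel_pair.Fubini_kernel[where B=1]) (auto simp: G integrable_gauss_diff \<Lambda>)
  also have "\<dots> = (LINT \<xi>|lborel. G \<xi> * (ee (y \<bullet> \<xi>) * (LINT \<tau>|lborel. complex_of_real (gauss \<Lambda> (t - \<tau>)) * ee (\<tau> \<bullet> P \<xi>))))"
    by (simp add: ee_add mult_ac flip: integral_mult_right_zero)
  also have "\<dots> = wave P (\<lambda>\<xi>. G \<xi> * exp (- pi * (P \<xi>)\<^sup>2 / \<Lambda>\<^sup>2)) t y"
    unfolding fourier_gauss_diff[OF \<Lambda>] wave_def by (simp add: ee_add mult_ac)
  finally show ?thesis .
qed

lemma wave_space_convolution:
  fixes P :: "real^'n \<Rightarrow> real" and G :: "real^'n \<Rightarrow> complex"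
  assumes P[measurable]: "P \<in> borel_measurable borel" and G: "integrable lborel G" and l: "l > 0"
  shows "(LINT y|lborel. wave P G t y * complex_of_real (gauss l (x - y)))
    = wave P (\<lambda>\<xi>. G \<xi> * exp (- pi * (norm \<xi>)\<^sup>2 / l\<^sup>2)) t x"
proof -
  have "(LINT y|lborel. wave P G t y * complex_of_real (gauss l (x - y)))
     = (LINT \<xi>|lborel. G \<xi> * (LINT y|lborel. ee (y \<bullet> \<xi> + t * P \<xi>) * complex_of_real (gauss l (x - y))))"
    unfolding wave_def
    by (rule lborel_pair.Fubini_kernel[where B=1]) (auto simp: G integrable_gauss_diff l)
  also have "\<dots> = (LINT \<xi>|lborel. G \<xi> * (ee (t * P \<xi>) * (LINT y|lborel. complex_of_real (gauss l (x - y)) * ee (y \<bullet> \<xi>))))"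
    by (simp add: ee_add mult_ac flip: integral_mult_right_zero)
  also have "\<dots> = wave P (\<lambda>\<xi>. G \<xi> * exp (- pi * (norm \<xi>)\<^sup>2 / l\<^sup>2)) t x"
    unfolding fourier_gauss_diff[OF l] wave_def by (simp add: ee_add mult_ac)
  finally show ?thesis .
qed

text \<open>The data \<open>F\<close> are the data \<open>G\<close> damped in time and space
  frequency, so the wave of \<open>F\<close> is the wave of \<open>G\<close> convolved with two
  Gaussians of mass 1. Cauchy-Schwarz with respect to this probability kernel brings the square
  inside.\<close>

lemma wave_reproducing:
  fixes P :: "real^'n \<Rightarrow> real" and F G :: "real^'n \<Rightarrow> complex"
  assumes P[measurable]: "P \<in> borel_measurable borel" and G: "integrable lborel G" and l: "l > 0" and \<Lambda>: "\<Lambda> > 0"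
    and F: "\<And>\<xi>. F \<xi> = G \<xi> * exp (- pi * (P \<xi>)\<^sup>2 / \<Lambda>\<^sup>2) * exp (- pi * (norm \<xi>)\<^sup>2 / l\<^sup>2)"
  shows "ennreal ((cmod (wave P F t x))\<^sup>2)
     \<le> ennreal \<Lambda> * (\<integral>\<^sup>+y. ennreal (gauss l (x - y)) * (\<integral>\<^sup>+\<tau>. ennreal ((cmod (wave P G \<tau> y))\<^sup>2) \<partial>lborel) \<partial>lborel)"
proof -
  have [measurable]: "G \<in> borel_measurable borel" using G by auto
  define G1 where "G1 \<xi> = G \<xi> * exp (- pi * (P \<xi>)\<^sup>2 / \<Lambda>\<^sup>2)" for \<xi>
  have G1: "integrable lborel G1" unfolding G1_def
    by (rule integrable_mult_bounded[OF G, where B=1]) auto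
  define W where "W y \<tau> = cmod (wave P G \<tau> y)" for y \<tau>
  have [measurable]: "case_prod W \<in> borel_measurable (borel \<Otimes>\<^sub>M borel)" unfolding W_def by measurable
  have W0: "W y \<tau> \<ge> 0" for y \<tau> by (simp add: W_def)
  define k where "k y \<tau> = gauss l (x - y) * gauss \<Lambda> (t - \<tau>)" for y \<tau>
  have k0: "k y \<tau> \<ge> 0" for y \<tau> using l \<Lambda> by (simp add: k_def)
  have [measurable]: "case_prod k \<in> borel_measurable (borel \<Otimes>\<^sub>M borel)" unfolding k_def by measurable
  let ?L = "lborel \<Otimes>\<^sub>M lborel :: ((real^'n) \<times> real) measure"
  have "ennreal (cmod (wave P F t x)) = ennreal (cmod (LINT y|lborel. wave P G1 t y * complex_of_real (gauss l (x - y))))"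
    using wave_space_convolution[OF P G1 l, of t x] unfolding F G1_def wave_def by (simp add: F)
  also have "\<dots> \<le> (\<integral>\<^sup>+y. ennreal (gauss l (x - y)) * ennreal (cmod (wave P G1 t y)) \<partial>lborel)"
    by (rule order_trans[OF ennreal_norm_integral_le])
       (use l in \<open>auto simp: norm_mult ennreal_mult mult.commute\<close>)
  also have "\<dots> \<le> (\<integral>\<^sup>+y. ennreal (gauss l (x - y)) * (\<integral>\<^sup>+\<tau>. ennreal (gauss \<Lambda> (t - \<tau>)) * ennreal (W y \<tau>) \<partial>lborel) \<partial>lborel)"
  proof (intro nn_integral_mono mult_left_mono)
    fix y
    have "ennreal (cmod (wave P G1 t y)) = ennreal (cmod (LINT \<tau>|lborel. wave P G \<tau> y * complex_of_real (gauss \<Lambda> (t - \<tau>))))"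
      using wave_time_convolution[OF P G \<Lambda>, of y t] unfolding G1_def by simp
    also have "\<dots> \<le> (\<integral>\<^sup>+\<tau>. ennreal (gauss \<Lambda> (t - \<tau>)) * ennreal (W y \<tau>) \<partial>lborel)"
      by (rule order_trans[OF ennreal_norm_integral_le])
         (use \<Lambda> in \<open>auto simp: norm_mult ennreal_mult mult.commute W_def\<close>)
    finally show "ennreal (cmod (wave P G1 t y)) \<le> \<dots>" .
  qed auto
  also have "\<dots> = (\<integral>\<^sup>+y. \<integral>\<^sup>+\<tau>. ennreal (k y \<tau> * W y \<tau>) \<partial>lborel \<partial>lborel)"
    using l \<Lambda> W0 by (subst nn_integral_cmult[symmetric]) (auto simp: k_def ennreal_mult[symmetric] mult.assoc)
  also have "\<dots> = (\<integral>\<^sup>+p. ennreal (case_prod k p * case_prod W p) \<partial>?L)"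
    by (subst lborel.nn_integral_fst[symmetric]) auto
  also have "\<dots> = (\<integral>\<^sup>+p. ennreal (sqrt (case_prod k p)) * ennreal (sqrt (case_prod k p) * case_prod W p) \<partial>?L)"
    using k0 W0 by (intro nn_integral_cong) (auto simp: ennreal_mult[symmetric] mult.assoc[symmetric])
  finally have 1: "ennreal (cmod (wave P F t x)) \<le> \<dots>" .
  have "ennreal ((cmod (wave P F t x))\<^sup>2) = (ennreal (cmod (wave P F t x)))\<^sup>2"
    by (simp add: ennreal_power)
  also have "\<dots> \<le> (\<integral>\<^sup>+p. ennreal (sqrt (case_prod k p)) * ennreal (sqrt (case_prod k p) * case_prod W p) \<partial>?L)\<^sup>2"
    using 1 by (rule power_mono) simp
  also have "\<dots> \<le> (\<integral>\<^sup>+p. (ennreal (sqrt (case_prod k p)))\<^sup>2 \<partial>?L) * (\<integral>\<^sup>+p. (ennreal (sqrt (case_prod k p) * case_prod W p))\<^sup>2 \<partial>?L)"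
    by (rule Cauchy_Schwarz_nn_integral) auto
  also have "(\<integral>\<^sup>+p. (ennreal (sqrt (case_prod k p)))\<^sup>2 \<partial>?L) = (\<integral>\<^sup>+p. ennreal (case_prod k p) \<partial>?L)"
    using k0 by (intro nn_integral_cong) (auto simp: ennreal_power)
  also have "\<dots> = (\<integral>\<^sup>+y. \<integral>\<^sup>+\<tau>. ennreal (gauss l (x - y)) * ennreal (gauss \<Lambda> (t - \<tau>)) \<partial>lborel \<partial>lborel)"
    using l \<Lambda> by (subst lborel.nn_integral_fst[symmetric]) (auto simp: k_def ennreal_mult)
  also have "\<dots> = 1"
    using l \<Lambda> by (simp add: nn_integral_cmult nn_integral_gauss_diff)
  also have "(\<integral>\<^sup>+p. (ennreal (sqrt (case_prod k p) * case_prod W p))\<^sup>2 \<partial>?L) = (\<integral>\<^sup>+p. ennreal (case_prod k p * (case_prod W p)\<^sup>2) \<partial>?L)"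
    using k0 W0 by (intro nn_integral_cong) (auto simp: ennreal_power power_mult_distrib)
  also have "\<dots> = (\<integral>\<^sup>+y. \<integral>\<^sup>+\<tau>. ennreal (k y \<tau> * (W y \<tau>)\<^sup>2) \<partial>lborel \<partial>lborel)"
    by (subst lborel.nn_integral_fst[symmetric]) auto
  \<comment> \<open>The time kernel is replaced by its peak \<Lambda>. This removes t from the
    right-hand side and is the whole cost of the supremum over all times.\<close>
  also have "\<dots> \<le> (\<integral>\<^sup>+y. \<integral>\<^sup>+\<tau>. ennreal \<Lambda> * (ennreal (gauss l (x - y)) * ennreal ((W y \<tau>)\<^sup>2)) \<partial>lborel \<partial>lborel)"
  proof (intro nn_integral_mono)
    fix y \<tau>
    have "k y \<tau> * (W y \<tau>)\<^sup>2 \<le> \<Lambda> * (gauss l (x - y) * (W y \<tau>)\<^sup>2)"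
      using mult_right_mono[OF gauss_real_le[of \<Lambda> "t - \<tau>"], of "gauss l (x - y) * (W y \<tau>)\<^sup>2"] l \<Lambda>
      by (simp add: k_def mult_ac)
    then show "ennreal (k y \<tau> * (W y \<tau>)\<^sup>2) \<le> ennreal \<Lambda> * (ennreal (gauss l (x - y)) * ennreal ((W y \<tau>)\<^sup>2))"
      using l \<Lambda> by (simp add: ennreal_mult[symmetric] ennreal_leI)
  qed
  also have "\<dots> = ennreal \<Lambda> * (\<integral>\<^sup>+y. ennreal (gauss l (x - y)) * (\<integral>\<^sup>+\<tau>. ennreal ((W y \<tau>)\<^sup>2) \<partial>lborel) \<partial>lborel)"
    by (simp add: nn_integral_cmult)
  finally show ?thesis by (simp add: W_def)
qed

lemma set_lebesgue_integral_ball_lborel: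
  fixes U :: "real^'n \<Rightarrow> complex"
  assumes "U \<in> borel_measurable borel"
  shows "(LINT y:ball x r|lebesgue. U y) = (LINT y:ball x r|lborel. U y)"
proof -
  have [measurable]: "ball x r \<in> sets borel" by simp
  show ?thesis
    unfolding set_lebesgue_integral_def by (rule integral_completion) (use assms in measurable)
qed

lemma measure_ball_pos: "r > 0 \<Longrightarrow> measure lebesgue (ball (x :: 'a::euclidean_space) r) > 0"
  by (simp add: content_ball)

lemma emeasure_ball_measure: "emeasure lborel (ball (x :: 'a::euclidean_space) r) = ennreal (measure lebesgue (ball x r))"
proof -
  have "measure lebesgue (ball x r) = measure lborel (ball x r)" by (rule measure_completion) simp
  moreover have "emeasure lborel (ball x r) \<noteq> \<infinity>" using emeasure_lborel_ball_finite[of x r] by simp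
  ultimately show ?thesis by (simp add: emeasure_eq_ennreal_measure)
qed

text \<open>Jensen's inequality, by Cauchy-Schwarz against the indicator of the ball.\<close>

lemma ball_average_square_le:
  fixes U :: "real^'n \<Rightarrow> complex"
  assumes [measurable]: "U \<in> borel_measurable borel" and r: "r > 0"
    and B: "(\<integral>\<^sup>+u. ennreal ((cmod (U u))\<^sup>2) * indicator (ball x r) u \<partial>lborel) \<le> B * emeasure lborel (ball x r)"
  shows "ennreal ((cmod (ball_average U x r))\<^sup>2) \<le> B"
proof (cases B)
  case (real b)
  have [measurable]: "ball x r \<in> sets borel" by simp
  define v where "v = measure lebesgue (ball x r)"
  have v: "v > 0" using measure_ball_pos[OF r] by (simp add: v_def)
  have V: "emeasure lborel (ball x r) = ennreal v" unfolding v_def by (rule emeasure_ball_measure)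
  define c where "c = cmod (LINT y:ball x r|lborel. U y)"
  have "ennreal c \<le> (\<integral>\<^sup>+u. ennreal (cmod (U u)) * indicator (ball x r) u * indicator (ball x r) u \<partial>lborel)"
    unfolding c_def set_lebesgue_integral_def
    by (rule order_trans[OF ennreal_norm_integral_le]) (auto intro!: nn_integral_mono split: split_indicator)
  then have "(ennreal c)\<^sup>2 \<le> (\<integral>\<^sup>+u. ennreal (cmod (U u)) * indicator (ball x r) u * indicator (ball x r) u \<partial>lborel)\<^sup>2"
    by (rule power_mono) simp
  also have "\<dots> \<le> (\<integral>\<^sup>+u. (ennreal (cmod (U u)) * indicator (ball x r) u)\<^sup>2 \<partial>lborel) * (\<integral>\<^sup>+u. (indicator (ball x r) u)\<^sup>2 \<partial>lborel)"
    by (rule Cauchy_Schwarz_nn_integral) auto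
  also have "(\<integral>\<^sup>+u. (ennreal (cmod (U u)) * indicator (ball x r) u)\<^sup>2 \<partial>lborel) = (\<integral>\<^sup>+u. ennreal ((cmod (U u))\<^sup>2) * indicator (ball x r) u \<partial>lborel)"
    by (intro nn_integral_cong) (auto split: split_indicator simp: ennreal_power)
  also have "(\<integral>\<^sup>+u. (indicator (ball x r) u)\<^sup>2 \<partial>lborel) = (\<integral>\<^sup>+u. indicator (ball x r) u \<partial>lborel)"
    by (intro nn_integral_cong) (auto split: split_indicator)
  also have "\<dots> = ennreal v" using V by simp
  also have "(\<integral>\<^sup>+u. ennreal ((cmod (U u))\<^sup>2) * indicator (ball x r) u \<partial>lborel) * ennreal v \<le> ennreal b * ennreal v * ennreal v"
    using B unfolding V real by (rule mult_right_mono) simp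
  finally have "ennreal (c\<^sup>2) \<le> ennreal (b * v * v)"
    using real v by (simp add: ennreal_power ennreal_mult c_def)
  then have "c\<^sup>2 \<le> b * v * v" using real v by (subst (asm) ennreal_le_iff) auto
  then have "(c / v)\<^sup>2 \<le> b" using v by (simp add: power_divide divide_le_eq power2_eq_square mult.assoc)
  moreover have "cmod (ball_average U x r) = c / v"
    unfolding ball_average_def c_def v_def
    using v by (subst set_lebesgue_integral_ball_lborel) (auto simp: norm_divide v_def)
  ultimately show ?thesis using real by (simp add: ennreal_leI)
qed simp

text \<open>A Borel majorant \<open>M\<close>, independent of r and t, stands in for the maximal
  function, so the measurability of an uncountable supremum does not arise.\<close>

abbreviation maximal_bound where
  "maximal_bound \<mu> P F K \<equiv> \<exists>M\<in>borel_measurable borel.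
     (\<forall>r t x. 0 < r \<longrightarrow> r \<le> 1 \<longrightarrow> ennreal ((cmod (ball_average (wave P F t) x r))\<^sup>2) \<le> M x) \<and>
     (\<integral>\<^sup>+x. M x \<partial>\<mu>) \<le> K"

text \<open>Combines \<open>wave_reproducing\<close> at space frequency \<open>2 ^ j\<close>, the
  Gaussian majorant of ball averages, the fractal bound and local smoothing. A single constant has
  to serve all scales, pieces and rates \<Lambda> and c, because the quotient
  \<open>\<Lambda> / c\<close> is evaluated only after rescaling.\<close>

lemma maximal_piece:
  fixes P :: "real^'n \<Rightarrow> real" and \<mu> :: "(real^'n) measure"
  assumes \<mu>: "\<mu> \<in> M_meas \<alpha>" and \<alpha>: "0 \<le> \<alpha>" "\<alpha> \<le> real CARD('n)" and P[measurable]: "P \<in> borel_measurable borel"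
  shows "\<exists>C\<ge>0. \<forall>j \<Lambda> c i S (F :: real^'n \<Rightarrow> complex) (G :: real^'n \<Rightarrow> complex). \<Lambda> > 0 \<longrightarrow> c > 0 \<longrightarrow> integrable lborel G \<longrightarrow> compact S \<longrightarrow> (\<forall>\<xi>. \<xi> \<notin> S \<longrightarrow> G \<xi> = 0) \<longrightarrow>
     continuous_on S P \<longrightarrow> (\<forall>\<xi> s. \<xi> \<in> S \<longrightarrow> upd \<xi> i s \<in> S \<longrightarrow> c * \<bar>s - \<xi> $ i\<bar> \<le> \<bar>P (upd \<xi> i s) - P \<xi>\<bar>) \<longrightarrow>
     (\<forall>\<xi>. F \<xi> = G \<xi> * exp (- pi * (P \<xi>)\<^sup>2 / \<Lambda>\<^sup>2) * exp (- pi * (norm \<xi>)\<^sup>2 / (2 ^ j)\<^sup>2)) \<longrightarrow>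
     maximal_bound \<mu> P F (ennreal (C * \<Lambda> / c * real (Suc j) * (2 ^ j) powr (real CARD('n) - \<alpha>)) * L2sq G)"
proof -
  from nn_integral_gauss_fractal[OF \<mu> \<alpha>] obtain C1 where C1: "C1 \<ge> 0"
    and gf: "\<And>\<rho> i y. \<rho> \<ge> 1/2 \<Longrightarrow> (\<integral>\<^sup>+x. ennreal (gauss \<rho> (x - y)) \<partial>\<mu>) \<le> ennreal (C1 * \<rho> powr (real CARD('n) - \<alpha>) * gauss (1/4) (y $ i))"
    by auto
  from nn_integral_gauss_ball[where 'a="real^'n"] obtain C2 where C2: "C2 \<ge> 0"
    and gb: "\<And>j r x y. 0 < r \<Longrightarrow> r \<le> 1 \<Longrightarrow> (\<integral>\<^sup>+u. ennreal (gauss (2 ^ j) (u - y)) * indicator (ball x r) u \<partial>lborel)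
      \<le> ennreal (C2 * (\<Sum>m\<le>j. gauss (2 ^ m / 2) (x - y))) * emeasure lborel (ball (x :: real^'n) r)"
    by auto
  from \<mu> have [measurable_cong]: "sets \<mu> = sets borel" and ps: "prob_space \<mu>" by (auto simp: M_meas_def)
  interpret \<mu>: prob_space \<mu> by fact
  interpret p\<mu>: pair_sigma_finite \<mu> "lborel :: (real^'n) measure" ..
  define C where "C = 2 * C1 * C2"
  show ?thesis
  proof (intro exI[of _ C] conjI allI impI)
    show "C \<ge> 0" using C1 C2 by (simp add: C_def)
    fix j :: nat and \<Lambda> c :: real and i S and F G :: "real^'n \<Rightarrow> complex"
    assume \<Lambda>: "\<Lambda> > 0" and c: "c > 0" and G: "integrable lborel G" and S: "compact S" and GS: "\<forall>\<xi>. \<xi> \<notin> S \<longrightarrow> G \<xi> = 0"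
      and cont: "continuous_on S P"
      and ex: "\<forall>\<xi> s. \<xi> \<in> S \<longrightarrow> upd \<xi> i s \<in> S \<longrightarrow> c * \<bar>s - \<xi> $ i\<bar> \<le> \<bar>P (upd \<xi> i s) - P \<xi>\<bar>"
      and FG: "\<forall>\<xi>. F \<xi> = G \<xi> * exp (- pi * (P \<xi>)\<^sup>2 / \<Lambda>\<^sup>2) * exp (- pi * (norm \<xi>)\<^sup>2 / (2 ^ j)\<^sup>2)"
    have [measurable]: "G \<in> borel_measurable borel" using G by auto
    have [measurable]: "F \<in> borel_measurable borel" unfolding FG[rule_format, abs_def] by measurable
    define E where "E y = (\<integral>\<^sup>+\<tau>. ennreal ((cmod (wave P G \<tau> y))\<^sup>2) \<partial>lborel)" for y
    have [measurable]: "E \<in> borel_measurable borel" unfolding E_def by measurable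
    define I where "I = L2sq G"
    define N where "N m x = (\<integral>\<^sup>+y. ennreal (gauss (2 ^ m / 2) (x - y)) * E y \<partial>lborel)" for m :: nat and x
    have [measurable]: "N m \<in> borel_measurable borel" for m unfolding N_def by measurable
    \<comment> \<open>The \<open>Suc j\<close> widths together cover all radii up to 1. Each term
      gets the same bound below, hence the factor \<open>Suc j\<close>, which is the logarithm of
      the frequency.\<close>
    define M where "M x = ennreal (\<Lambda> * C2) * (\<Sum>m\<le>j. N m x)" for x
    have [measurable]: "M \<in> borel_measurable borel" unfolding M_def by measurable
    have bound: "ennreal ((cmod (ball_average (wave P F t) x r))\<^sup>2) \<le> M x" if r: "0 < r" "r \<le> 1" for r t x
    proof (rule ball_average_square_le[OF _ r(1)])
      have [measurable]: "ball x r \<in> sets borel" by simp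
      show "wave P F t \<in> borel_measurable borel" by measurable
      have "(\<integral>\<^sup>+u. ennreal ((cmod (wave P F t u))\<^sup>2) * indicator (ball x r) u \<partial>lborel)
        \<le> (\<integral>\<^sup>+u. ennreal \<Lambda> * (\<integral>\<^sup>+y. ennreal (gauss (2 ^ j) (u - y)) * E y \<partial>lborel) * indicator (ball x r) u \<partial>lborel)"
        unfolding E_def using FG by (intro nn_integral_mono mult_right_mono wave_reproducing[OF P G _ \<Lambda>]) auto
      also have "\<dots> = ennreal \<Lambda> * (\<integral>\<^sup>+u. (\<integral>\<^sup>+y. E y * (ennreal (gauss (2 ^ j) (u - y)) * indicator (ball x r) u) \<partial>lborel) \<partial>lborel)"
      proof -
        have "ennreal \<Lambda> * (\<integral>\<^sup>+y. ennreal (gauss (2 ^ j) (u - y)) * E y \<partial>lborel) * indicator (ball x r) u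
           = ennreal \<Lambda> * (\<integral>\<^sup>+y. E y * (ennreal (gauss (2 ^ j) (u - y)) * indicator (ball x r) u) \<partial>lborel)" for u
          by (subst mult.assoc, subst nn_integral_multc[symmetric]) (auto simp: mult_ac)
        then show ?thesis by (simp add: nn_integral_cmult)
      qed
      \<comment> \<open>The ball average is moved from the wave onto the Gaussian kernel, where it
        is estimated uniformly in the radius.\<close>
      also have "(\<integral>\<^sup>+u. (\<integral>\<^sup>+y. E y * (ennreal (gauss (2 ^ j) (u - y)) * indicator (ball x r) u) \<partial>lborel) \<partial>lborel)
         = (\<integral>\<^sup>+y. (\<integral>\<^sup>+u. E y * (ennreal (gauss (2 ^ j) (u - y)) * indicator (ball x r) u) \<partial>lborel) \<partial>lborel)"
        by (rule lborel_pair.Fubini'[symmetric]) measurable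
      also have "\<dots> = (\<integral>\<^sup>+y. E y * (\<integral>\<^sup>+u. ennreal (gauss (2 ^ j) (u - y)) * indicator (ball x r) u \<partial>lborel) \<partial>lborel)"
        by (simp add: nn_integral_cmult)
      also have "\<dots> \<le> (\<integral>\<^sup>+y. E y * (ennreal (C2 * (\<Sum>m\<le>j. gauss (2 ^ m / 2) (x - y))) * emeasure lborel (ball x r)) \<partial>lborel)"
        by (intro nn_integral_mono mult_left_mono gb r) auto
      also have "\<dots> = (\<integral>\<^sup>+y. ennreal C2 * emeasure lborel (ball x r) * (\<Sum>m\<le>j. ennreal (gauss (2 ^ m / 2) (x - y)) * E y) \<partial>lborel)"
      proof (intro nn_integral_cong)
        fix y
        have "ennreal (C2 * (\<Sum>m\<le>j. gauss (2 ^ m / 2) (x - y))) = ennreal C2 * (\<Sum>m\<le>j. ennreal (gauss (2 ^ m / 2) (x - y)))"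
          using C2 by (subst sum_ennreal) (auto simp: ennreal_mult sum_nonneg)
        then show "E y * (ennreal (C2 * (\<Sum>m\<le>j. gauss (2 ^ m / 2) (x - y))) * emeasure lborel (ball x r))
           = ennreal C2 * emeasure lborel (ball x r) * (\<Sum>m\<le>j. ennreal (gauss (2 ^ m / 2) (x - y)) * E y)"
          unfolding sum_distrib_right[symmetric] by (simp only: mult_ac)
      qed
      also have "\<dots> = ennreal C2 * emeasure lborel (ball x r) * (\<Sum>m\<le>j. N m x)"
        by (subst nn_integral_cmult) (auto simp: nn_integral_sum N_def)
      also have "ennreal \<Lambda> * \<dots> = M x * emeasure lborel (ball x r)"
        using \<Lambda> C2 by (simp add: M_def ennreal_mult mult_ac)
      finally show "(\<integral>\<^sup>+u. ennreal ((cmod (wave P F t u))\<^sup>2) * indicator (ball x r) u \<partial>lborel) \<le> M x * emeasure lborel (ball x r)"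
        by (simp add: mult_left_mono)
    qed
    have Nint: "(\<integral>\<^sup>+x. N m x \<partial>\<mu>) \<le> ennreal (C1 * (2 ^ j) powr (real CARD('n) - \<alpha>)) * (ennreal (2 / c) * I)" if m: "m \<le> j" for m
    proof -
      define \<rho> :: real where "\<rho> = 2 ^ m / 2"
      have \<rho>: "\<rho> \<ge> 1/2" by (simp add: \<rho>_def)
      \<comment> \<open>All coarser scales are bounded by the finest one, as the exponent
        \<open>real CARD('n) - \<alpha>\<close> is nonnegative.\<close>
      have \<rho>j: "\<rho> \<le> 2 ^ j" using power_increasing[OF m, of "2::real"] zero_le_power[of "2::real" m] unfolding \<rho>_def by linarith
      have "(\<integral>\<^sup>+x. N m x \<partial>\<mu>) = (\<integral>\<^sup>+y. (\<integral>\<^sup>+x. ennreal (gauss \<rho> (x - y)) * E y \<partial>\<mu>) \<partial>lborel)"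
        unfolding N_def \<rho>_def by (rule p\<mu>.Fubini'[symmetric]) measurable
      also have "\<dots> = (\<integral>\<^sup>+y. (\<integral>\<^sup>+x. ennreal (gauss \<rho> (x - y)) \<partial>\<mu>) * E y \<partial>lborel)"
        by (simp add: nn_integral_multc)
      also have "\<dots> \<le> (\<integral>\<^sup>+s. ennreal (C1 * \<rho> powr (real CARD('n) - \<alpha>) * gauss (1/4) (s::real)) \<partial>lborel) * (ennreal (2 / c) * I)"
        unfolding E_def I_def
      proof (rule local_smoothing[OF P G S _ cont c, where i=i])
        show "(\<lambda>y. \<integral>\<^sup>+x. ennreal (gauss \<rho> (x - y)) \<partial>\<mu>) \<in> borel_measurable borel" by measurable
        show "G \<xi> = 0" if "\<xi> \<notin> S" for \<xi> using GS that by blast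
        show "c * \<bar>s - \<xi> $ i\<bar> \<le> \<bar>P (upd \<xi> i s) - P \<xi>\<bar>" if "\<xi> \<in> S" "upd \<xi> i s \<in> S" for \<xi> s
          using ex that by blast
        show "(\<lambda>s. ennreal (C1 * \<rho> powr (real CARD('n) - \<alpha>) * gauss (1/4) s)) \<in> borel_measurable borel"
          by measurable
        show "(\<integral>\<^sup>+x. ennreal (gauss \<rho> (x - y)) \<partial>\<mu>) \<le> ennreal (C1 * \<rho> powr (real CARD('n) - \<alpha>) * gauss (1/4) (y $ i))" for y
          by (rule gf[OF \<rho>])
      qed
      also have "(\<integral>\<^sup>+s. ennreal (C1 * \<rho> powr (real CARD('n) - \<alpha>) * gauss (1/4) (s::real)) \<partial>lborel) = ennreal (C1 * \<rho> powr (real CARD('n) - \<alpha>))"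
        using C1 by (simp add: ennreal_mult nn_integral_cmult nn_integral_gauss)
      also have "\<dots> \<le> ennreal (C1 * (2 ^ j) powr (real CARD('n) - \<alpha>))"
        using C1 \<alpha> \<rho> \<rho>j by (intro ennreal_leI mult_left_mono powr_mono2) auto
      finally show ?thesis by (simp add: mult_right_mono)
    qed
    have "(\<integral>\<^sup>+x. M x \<partial>\<mu>) = ennreal (\<Lambda> * C2) * (\<Sum>m\<le>j. \<integral>\<^sup>+x. N m x \<partial>\<mu>)"
      unfolding M_def by (subst nn_integral_cmult) (auto simp: nn_integral_sum)
    also have "\<dots> \<le> ennreal (\<Lambda> * C2) * (\<Sum>m\<le>j. ennreal (C1 * (2 ^ j) powr (real CARD('n) - \<alpha>)) * (ennreal (2 / c) * I))"
      by (intro mult_left_mono sum_mono Nint) auto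
    also have "\<dots> = ennreal (\<Lambda> * C2) * (ennreal (real (Suc j)) * (ennreal (C1 * (2 ^ j) powr (real CARD('n) - \<alpha>)) * (ennreal (2 / c) * I)))"
      by (simp add: ennreal_of_nat_eq_real_of_nat)
    also have "\<dots> = ennreal ((\<Lambda> * C2) * (real (Suc j) * ((C1 * (2 ^ j) powr (real CARD('n) - \<alpha>)) * (2 / c)))) * I"
      using \<Lambda> C1 C2 c by (simp only: ennreal_mult mult_nonneg_nonneg less_imp_le of_nat_0_le_iff powr_ge_zero divide_nonneg_pos zero_le_numeral mult.assoc)
    also have "(\<Lambda> * C2) * (real (Suc j) * ((C1 * (2 ^ j) powr (real CARD('n) - \<alpha>)) * (2 / c))) = C * \<Lambda> / c * real (Suc j) * (2 ^ j) powr (real CARD('n) - \<alpha>)"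
      by (simp add: C_def)
    finally show "maximal_bound \<mu> P F (ennreal (C * \<Lambda> / c * real (Suc j) * (2 ^ j) powr (real CARD('n) - \<alpha>)) * L2sq G)"
      using bound by (intro bexI[of _ M]) (auto simp: I_def)
  qed
qed

subsection \<open>The maximal estimate for a dyadic shell\<close>

lemma gradient_GDERIV:
  fixes f :: "real^'n \<Rightarrow> real"
  assumes "f differentiable (at x)"
  shows "GDERIV f x :> gradient f x"
proof -
  obtain f' where f': "(f has_derivative f') (at x)" using assms by (auto simp: differentiable_def)
  interpret bounded_linear f' using f' by (rule has_derivative_bounded_linear)
  \<comment> \<open>The vector that represents the derivative; together with uniqueness it makes the
    definite description in \<open>gradient\<close> meaningful.\<close>
  define D where "D = (\<Sum>b\<in>Basis. f' b *\<^sub>R b)"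
  have "f' h = h \<bullet> D" for h
  proof -
    have "f' h = f' (\<Sum>b\<in>Basis. (h \<bullet> b) *\<^sub>R b)" by (simp add: euclidean_representation)
    also have "\<dots> = h \<bullet> D" by (simp add: sum scaleR D_def inner_sum_right mult.commute)
    finally show ?thesis .
  qed
  then have "f' = (\<lambda>h. h \<bullet> D)" by (rule ext)
  then have "GDERIV f x :> D" using f' by (simp add: gderiv_def)
  moreover have "D' = D" if "GDERIV f x :> D'" for D'
  proof -
    have "(\<lambda>h. h \<bullet> D') = (\<lambda>h. h \<bullet> D)"
      using that \<open>GDERIV f x :> D\<close> unfolding gderiv_def by (rule has_derivative_unique)
    then show ?thesis by (metis vector_eq_ldot)
  qed
  ultimately show ?thesis unfolding gradient_def by (rule theI)
qed

lemma smooth_on_punctured: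
  fixes P :: "real^'n \<Rightarrow> real"
  assumes "smooth_on (- {0}) P"
  shows "continuous_on (- {0}) P" "\<And>x. x \<noteq> 0 \<Longrightarrow> GDERIV P x :> gradient P x"
    "continuous_on (- {0}) (\<lambda>x. gradient P x $ i)"
proof -
  have "C_on 0 (- {0}) P" "C_on (Suc 0) (- {0}) P" using assms by (simp_all only: smooth_on_def)
  then have 1: "continuous_on (- {0}) P" "P differentiable_on (- {0})" "continuous_on (- {0}) (\<lambda>x. gradient P x $ i)"
    by auto
  show "continuous_on (- {0}) P" "continuous_on (- {0}) (\<lambda>x. gradient P x $ i)" using 1 by auto
  fix x :: "real^'n" assume "x \<noteq> 0"
  then have "at x within - {0} = at x" by (intro at_within_open) auto
  then have "P differentiable (at x)"
    using 1(2) \<open>x \<noteq> 0\<close> by (metis ComplI differentiable_on_def singletonD)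
  then show "GDERIV P x :> gradient P x" by (rule gradient_GDERIV)
qed

lemma upd_add_axis: "upd \<xi> i s = \<xi> + (s - \<xi> $ i) *\<^sub>R axis i 1"
  by (auto simp: vec_eq_iff upd_nth axis_def)

text \<open>Some partial derivative is nonzero at \<eta>, and by continuity it keeps at least half
  of its size on a small ball that avoids the origin. The ball is convex, so the mean value theorem
  applies on the segment joining two of its points that differ in the i-th coordinate only.\<close>

lemma expanding_near:
  fixes P :: "real^'n \<Rightarrow> real"
  assumes sm: "smooth_on (- {0}) P" and ns: "nonsingular P" and \<eta>: "\<eta> \<noteq> 0"
  shows "\<exists>\<delta> c i. \<delta> > 0 \<and> c > 0 \<and> 0 \<notin> cball \<eta> \<delta> \<and>
    (\<forall>\<xi> s. \<xi> \<in> cball \<eta> \<delta> \<longrightarrow> upd \<xi> i s \<in> cball \<eta> \<delta> \<longrightarrow> c * \<bar>s - \<xi> $ i\<bar> \<le> \<bar>P (upd \<xi> i s) - P \<xi>\<bar>)"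
proof -
  have "gradient P \<eta> \<noteq> 0" using ns \<eta> by (simp add: nonsingular_def)
  then obtain i where i: "gradient P \<eta> $ i \<noteq> 0" by (auto simp: vec_eq_iff)
  define g where "g x = gradient P x $ i" for x
  define c where "c = \<bar>g \<eta>\<bar> / 2"
  have c: "c > 0" using i by (simp add: c_def g_def)
  have "continuous (at \<eta>) g"
    using smooth_on_punctured(3)[OF sm, of i] \<eta> unfolding g_def
    by (subst (asm) continuous_on_eq_continuous_at) (auto simp: open_delete)
  then obtain d where d: "d > 0" "\<And>x. dist x \<eta> < d \<Longrightarrow> \<bar>g x - g \<eta>\<bar> < c"
    unfolding continuous_at_eps_delta using c by (auto simp: dist_real_def dest!: spec[of _ c])
  define \<delta> where "\<delta> = min d (norm \<eta>) / 2"
  have \<delta>: "\<delta> > 0" "\<delta> < d" "\<delta> < norm \<eta>" using d(1) zero_less_norm_iff[of \<eta>] \<eta> by (auto simp: \<delta>_def min_def)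
  have 0: "0 \<notin> cball \<eta> \<delta>" using \<delta>(3) by simp
  have gc: "\<bar>g x\<bar> \<ge> c" if "x \<in> cball \<eta> \<delta>" for x
  proof -
    have "\<bar>g x - g \<eta>\<bar> < \<bar>g \<eta>\<bar> / 2" using d(2)[of x] that \<delta>(2) by (simp add: c_def dist_commute)
    then show ?thesis unfolding c_def by arith
  qed
  have "c * \<bar>s - \<xi> $ i\<bar> \<le> \<bar>P (upd \<xi> i s) - P \<xi>\<bar>" if \<xi>: "\<xi> \<in> cball \<eta> \<delta>" and u: "upd \<xi> i s \<in> cball \<eta> \<delta>" for \<xi> s
  proof -
    define v where "v = (s - \<xi> $ i) *\<^sub>R axis i (1::real)"
    have uv: "upd \<xi> i s = \<xi> + v" by (simp add: upd_add_axis v_def)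
    have inb: "\<xi> + \<theta> *\<^sub>R v \<in> cball \<eta> \<delta>" if "0 \<le> \<theta>" "\<theta> \<le> 1" for \<theta>
    proof -
      have "(1 - \<theta>) *\<^sub>R \<xi> + \<theta> *\<^sub>R (\<xi> + v) \<in> cball \<eta> \<delta>"
        using convex_cball[of \<eta> \<delta>] \<xi> u that unfolding uv convex_alt by blast
      then show ?thesis by (simp add: algebra_simps)
    qed
    have der: "((\<lambda>\<theta>. P (\<xi> + \<theta> *\<^sub>R v)) has_real_derivative (s - \<xi> $ i) * g (\<xi> + \<theta> *\<^sub>R v)) (at \<theta>)"
      if "0 \<le> \<theta>" "\<theta> \<le> 1" for \<theta>
    proof -
      have "\<xi> + \<theta> *\<^sub>R v \<noteq> 0" using inb[OF that] 0 by metis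
      then have "(P has_derivative (\<lambda>h. h \<bullet> gradient P (\<xi> + \<theta> *\<^sub>R v))) (at (\<xi> + \<theta> *\<^sub>R v))"
        using smooth_on_punctured(2)[OF sm] by (simp add: gderiv_def)
      moreover have "((\<lambda>\<theta>. \<xi> + \<theta> *\<^sub>R v) has_derivative (\<lambda>h. h *\<^sub>R v)) (at \<theta>)"
        by (auto intro!: derivative_eq_intros)
      ultimately have "((\<lambda>\<theta>. P (\<xi> + \<theta> *\<^sub>R v)) has_derivative (\<lambda>h. (h *\<^sub>R v) \<bullet> gradient P (\<xi> + \<theta> *\<^sub>R v))) (at \<theta>)"
        by (rule has_derivative_compose[rotated])
      moreover have "(h *\<^sub>R v) \<bullet> gradient P (\<xi> + \<theta> *\<^sub>R v) = ((s - \<xi> $ i) * g (\<xi> + \<theta> *\<^sub>R v)) * h" for h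
        by (simp add: v_def g_def inner_axis')
      ultimately show ?thesis unfolding has_field_derivative_def by (simp only:)
    qed
    obtain \<theta> where \<theta>: "0 < \<theta>" "\<theta> < 1" "P (\<xi> + 1 *\<^sub>R v) - P (\<xi> + 0 *\<^sub>R v) = (1 - 0) * ((s - \<xi> $ i) * g (\<xi> + \<theta> *\<^sub>R v))"
      using MVT2[of 0 1 "\<lambda>\<theta>. P (\<xi> + \<theta> *\<^sub>R v)" "\<lambda>\<theta>. (s - \<xi> $ i) * g (\<xi> + \<theta> *\<^sub>R v)"] der by auto
    then have "\<bar>P (upd \<xi> i s) - P \<xi>\<bar> = \<bar>s - \<xi> $ i\<bar> * \<bar>g (\<xi> + \<theta> *\<^sub>R v)\<bar>" by (simp add: uv abs_mult)
    also have "\<dots> \<ge> \<bar>s - \<xi> $ i\<bar> * c" using gc[OF inb[of \<theta>]] \<theta> by (intro mult_left_mono) auto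
    finally show ?thesis by (simp add: mult.commute)
  qed
  with \<delta> c 0 show ?thesis by blast
qed

text \<open>Compactness leaves finitely many balls and a common constant. They are numbered because
  the pieces are later made disjoint in that order.\<close>

lemma expanding_cover:
  fixes P :: "real^'n \<Rightarrow> real"
  assumes sm: "smooth_on (- {0}) P" and ns: "nonsingular P" and A: "compact A" "0 \<notin> A"
  shows "\<exists>N c (B :: nat \<Rightarrow> (real^'n) set) i. c > 0 \<and> A \<subseteq> (\<Union>l<N. B l) \<and>
    (\<forall>l<N. compact (B l) \<and> 0 \<notin> B l \<and>
      (\<forall>\<xi> s. \<xi> \<in> B l \<longrightarrow> upd \<xi> (i l) s \<in> B l \<longrightarrow> c * \<bar>s - \<xi> $ i l\<bar> \<le> \<bar>P (upd \<xi> (i l) s) - P \<xi>\<bar>))"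
proof -
  have "\<forall>\<eta>\<in>A. \<exists>\<delta> c i. \<delta> > 0 \<and> c > 0 \<and> 0 \<notin> cball \<eta> \<delta> \<and>
    (\<forall>\<xi> s. \<xi> \<in> cball \<eta> \<delta> \<longrightarrow> upd \<xi> i s \<in> cball \<eta> \<delta> \<longrightarrow> c * \<bar>s - \<xi> $ i\<bar> \<le> \<bar>P (upd \<xi> i s) - P \<xi>\<bar>)"
    using expanding_near[OF sm ns] A(2) by metis
  then obtain \<delta> c i where *: "\<And>\<eta>. \<eta> \<in> A \<Longrightarrow> \<delta> \<eta> > 0 \<and> c \<eta> > 0 \<and> 0 \<notin> cball \<eta> (\<delta> \<eta>) \<and>
    (\<forall>\<xi> s. \<xi> \<in> cball \<eta> (\<delta> \<eta>) \<longrightarrow> upd \<xi> (i \<eta>) s \<in> cball \<eta> (\<delta> \<eta>) \<longrightarrow> c \<eta> * \<bar>s - \<xi> $ i \<eta>\<bar> \<le> \<bar>P (upd \<xi> (i \<eta>) s) - P \<xi>\<bar>)"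
    by metis
  have "A \<subseteq> (\<Union>\<eta>\<in>A. ball \<eta> (\<delta> \<eta>))" using * centre_in_ball by blast
  then obtain T where T: "T \<subseteq> A" "finite T" "A \<subseteq> (\<Union>\<eta>\<in>T. ball \<eta> (\<delta> \<eta>))"
    using compactE_image[OF A(1), of A "\<lambda>\<eta>. ball \<eta> (\<delta> \<eta>)"] by auto
  obtain xs where xs: "set xs = T" using finite_list[OF T(2)] by blast
  \<comment> \<open>The inserted 1 keeps the minimum defined and positive when \<open>T\<close> is
    empty.\<close>
  define c0 where "c0 = Min (insert 1 (c ` T))"
  have c0: "c0 > 0" using T * by (auto simp: c0_def)
  have c0le: "c0 \<le> c \<eta>" if "\<eta> \<in> T" for \<eta> using T that by (auto simp: c0_def)
  show ?thesis
  proof (intro exI[of _ "length xs"] exI[of _ c0] exI[of _ "\<lambda>l. cball (xs ! l) (\<delta> (xs ! l))"] exI[of _ "\<lambda>l. i (xs ! l)"] conjI allI impI)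
    show "c0 > 0" by fact
    show "A \<subseteq> (\<Union>l<length xs. cball (xs ! l) (\<delta> (xs ! l)))"
    proof
      fix x assume "x \<in> A"
      then obtain \<eta> where "\<eta> \<in> T" "x \<in> ball \<eta> (\<delta> \<eta>)" using T(3) by blast
      moreover then obtain l where "l < length xs" "xs ! l = \<eta>" by (metis xs in_set_conv_nth)
      ultimately show "x \<in> (\<Union>l<length xs. cball (xs ! l) (\<delta> (xs ! l)))" using ball_subset_cball by blast
    qed
    fix l assume "l < length xs"
    then have l: "xs ! l \<in> T" using xs by auto
    then have lA: "xs ! l \<in> A" using T by auto
    show "compact (cball (xs ! l) (\<delta> (xs ! l)))" by simp
    show "0 \<notin> cball (xs ! l) (\<delta> (xs ! l))" using *[OF lA] by blast
    fix \<xi> s assume "\<xi> \<in> cball (xs ! l) (\<delta> (xs ! l))" "upd \<xi> (i (xs ! l)) s \<in> cball (xs ! l) (\<delta> (xs ! l))"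
    then have "c (xs ! l) * \<bar>s - \<xi> $ i (xs ! l)\<bar> \<le> \<bar>P (upd \<xi> (i (xs ! l)) s) - P \<xi>\<bar>"
      using *[OF lA] by blast
    moreover have "c0 * \<bar>s - \<xi> $ i (xs ! l)\<bar> \<le> c (xs ! l) * \<bar>s - \<xi> $ i (xs ! l)\<bar>"
      using c0le[OF l] by (intro mult_right_mono) auto
    ultimately show "c0 * \<bar>s - \<xi> $ i (xs ! l)\<bar> \<le> \<bar>P (upd \<xi> (i (xs ! l)) s) - P \<xi>\<bar>" by linarith
  qed
qed

text \<open>Under dilation by L the values of \<open>P\<close> scale by \<open>L powr k\<close> and
  the coordinates by L, so the expansion constant scales by their quotient.\<close>

lemma expanding_scale:
  fixes P :: "real^'n \<Rightarrow> real"
  assumes hom: "homogeneous k P" and L: "L > 0" and B0: "0 \<notin> B"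
    and ex: "\<And>\<xi> s. \<xi> \<in> B \<Longrightarrow> upd \<xi> i s \<in> B \<Longrightarrow> c * \<bar>s - \<xi> $ i\<bar> \<le> \<bar>P (upd \<xi> i s) - P \<xi>\<bar>"
    and \<xi>: "\<xi> \<in> (*\<^sub>R) L ` B" and u: "upd \<xi> i s \<in> (*\<^sub>R) L ` B"
  shows "(c * L powr k / L) * \<bar>s - \<xi> $ i\<bar> \<le> \<bar>P (upd \<xi> i s) - P \<xi>\<bar>"
proof -
  obtain x where x: "x \<in> B" "\<xi> = L *\<^sub>R x" using \<xi> by auto
  obtain y where y: "y \<in> B" "upd \<xi> i s = L *\<^sub>R y" using u by auto
  have yx: "y = upd x i (s / L)"
  proof -
    have "L *\<^sub>R y = L *\<^sub>R upd x i (s / L)"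
      using L unfolding y(2)[symmetric] x(2) by (auto simp: vec_eq_iff upd_nth)
    then show ?thesis using L by simp
  qed
  have "x \<noteq> 0" "y \<noteq> 0" using x y B0 by auto
  then have "P (upd \<xi> i s) = L powr k * P y" "P \<xi> = L powr k * P x"
    using hom L y(2) x(2) unfolding homogeneous_def by auto
  then have P: "P (upd \<xi> i s) - P \<xi> = L powr k * (P y - P x)"
    by (simp add: right_diff_distrib)
  have "c * \<bar>s / L - x $ i\<bar> \<le> \<bar>P y - P x\<bar>" using ex[of x "s / L"] x y yx by simp
  then have "L powr k * (c * \<bar>s / L - x $ i\<bar>) \<le> L powr k * \<bar>P y - P x\<bar>" by (intro mult_left_mono) auto
  also have "\<dots> = \<bar>P (upd \<xi> i s) - P \<xi>\<bar>" unfolding P by (simp add: abs_mult)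
  also have "s / L - x $ i = (s - \<xi> $ i) / L" using L x(2) by (simp add: field_simps)
  finally show ?thesis using L by (simp add: abs_divide mult_ac)
qed

section \<open>Linearity of waves and of their ball averages\<close>

lemma set_integrable_ball_bounded:
  fixes U :: "real^'n \<Rightarrow> complex"
  assumes [measurable]: "U \<in> borel_measurable borel" and B: "\<And>u. cmod (U u) \<le> B"
  shows "set_integrable lborel (ball x r) U"
proof -
  have [measurable]: "ball x r \<in> sets borel" by simp
  have 1: "integrable lborel (\<lambda>u. complex_of_real (indicator (ball x r) u))"
    using integrable_real_indicator[of "ball x r" lborel] emeasure_lborel_ball_finite[of x r] by simp
  have "integrable lborel (\<lambda>u. complex_of_real (indicator (ball x r) u) * U u)"
    by (rule integrable_mult_bounded[OF 1 _ B]) measurable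
  then show ?thesis by (simp add: set_integrable_def scaleR_conv_of_real)
qed

lemma cmod_wave_le: "cmod (wave P F t x) \<le> (LINT \<xi>|lborel. cmod (F \<xi>))"
  unfolding wave_def by (rule order_trans[OF integral_norm_bound]) (simp add: norm_mult)

lemma set_integrable_wave:
  assumes [measurable]: "P \<in> borel_measurable borel" "F \<in> borel_measurable borel"
  shows "set_integrable lborel (ball x r) (wave P F t)"
  by (rule set_integrable_ball_bounded[OF _ cmod_wave_le]) measurable

lemma integrable_phase:
  assumes [measurable]: "P \<in> borel_measurable borel" and "integrable lborel F"
  shows "integrable lborel (\<lambda>\<xi>. F \<xi> * ee (x \<bullet> \<xi> + t * P \<xi>))"
  by (rule integrable_mult_bounded[OF assms(2), where B=1]) auto

lemma wave_sum:
  assumes [measurable]: "P \<in> borel_measurable borel" and "\<And>l. l \<in> A \<Longrightarrow> integrable lborel (F l)"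
  shows "wave P (\<lambda>\<xi>. \<Sum>l\<in>A. F l \<xi>) t x = (\<Sum>l\<in>A. wave P (F l) t x)"
  unfolding wave_def sum_distrib_right
  by (rule Bochner_Integration.integral_sum) (auto intro!: integrable_phase assms)

lemma ball_average_lborel:
  fixes U :: "real^'n \<Rightarrow> complex"
  assumes "U \<in> borel_measurable borel"
  shows "ball_average U x r = (LINT y:ball x r|lborel. U y) / measure lebesgue (ball x r)"
  by (simp add: ball_average_def set_lebesgue_integral_ball_lborel[OF assms])

lemma ball_average_sum:
  fixes U :: "'l \<Rightarrow> real^'n \<Rightarrow> complex"
  assumes "finite A" and [measurable]: "\<And>l. l \<in> A \<Longrightarrow> U l \<in> borel_measurable borel"
    and "\<And>l. l \<in> A \<Longrightarrow> set_integrable lborel (ball x r) (U l)"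
  shows "ball_average (\<lambda>u. \<Sum>l\<in>A. U l u) x r = (\<Sum>l\<in>A. ball_average (U l) x r)"
proof -
  have "(LINT y:ball x r|lborel. (\<Sum>l\<in>A. U l y)) = (\<Sum>l\<in>A. LINT y:ball x r|lborel. U l y)"
    using assms(3) unfolding set_lebesgue_integral_def set_integrable_def scaleR_sum_right
    by (rule Bochner_Integration.integral_sum)
  then show ?thesis using assms(1) by (simp add: ball_average_lborel sum_divide_distrib)
qed

text \<open>The frequency range is the dilate by \<open>2 ^ j\<close> of one fixed annulus, so the
  number of pieces, their expansion constant and the bound for \<open>P\<close> are all determined
  at unit scale. After rescaling, \<open>\<Lambda> / c'\<close> equals \<open>L / c\<close>, and
  this factor L is the 1 in the exponent.\<close>

lemma maximal_dyadic:
  fixes P :: "real^'n \<Rightarrow> real" and \<mu> :: "(real^'n) measure"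
  assumes \<mu>: "\<mu> \<in> M_meas \<alpha>" and \<alpha>: "0 \<le> \<alpha>" "\<alpha> \<le> real CARD('n)" and P[measurable]: "P \<in> borel_measurable borel"
    and sm: "smooth_on (- {0}) P" and hom: "homogeneous k P" and ns: "nonsingular P"
  shows "\<exists>C\<ge>0. \<forall>j (F :: real^'n \<Rightarrow> complex). integrable lborel F \<longrightarrow> (\<forall>\<xi>. F \<xi> \<noteq> 0 \<longrightarrow> 2 ^ j / 2 \<le> norm \<xi> \<and> norm \<xi> \<le> 2 ^ j) \<longrightarrow>
     maximal_bound \<mu> P F (ennreal (C * real (Suc j) * (2 ^ j) powr (real CARD('n) - \<alpha> + 1)) * L2sq F)"
proof -
  obtain C1 where C1: "C1 \<ge> 0" and
   piece: "\<forall>j \<Lambda> c i S (F :: real^'n \<Rightarrow> complex) (G :: real^'n \<Rightarrow> complex). \<Lambda> > 0 \<longrightarrow> c > 0 \<longrightarrow> integrable lborel G \<longrightarrow> compact S \<longrightarrow> (\<forall>\<xi>. \<xi> \<notin> S \<longrightarrow> G \<xi> = 0) \<longrightarrow>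
     continuous_on S P \<longrightarrow> (\<forall>\<xi> s. \<xi> \<in> S \<longrightarrow> upd \<xi> i s \<in> S \<longrightarrow> c * \<bar>s - \<xi> $ i\<bar> \<le> \<bar>P (upd \<xi> i s) - P \<xi>\<bar>) \<longrightarrow>
     (\<forall>\<xi>. F \<xi> = G \<xi> * exp (- pi * (P \<xi>)\<^sup>2 / \<Lambda>\<^sup>2) * exp (- pi * (norm \<xi>)\<^sup>2 / (2 ^ j)\<^sup>2)) \<longrightarrow>
     maximal_bound \<mu> P F (ennreal (C1 * \<Lambda> / c * real (Suc j) * (2 ^ j) powr (real CARD('n) - \<alpha>)) * L2sq G)"
    using maximal_piece[OF \<mu> \<alpha> P] by (elim exE conjE) (rule that)
  define A where "A = {\<xi> :: real^'n. 1 / 2 \<le> norm \<xi> \<and> norm \<xi> \<le> 1}"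
  have "A = cball 0 1 - ball 0 (1/2)" by (auto simp: A_def)
  then have A: "compact A" "0 \<notin> A" by (auto simp: compact_diff)
  have contP: "continuous_on (- {0}) P" by (rule smooth_on_punctured(1)[OF sm])
  then have "continuous_on A P" using A(2) by (auto elim: continuous_on_subset)
  then have "compact (P ` A)" using A(1) by (rule compact_continuous_image)
  then obtain B where "\<forall>\<xi>\<in>A. \<bar>P \<xi>\<bar> \<le> B" by (auto dest!: compact_imp_bounded simp: bounded_iff)
  then have B: "\<And>\<xi>. \<xi> \<in> A \<Longrightarrow> \<bar>P \<xi>\<bar> \<le> B" by blast
  obtain N c and Bs :: "nat \<Rightarrow> (real^'n) set" and i where c: "c > 0"
    and cover: "A \<subseteq> (\<Union>l<N. Bs l)"
    and Bs_all: "\<forall>l<N. compact (Bs l) \<and> 0 \<notin> Bs l \<and>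
      (\<forall>\<xi> s. \<xi> \<in> Bs l \<longrightarrow> upd \<xi> (i l) s \<in> Bs l \<longrightarrow> c * \<bar>s - \<xi> $ i l\<bar> \<le> \<bar>P (upd \<xi> (i l) s) - P \<xi>\<bar>)"
    using expanding_cover[OF sm ns A] by (elim exE conjE) (rule that)
  have Bs: "\<And>l. l < N \<Longrightarrow> compact (Bs l)" "\<And>l. l < N \<Longrightarrow> 0 \<notin> Bs l"
     "\<And>l \<xi> s. l < N \<Longrightarrow> \<xi> \<in> Bs l \<Longrightarrow> upd \<xi> (i l) s \<in> Bs l \<Longrightarrow> c * \<bar>s - \<xi> $ i l\<bar> \<le> \<bar>P (upd \<xi> (i l) s) - P \<xi>\<bar>"
    using Bs_all by simp_all
  \<comment> \<open>Bounds the reciprocals of the two Gaussian multipliers on the support, where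
    \<open>\<bar>P \<xi>\<bar>\<close> is at most \<open>B * \<Lambda>\<close> and
    \<open>norm \<xi>\<close> is at most L.\<close>
  define K where "K = exp (pi * B\<^sup>2 + pi)"
  \<comment> \<open>One factor N comes from squaring a sum of N terms, the other from adding N
    integrals; \<open>K\<^sup>2\<close> compares \<open>G l\<close> with \<open>F\<close>.\<close>
  define C where "C = real N * (real N * (C1 / c * K\<^sup>2))"
  show ?thesis
  proof (intro exI[of _ C] conjI allI impI)
    show "C \<ge> 0" using C1 c by (simp add: C_def)
    fix j :: nat and F :: "real^'n \<Rightarrow> complex"
    assume F: "integrable lborel F" and supp: "\<forall>\<xi>. F \<xi> \<noteq> 0 \<longrightarrow> 2 ^ j / 2 \<le> norm \<xi> \<and> norm \<xi> \<le> 2 ^ j"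
    have [measurable]: "F \<in> borel_measurable borel" using F by auto
    define L :: real where "L = 2 ^ j"
    have L: "L > 0" by (simp add: L_def)
    define \<Lambda> where "\<Lambda> = L powr k"
    have \<Lambda>: "\<Lambda> > 0" using L by (simp add: \<Lambda>_def)
    define S where "S l = (*\<^sub>R) L ` Bs l" for l
    have S: "compact (S l)" if "l < N" for l
      unfolding S_def using Bs(1)[OF that] by (rule compact_scaling)
    have S0: "0 \<notin> S l" if "l < N" for l using Bs(2)[OF that] L by (auto simp: S_def)
    have scaleA: "(1 / L) *\<^sub>R \<xi> \<in> A" if "F \<xi> \<noteq> 0" for \<xi>
      using supp[rule_format, OF that] L by (auto simp: A_def L_def[symmetric] field_simps)
    have PB: "\<bar>P \<xi>\<bar> \<le> B * \<Lambda>" if "F \<xi> \<noteq> 0" for \<xi>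
    proof -
      have "(1 / L) *\<^sub>R \<xi> \<noteq> 0" using scaleA[OF that] A(2) by metis
      then have "P (L *\<^sub>R ((1 / L) *\<^sub>R \<xi>)) = \<Lambda> * P ((1 / L) *\<^sub>R \<xi>)"
        using hom L unfolding homogeneous_def \<Lambda>_def by blast
      then have "\<bar>P \<xi>\<bar> = \<Lambda> * \<bar>P ((1 / L) *\<^sub>R \<xi>)\<bar>" using L \<Lambda> by (simp add: abs_mult)
      also have "\<dots> \<le> \<Lambda> * B" using \<Lambda> B[OF scaleA[OF that]] by (intro mult_left_mono) auto
      finally show ?thesis by (simp add: mult.commute)
    qed
    \<comment> \<open>The covering sets may overlap; removing the earlier ones makes the
      restrictions \<open>Fl l\<close> add up to exactly \<open>F\<close>.\<close>
    define D where "D l = S l - (\<Union>m<l. S m)" for l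
    have Sm: "S l \<in> sets borel" if "l < N" for l using S[OF that] by (simp add: compact_imp_closed)
    have Dm: "D l \<in> sets borel" if "l < N" for l unfolding D_def using that by (auto intro!: sets.Diff sets.finite_UN Sm)
    define Fl where "Fl l \<xi> = F \<xi> * indicator (D l) \<xi>" for l \<xi>
    have Flm[measurable]: "Fl l \<in> borel_measurable borel" if "l < N" for l
      unfolding Fl_def using Dm[OF that] by measurable
    have Flint: "integrable lborel (Fl l)" if "l < N" for l
      unfolding Fl_def using Dm[OF that] by (intro integrable_mult_bounded[OF F, where B=1]) (auto split: split_indicator)
    have Fsum: "F = (\<lambda>\<xi>. \<Sum>l<N. Fl l \<xi>)"
    proof
      fix \<xi> show "F \<xi> = (\<Sum>l<N. Fl l \<xi>)"
      proof (cases "F \<xi> = 0")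
        case False
        obtain l where "l < N" "(1 / L) *\<^sub>R \<xi> \<in> Bs l" using scaleA[OF False] cover by auto
        then have l: "l < N" "\<xi> \<in> S l" unfolding S_def using L by (auto intro!: image_eqI[where x="(1 / L) *\<^sub>R \<xi>"])
        define q where "q = (LEAST l. \<xi> \<in> S l)"
        have q: "\<xi> \<in> S q" "q \<le> l" "\<And>m. m < q \<Longrightarrow> \<xi> \<notin> S m"
          unfolding q_def using l(2) by (auto intro: LeastI Least_le dest: not_less_Least)
        have "Fl m \<xi> = (if m = q then F \<xi> else 0)" if "m < N" for m
          using q(1,3) that by (cases m q rule: linorder_cases) (auto simp: Fl_def D_def split: split_indicator)
        then have "(\<Sum>l<N. Fl l \<xi>) = (\<Sum>m<N. if m = q then F \<xi> else 0)" by (intro sum.cong) auto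
        also have "\<dots> = F \<xi>" using q(2) l(1) by simp
        finally show ?thesis ..
      qed (simp add: Fl_def)
    qed
    \<comment> \<open>Reciprocal of the multipliers introduced by the two convolutions, so that
      damping \<open>G l\<close> gives back \<open>Fl l\<close>.\<close>
    define w where "w \<xi> = exp (pi * (P \<xi>)\<^sup>2 / \<Lambda>\<^sup>2) * exp (pi * (norm \<xi>)\<^sup>2 / L\<^sup>2)" for \<xi>
    have [measurable]: "w \<in> borel_measurable borel" unfolding w_def by measurable
    have w0: "w \<xi> > 0" for \<xi> by (simp add: w_def)
    have wK: "w \<xi> \<le> K" if "F \<xi> \<noteq> 0" for \<xi>
    proof -
      have "(P \<xi>)\<^sup>2 \<le> (B * \<Lambda>)\<^sup>2" using PB[OF that] by (intro abs_le_square_iff[THEN iffD1]) simp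
      then have 1: "(P \<xi>)\<^sup>2 / \<Lambda>\<^sup>2 \<le> B\<^sup>2" using \<Lambda> by (simp add: power_mult_distrib divide_le_eq)
      have "(norm \<xi>)\<^sup>2 \<le> L\<^sup>2" using supp[rule_format, OF that] by (intro power_mono) (auto simp: L_def)
      then have 2: "(norm \<xi>)\<^sup>2 / L\<^sup>2 \<le> 1" using L by (simp add: divide_le_eq)
      have "pi * ((P \<xi>)\<^sup>2 / \<Lambda>\<^sup>2) + pi * ((norm \<xi>)\<^sup>2 / L\<^sup>2) \<le> pi * B\<^sup>2 + pi * 1"
        using 1 2 by (intro add_mono mult_left_mono) auto
      then show ?thesis by (simp add: w_def K_def exp_add[symmetric])
    qed
    define G where "G l \<xi> = Fl l \<xi> * complex_of_real (w \<xi>)" for l \<xi>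
    have Gle: "cmod (G l \<xi>) \<le> K * cmod (F \<xi>)" for l \<xi>
    proof (cases "F \<xi> = 0")
      case False
      then show ?thesis using wK[OF False] w0[of \<xi>]
        by (auto simp: G_def Fl_def norm_mult K_def mult.commute[of "exp _"] split: split_indicator intro!: mult_left_mono)
    qed (simp add: G_def Fl_def)
    have Gm: "G l \<in> borel_measurable borel" if "l < N" for l
      unfolding G_def using Flm[OF that] by measurable
    have Gint: "integrable lborel (G l)" if "l < N" for l
    proof (rule Bochner_Integration.integrable_bound)
      show "integrable lborel (\<lambda>\<xi>. K *\<^sub>R F \<xi>)" using F by simp
      show "G l \<in> borel_measurable lborel" using Gm[OF that] by simp
      show "AE \<xi> in lborel. norm (G l \<xi>) \<le> norm (K *\<^sub>R F \<xi>)" using Gle by (simp add: K_def)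
    qed
    have GI: "L2sq (G l) \<le> ennreal (K\<^sup>2) * L2sq F" for l
    proof -
      have "(cmod (G l \<xi>))\<^sup>2 \<le> K\<^sup>2 * (cmod (F \<xi>))\<^sup>2" for \<xi>
        using power_mono[OF Gle[of l \<xi>], of 2] by (simp add: power_mult_distrib)
      then have "L2sq (G l) \<le> (\<integral>\<^sup>+\<xi>. ennreal (K\<^sup>2) * ennreal ((cmod (F \<xi>))\<^sup>2) \<partial>lborel)"
        by (intro nn_integral_mono) (simp add: ennreal_mult[symmetric] ennreal_leI)
      then show ?thesis by (simp add: nn_integral_cmult)
    qed
    define R where "R = real (Suc j) * (2 ^ j) powr (real CARD('n) - \<alpha> + 1)"
    have R0: "R \<ge> 0" by (simp add: R_def)
    have ex: "maximal_bound \<mu> P (Fl l) (ennreal (C1 / c * R) * L2sq (G l))" if l: "l < N" for l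
    proof -
      define c' where "c' = c * L powr k / L"
      have c': "c' > 0" using c L by (simp add: c'_def)
      have "C1 * \<Lambda> / c' * real (Suc j) * (2 ^ j) powr (real CARD('n) - \<alpha>) = C1 / c * R"
      proof -
        \<comment> \<open>The cost \<open>L powr k\<close> of the time supremum meets the gain
          \<open>1 / c'\<close> of local smoothing, and the powers of degree k cancel.\<close>
        have 1: "C1 * \<Lambda> / c' = C1 / c * L" using L c by (simp add: c'_def \<Lambda>_def)
        have 2: "R = real (Suc j) * (L * L powr (real CARD('n) - \<alpha>))"
          using L unfolding R_def L_def[symmetric] powr_add by simp
        show ?thesis unfolding 1 2 L_def[symmetric] by (simp only: mult_ac)
      qed
      moreover have "maximal_bound \<mu> P (Fl l) (ennreal (C1 * \<Lambda> / c' * real (Suc j) * (2 ^ j) powr (real CARD('n) - \<alpha>)) * L2sq (G l))"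
      proof (rule piece[rule_format, OF \<Lambda> c' Gint[OF l] S[OF l], where i = "i l"])
        show "G l \<xi> = 0" if "\<xi> \<notin> S l" for \<xi> using that by (auto simp: G_def Fl_def D_def)
        show "continuous_on (S l) P" using contP S0[OF l] by (auto elim: continuous_on_subset)
        show "c' * \<bar>s - \<xi> $ i l\<bar> \<le> \<bar>P (upd \<xi> (i l) s) - P \<xi>\<bar>" if "\<xi> \<in> S l" "upd \<xi> (i l) s \<in> S l" for \<xi> s
          using that unfolding S_def c'_def by (intro expanding_scale[OF hom L Bs(2)[OF l] Bs(3)[OF l]])
        show "Fl l \<xi> = G l \<xi> * exp (- pi * (P \<xi>)\<^sup>2 / \<Lambda>\<^sup>2) * exp (- pi * (norm \<xi>)\<^sup>2 / (2 ^ j)\<^sup>2)" for \<xi>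
        proof -
          have "w \<xi> * exp (- pi * (P \<xi>)\<^sup>2 / \<Lambda>\<^sup>2) * exp (- pi * (norm \<xi>)\<^sup>2 / (2 ^ j)\<^sup>2) = 1"
            by (simp add: w_def L_def exp_add[symmetric])
          then show "Fl l \<xi> = G l \<xi> * exp (- pi * (P \<xi>)\<^sup>2 / \<Lambda>\<^sup>2) * exp (- pi * (norm \<xi>)\<^sup>2 / (2 ^ j)\<^sup>2)"
            unfolding G_def mult.assoc of_real_mult[symmetric] by simp
        qed
      qed
      ultimately show ?thesis by simp
    qed
    then obtain Ml where Mlm: "\<And>l. l < N \<Longrightarrow> Ml l \<in> borel_measurable borel"
      and Ml1: "\<And>l r t x. l < N \<Longrightarrow> 0 < r \<Longrightarrow> r \<le> 1 \<Longrightarrow> ennreal ((cmod (ball_average (wave P (Fl l) t) x r))\<^sup>2) \<le> Ml l x"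
      and Ml2: "\<And>l. l < N \<Longrightarrow> (\<integral>\<^sup>+x. Ml l x \<partial>\<mu>) \<le> ennreal (C1 / c * R) * L2sq (G l)"
      by metis
    define M where "M x = ennreal (real N) * (\<Sum>l<N. Ml l x)" for x
    from \<mu> have sets\<mu>[measurable_cong]: "sets \<mu> = sets borel" by (auto simp: M_meas_def)
    have Mlm': "Ml l \<in> borel_measurable \<mu>" if "l < N" for l using Mlm[OF that] by measurable
    show "maximal_bound \<mu> P F (ennreal (C * real (Suc j) * (2 ^ j) powr (real CARD('n) - \<alpha> + 1)) * L2sq F)"
    proof (intro bexI[of _ M] conjI allI impI)
      have [measurable]: "(\<lambda>x. \<Sum>l<N. Ml l x) \<in> borel_measurable borel"
        using Mlm by (intro borel_measurable_sum) auto
      show "M \<in> borel_measurable borel" unfolding M_def by measurable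
      fix r t :: real and x assume r: "0 < r" "r \<le> 1"
      have "wave P F t = (\<lambda>u. \<Sum>l<N. wave P (Fl l) t u)"
        by (subst Fsum) (auto intro!: ext wave_sum Flint)
      then have "ball_average (wave P F t) x r = (\<Sum>l<N. ball_average (wave P (Fl l) t) x r)"
        using Flm by (auto intro!: ball_average_sum set_integrable_wave measurable_wave)
      then have "cmod (ball_average (wave P F t) x r) \<le> (\<Sum>l<N. cmod (ball_average (wave P (Fl l) t) x r))"
        by (simp add: norm_sum)
      then have "(cmod (ball_average (wave P F t) x r))\<^sup>2 \<le> (\<Sum>l<N. cmod (ball_average (wave P (Fl l) t) x r))\<^sup>2"
        by (intro power_mono) auto
      also have "\<dots> \<le> (\<Sum>l<N. (cmod (ball_average (wave P (Fl l) t) x r))\<^sup>2) * real N"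
        using sum_squared_le_sum_of_squares[of "\<lambda>l. cmod (ball_average (wave P (Fl l) t) x r)" "{..<N}"] by simp
      finally have "ennreal ((cmod (ball_average (wave P F t) x r))\<^sup>2) \<le> ennreal (real N) * (\<Sum>l<N. ennreal ((cmod (ball_average (wave P (Fl l) t) x r))\<^sup>2))"
        by (simp add: ennreal_mult[symmetric] sum_nonneg ennreal_leI mult.commute)
      also have "\<dots> \<le> M x" unfolding M_def using r by (intro mult_left_mono sum_mono Ml1) auto
      finally show "ennreal ((cmod (ball_average (wave P F t) x r))\<^sup>2) \<le> M x" .
    next
      let ?I = "\<integral>\<^sup>+\<xi>. ennreal ((cmod (F \<xi>))\<^sup>2) \<partial>lborel"
      have "(\<integral>\<^sup>+x. M x \<partial>\<mu>) = ennreal (real N) * (\<Sum>l<N. \<integral>\<^sup>+x. Ml l x \<partial>\<mu>)"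
      proof -
        have "(\<lambda>x. \<Sum>l<N. Ml l x) \<in> borel_measurable \<mu>" using Mlm' by (intro borel_measurable_sum) auto
        moreover have "(\<integral>\<^sup>+x. (\<Sum>l<N. Ml l x) \<partial>\<mu>) = (\<Sum>l<N. \<integral>\<^sup>+x. Ml l x \<partial>\<mu>)"
          using Mlm' by (intro nn_integral_sum) auto
        ultimately show ?thesis unfolding M_def by (simp add: nn_integral_cmult)
      qed
      also have "\<dots> \<le> ennreal (real N) * (\<Sum>l<N. ennreal (C1 / c * R) * (ennreal (K\<^sup>2) * ?I))"
        by (intro mult_left_mono sum_mono order_trans[OF Ml2]) (auto intro!: mult_left_mono GI)
      also have "\<dots> = ennreal (real N) * (ennreal (real N) * (ennreal (C1 / c * R) * (ennreal (K\<^sup>2) * ?I)))"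
        by (simp add: ennreal_of_nat_eq_real_of_nat)
      also have "\<dots> = ennreal (real N * (real N * ((C1 / c * R) * K\<^sup>2))) * ?I"
        using C1 c R0 by (simp only: ennreal_mult mult_nonneg_nonneg of_nat_0_le_iff divide_nonneg_pos zero_le_power2 mult.assoc)
      also have "real N * (real N * ((C1 / c * R) * K\<^sup>2)) = C * real (Suc j) * (2 ^ j) powr (real CARD('n) - \<alpha> + 1)"
        by (simp add: C_def R_def)
      finally show "(\<integral>\<^sup>+x. M x \<partial>\<mu>) \<le> ennreal (C * real (Suc j) * (2 ^ j) powr (real CARD('n) - \<alpha> + 1)) * ?I" .
    qed
  qed
qed

subsection \<open>The Fourier transform of a square integrable function\<close>

lemma borel_measurable_completion_cong_AE:
  fixes f g :: "'a \<Rightarrow> 'b::topological_space"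
  assumes f: "f \<in> borel_measurable (completion M)" and ae: "AE x in M. f x = g x"
  shows "g \<in> borel_measurable (completion M)"
proof (rule measurableI)
  fix A :: "'b set" assume A: "A \<in> sets borel"
  have "AE x in completion M. f x = g x" using ae by (rule AE_completion)
  then have "AE x in completion M. (x \<in> f -` A \<inter> space (completion M)) = (x \<in> g -` A \<inter> space (completion M))"
    by eventually_elim auto
  then show "g -` A \<inter> space (completion M) \<in> sets (completion M)"
    by (rule completion.in_sets_AE) (use measurable_sets[OF f A] in auto)
qed simp

lemma lebesgue_ex_borel_complex:
  fixes f :: "'a::euclidean_space \<Rightarrow> complex"
  assumes "f \<in> borel_measurable lebesgue"
  shows "\<exists>F\<in>borel_measurable borel. AE x in lborel. f x = F x"
proof -
  have "(\<lambda>x. Re (f x)) \<in> borel_measurable lebesgue" "(\<lambda>x. Im (f x)) \<in> borel_measurable lebesgue"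
    using assms by auto
  from this[THEN completion_ex_borel_measurable_real] obtain u v
    where uv[measurable]: "u \<in> borel_measurable lborel" "v \<in> borel_measurable lborel"
    and ae: "AE x in lborel. Re (f x) = u x" "AE x in lborel. Im (f x) = v x" by blast
  have m: "(\<lambda>x. Complex (u x) (v x)) \<in> borel_measurable borel"
    unfolding Complex_eq using uv by simp
  have "AE x in lborel. f x = Complex (u x) (v x)"
    using ae by eventually_elim (simp add: complex_eq_iff)
  then show ?thesis by (rule bexI[OF _ m])
qed

lemma ennreal_cmod_add_square: "ennreal ((cmod (a + b))\<^sup>2) \<le> 2 * ennreal ((cmod a)\<^sup>2) + 2 * ennreal ((cmod b)\<^sup>2)"
proof -
  have "(cmod (a + b))\<^sup>2 \<le> (cmod a + cmod b)\<^sup>2" by (intro power_mono norm_triangle_ineq) auto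
  also have "\<dots> \<le> 2 * (cmod a)\<^sup>2 + 2 * (cmod b)\<^sup>2"
    using sum_squares_bound[of "cmod a" "cmod b"] by (simp add: power2_sum)
  finally have "ennreal ((cmod (a + b))\<^sup>2) \<le> ennreal (2 * (cmod a)\<^sup>2 + 2 * (cmod b)\<^sup>2)" by (rule ennreal_leI)
  also have "\<dots> = 2 * ennreal ((cmod a)\<^sup>2) + 2 * ennreal ((cmod b)\<^sup>2)"
    by (simp add: ennreal_mult)
  finally show ?thesis .
qed

lemma nn_integral_cmod_add_square:
  fixes f g :: "'a \<Rightarrow> complex"
  assumes [measurable]: "f \<in> borel_measurable M" "g \<in> borel_measurable M"
  shows "(\<integral>\<^sup>+x. ennreal ((cmod (f x + g x))\<^sup>2) \<partial>M)
    \<le> 2 * (\<integral>\<^sup>+x. ennreal ((cmod (f x))\<^sup>2) \<partial>M) + 2 * (\<integral>\<^sup>+x. ennreal ((cmod (g x))\<^sup>2) \<partial>M)"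
proof -
  have "(\<integral>\<^sup>+x. ennreal ((cmod (f x + g x))\<^sup>2) \<partial>M) \<le> (\<integral>\<^sup>+x. 2 * ennreal ((cmod (f x))\<^sup>2) + 2 * ennreal ((cmod (g x))\<^sup>2) \<partial>M)"
    by (intro nn_integral_mono ennreal_cmod_add_square)
  also have "\<dots> = 2 * (\<integral>\<^sup>+x. ennreal ((cmod (f x))\<^sup>2) \<partial>M) + 2 * (\<integral>\<^sup>+x. ennreal ((cmod (g x))\<^sup>2) \<partial>M)"
    by (simp add: nn_integral_add nn_integral_cmult)
  finally show ?thesis .
qed

section \<open>Truncated transforms and the mean square limit that defines the transform\<close>

definition trunc :: "real \<Rightarrow> (real^'n \<Rightarrow> complex) \<Rightarrow> real^'n \<Rightarrow> complex" where
  "trunc R F x = indicator (ball 0 R) x * F x"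

lemma measurable_ball_indicator [measurable]:
  "(indicator (ball a R) :: 'a::euclidean_space \<Rightarrow> 'b::{real_normed_algebra_1, second_countable_topology}) \<in> borel_measurable borel"
  by (rule borel_measurable_indicator) simp

lemma measurable_trunc [measurable (raw)]:
  "F \<in> borel_measurable borel \<Longrightarrow> trunc R F \<in> borel_measurable borel"
  unfolding trunc_def[abs_def] by measurable

text \<open>On the ball \<open>cmod (F x) \<le> 1 + (cmod (F x))\<^sup>2\<close>, and the ball has
  finite measure.\<close>

lemma integrable_square_bounded_support:
  fixes F :: "real^'n \<Rightarrow> complex"
  assumes [measurable]: "F \<in> borel_measurable borel" and I: "L2sq F < \<infinity>"
    and supp: "\<And>x. x \<notin> ball 0 R \<Longrightarrow> F x = 0"
  shows "integrable lborel F"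
proof (rule integrableI_bounded)
  have b: "ball 0 R \<in> sets (borel :: (real^'n) measure)" by simp
  have "(\<integral>\<^sup>+x. ennreal (norm (F x)) \<partial>lborel) \<le> (\<integral>\<^sup>+x. indicator (ball 0 R) x + ennreal ((cmod (F x))\<^sup>2) \<partial>lborel)"
  proof (rule nn_integral_mono)
    fix x
    have "2 * cmod (F x) \<le> 1 + (cmod (F x))\<^sup>2" using sum_squares_bound[of 1 "cmod (F x)"] by simp
    then have "cmod (F x) \<le> 1 + (cmod (F x))\<^sup>2" using norm_ge_zero[of "F x"] by linarith
    then show "ennreal (norm (F x)) \<le> indicator (ball 0 R) x + ennreal ((cmod (F x))\<^sup>2)"
      using supp[of x] by (cases "x \<in> ball 0 R") (auto simp: ennreal_plus[symmetric] ennreal_1[symmetric] simp del: ennreal_plus ennreal_1 intro!: ennreal_leI)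
  qed
  also have "\<dots> = emeasure lborel (ball (0 :: real^'n) R) + L2sq F"
    using b by (subst nn_integral_add) (auto intro!: borel_measurable_indicator)
  also have "\<dots> < \<infinity>" using I emeasure_lborel_ball_finite[of "0::real^'n" R] by (simp add: less_top)
  finally show "(\<integral>\<^sup>+x. ennreal (norm (F x)) \<partial>lborel) < \<infinity>" .
qed simp

lemma cmod_trunc_le: "cmod (trunc R F x) \<le> cmod (F x)"
  by (auto simp: trunc_def split: split_indicator)

lemma nn_integral_trunc_le:
  "L2sq (trunc R F) \<le> L2sq F"
  by (intro nn_integral_mono ennreal_leI power_mono cmod_trunc_le) auto

lemma integrable_trunc:
  fixes F :: "real^'n \<Rightarrow> complex"
  assumes [measurable]: "F \<in> borel_measurable borel" and I: "L2sq F < \<infinity>"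
  shows "integrable lborel (trunc R F)"
proof (rule integrable_square_bounded_support)
  show "L2sq (trunc R F) < \<infinity>"
    using le_less_trans[OF nn_integral_trunc_le I] .
  show "x \<notin> ball 0 R \<Longrightarrow> trunc R F x = 0" for x by (simp add: trunc_def)
qed simp

text \<open>The integral of \<open>fourier_integral\<close> taken over \<open>lborel\<close>: joint
  measurability in both variables, and with it Fubini, refers to Borel sets rather than to the
  completion. Borel representatives connect the two versions.\<close>

definition fourier_L1 :: "(real^'n \<Rightarrow> complex) \<Rightarrow> real^'n \<Rightarrow> complex" where
  "fourier_L1 F \<xi> = (LINT x|lborel. F x * ee (- (x \<bullet> \<xi>)))"

lemma measurable_fourier_L1 [measurable]:
  assumes [measurable]: "F \<in> borel_measurable borel"
  shows "fourier_L1 F \<in> borel_measurable borel"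
  unfolding fourier_L1_def[abs_def] by measurable

lemma fourier_integral_eq_fourier_L1:
  fixes f F :: "real^'n \<Rightarrow> complex"
  assumes f: "f \<in> borel_measurable lebesgue" and [measurable]: "F \<in> borel_measurable borel" and ae: "AE x in lborel. f x = F x"
  shows "fourier_integral (\<lambda>x. indicator (ball 0 R) x * f x) = fourier_L1 (trunc R F)"
proof
  fix \<xi> :: "real^'n"
  have [measurable]: "f \<in> borel_measurable lebesgue" by fact
  have [measurable]: "ball 0 R \<in> sets (lebesgue :: (real^'n) measure)" by simp
  have [measurable]: "(\<lambda>x. ee (- (x \<bullet> \<xi>))) \<in> borel_measurable lebesgue"
    by (rule measurable_completion) measurable
  have "fourier_integral (\<lambda>x. indicator (ball 0 R) x * f x) \<xi> = (LINT x|lebesgue. trunc R F x * ee (- (x \<bullet> \<xi>)))"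
    unfolding fourier_integral_def
  proof (rule integral_cong_AE)
    show "(\<lambda>x. trunc R F x * ee (- (x \<bullet> \<xi>))) \<in> borel_measurable lebesgue"
      by (rule measurable_completion) measurable
    show "AE x in lebesgue. indicator (ball 0 R) x * f x * ee (- (x \<bullet> \<xi>)) = trunc R F x * ee (- (x \<bullet> \<xi>))"
      using AE_completion[OF ae] by eventually_elim (simp add: trunc_def)
  qed measurable
  also have "\<dots> = fourier_L1 (trunc R F) \<xi>"
    unfolding fourier_L1_def by (rule integral_completion) measurable
  finally show "fourier_integral (\<lambda>x. indicator (ball 0 R) x * f x) \<xi> = fourier_L1 (trunc R F) \<xi>" .
qed

text \<open>Schur's test with \<open>\<theta> \<xi> = - \<xi>\<close>: the kernel is a Gaussian of
  mass 1, hence \<open>A = 1\<close>. This half of Plancherel's theorem makes the truncated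
  transforms a Cauchy family.\<close>

lemma bessel_fourier_L1:
  fixes F :: "real^'n \<Rightarrow> complex"
  assumes F: "integrable lborel F"
  shows "L2sq (fourier_L1 F) \<le> L2sq F"
proof -
  have "L2sq (\<lambda>z. LINT \<xi>|lborel. F \<xi> * ee (z \<bullet> (- \<xi>)))
     \<le> 1 * L2sq F"
  proof (rule schur_gauss[where S=UNIV])
    show "(\<integral>\<^sup>+\<eta>. ennreal (gauss \<rho> (- a - - \<eta>)) * indicator UNIV \<eta> \<partial>lborel) \<le> 1" if "\<rho> > 0" for \<rho> and a :: "real^'n"
      using nn_integral_gauss_diff[OF that, of a] by (subst gauss_minus[symmetric]) simp
  qed (use F in auto)
  then show ?thesis by (simp add: fourier_L1_def inner_commute)
qed

lemma fourier_L1_diff: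
  assumes "integrable lborel F" "integrable lborel G"
  shows "fourier_L1 F \<xi> - fourier_L1 G \<xi> = fourier_L1 (\<lambda>x. F x - G x) \<xi>"
  unfolding fourier_L1_def left_diff_distrib
  by (rule Bochner_Integration.integral_diff[symmetric]; rule integrable_mult_bounded[where B=1]) (use assms in auto)

text \<open>The squared norm of \<open>F\<close> outside the ball of radius R, an explicit rate for
  the convergence of the truncated transforms.\<close>

definition L2tail :: "(real^'n \<Rightarrow> complex) \<Rightarrow> real \<Rightarrow> ennreal" where
  "L2tail F R = L2sq (\<lambda>x. F x - trunc R F x)"

lemma L2tail_tendsto:
  fixes F :: "real^'n \<Rightarrow> complex"
  assumes [measurable]: "F \<in> borel_measurable borel" and I: "L2sq F < \<infinity>"
  shows "(L2tail F \<longlongrightarrow> 0) at_top"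
proof -
  have int: "integrable lborel (\<lambda>x. (cmod (F x))\<^sup>2)"
    using I by (intro integrableI_bounded) auto
  have le: "(cmod (F x - trunc R F x))\<^sup>2 \<le> (cmod (F x))\<^sup>2" for R x
    by (auto simp: trunc_def split: split_indicator)
  have intR: "integrable lborel (\<lambda>x. (cmod (F x - trunc R F x))\<^sup>2)" for R
    by (rule Bochner_Integration.integrable_bound[OF int]) (use le in auto)
  have "((\<lambda>R. LINT x|lborel. (cmod (F x - trunc R F x))\<^sup>2) \<longlongrightarrow> (LINT x|(lborel :: (real^'n) measure). 0)) at_top"
  proof (rule integral_dominated_convergence_at_top[OF _ _ int])
    show "AE x in lborel. ((\<lambda>R. (cmod (F x - trunc R F x))\<^sup>2) \<longlongrightarrow> 0) at_top"
    proof (rule AE_I2)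
      fix x
      have "\<forall>\<^sub>F R in at_top. (cmod (F x - trunc R F x))\<^sup>2 = 0"
        using eventually_gt_at_top[of "norm x"] by eventually_elim (simp add: trunc_def)
      then show "((\<lambda>R. (cmod (F x - trunc R F x))\<^sup>2) \<longlongrightarrow> 0) at_top" by (rule tendsto_eventually)
    qed
    show "\<forall>\<^sub>F R in at_top. AE x in lborel. norm ((cmod (F x - trunc R F x))\<^sup>2) \<le> (cmod (F x))\<^sup>2"
      using le by simp
  qed auto
  then have "((\<lambda>R. ennreal (LINT x|lborel. (cmod (F x - trunc R F x))\<^sup>2)) \<longlongrightarrow> ennreal 0) at_top"
    by (intro tendsto_ennrealI) simp
  moreover have "L2tail F = (\<lambda>R. ennreal (LINT x|lborel. (cmod (F x - trunc R F x))\<^sup>2))"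
    unfolding L2tail_def by (rule ext) (rule nn_integral_eq_integral[OF intR], simp)
  ultimately show ?thesis by simp
qed

lemma fourier_L1_trunc_cauchy:
  fixes F :: "real^'n \<Rightarrow> complex"
  assumes [measurable]: "F \<in> borel_measurable borel" and I: "L2sq F < \<infinity>"
    and R: "R \<le> R'"
  shows "L2sq (\<lambda>\<xi>. fourier_L1 (trunc R' F) \<xi> - fourier_L1 (trunc R F) \<xi>) \<le> L2tail F R"
proof -
  note int = integrable_trunc[OF assms(1) I]
  have "L2sq (\<lambda>\<xi>. fourier_L1 (trunc R' F) \<xi> - fourier_L1 (trunc R F) \<xi>)
     \<le> L2sq (\<lambda>x. trunc R' F x - trunc R F x)"
    unfolding fourier_L1_diff[OF int int] by (rule bessel_fourier_L1) (intro Bochner_Integration.integrable_diff int)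
  also have "\<dots> \<le> L2tail F R"
    unfolding L2tail_def using R by (intro nn_integral_mono) (auto simp: trunc_def split: split_indicator)
  finally show ?thesis .
qed

text \<open>The completeness argument for square integrable functions, with a rate: along a fast
  sequence of radii the transforms converge almost everywhere, and Fatou's lemma carries the Cauchy
  bound over to the limit for every R, not only along the sequence.\<close>

lemma ex_L2_limit:
  fixes F :: "real^'n \<Rightarrow> complex"
  assumes F[measurable]: "F \<in> borel_measurable borel" and I: "L2sq F < \<infinity>"
  shows "\<exists>g\<in>borel_measurable borel. \<forall>R. L2sq (\<lambda>\<xi>. fourier_L1 (trunc R F) \<xi> - g \<xi>) \<le> L2tail F R"
proof -
  define h where "h R = fourier_L1 (trunc R F)" for R
  have [measurable]: "h R \<in> borel_measurable borel" for R unfolding h_def by measurable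
  have "\<exists>R0\<ge>real m. \<forall>R\<ge>R0. L2tail F R \<le> ennreal ((1 / 4) ^ m)" for m
  proof -
    have "\<forall>\<^sub>F R in at_top. L2tail F R < ennreal ((1 / 4) ^ m)"
      using L2tail_tendsto[OF F I] by (rule order_tendstoD) simp
    then obtain R1 where "\<forall>R\<ge>R1. L2tail F R < ennreal ((1 / 4) ^ m)" by (auto simp: eventually_at_top_linorder)
    then show ?thesis by (intro exI[of _ "max R1 (real m)"]) (auto intro: less_imp_le)
  qed
  then obtain R0 where R0: "\<And>m. R0 m \<ge> real m" "\<And>m R. R \<ge> R0 m \<Longrightarrow> L2tail F R \<le> ennreal ((1 / 4) ^ m)" by metis
  \<comment> \<open>The maximum makes the radii monotone, as the Cauchy estimate requires;
    \<open>R0 m \<ge> real m\<close> makes them unbounded.\<close>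
  define \<rho> where "\<rho> m = Max (R0 ` {..m})" for m
  have \<rho>R: "\<rho> m \<ge> R0 m" for m by (simp add: \<rho>_def)
  have \<rho>mono: "\<rho> m \<le> \<rho> (Suc m)" for m unfolding \<rho>_def by (rule Max_mono) auto
  define d where "d m \<xi> = cmod (h (\<rho> (Suc m)) \<xi> - h (\<rho> m) \<xi>)" for m \<xi>
  have [measurable]: "d m \<in> borel_measurable borel" for m unfolding d_def by measurable
  have dm: "(\<integral>\<^sup>+\<xi>. ennreal ((d m \<xi>)\<^sup>2) \<partial>lborel) \<le> ennreal ((1 / 4) ^ m)" for m
    unfolding d_def h_def using fourier_L1_trunc_cauchy[OF F I \<rho>mono] R0(2)[OF \<rho>R] by (rule order_trans)
  \<comment> \<open>The weight \<open>2 ^ m\<close> is played against the bound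
    \<open>(1 / 4) ^ m\<close>: the weighted sum stays integrable, and where it is finite it forces
    geometric decay of \<open>d m\<close>.\<close>
  have "(\<integral>\<^sup>+\<xi>. (\<Sum>m. ennreal (2 ^ m * (d m \<xi>)\<^sup>2)) \<partial>lborel) = (\<Sum>m. \<integral>\<^sup>+\<xi>. ennreal (2 ^ m * (d m \<xi>)\<^sup>2) \<partial>lborel)"
    by (rule nn_integral_suminf) measurable
  also have "\<dots> \<le> (\<Sum>m. ennreal ((1 / 2) ^ m))"
  proof (rule suminf_le)
    fix m
    have "(\<integral>\<^sup>+\<xi>. ennreal (2 ^ m * (d m \<xi>)\<^sup>2) \<partial>lborel) = ennreal (2 ^ m) * (\<integral>\<^sup>+\<xi>. ennreal ((d m \<xi>)\<^sup>2) \<partial>lborel)"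
      by (simp add: ennreal_mult nn_integral_cmult)
    also have "\<dots> \<le> ennreal (2 ^ m) * ennreal ((1 / 4) ^ m)" by (intro mult_left_mono dm) simp
    also have "\<dots> = ennreal ((1 / 2) ^ m)" by (simp add: ennreal_mult[symmetric] power_mult_distrib[symmetric])
    finally show "(\<integral>\<^sup>+\<xi>. ennreal (2 ^ m * (d m \<xi>)\<^sup>2) \<partial>lborel) \<le> ennreal ((1 / 2) ^ m)" .
  qed auto
  also have "\<dots> = ennreal 2"
    using geometric_sums[of "1/2::real"] by (intro suminf_ennreal_eq) auto
  finally have "(\<integral>\<^sup>+\<xi>. (\<Sum>m. ennreal (2 ^ m * (d m \<xi>)\<^sup>2)) \<partial>lborel) \<noteq> \<infinity>" by (auto simp: top_unique)
  then have "AE \<xi> in lborel. (\<Sum>m. ennreal (2 ^ m * (d m \<xi>)\<^sup>2)) \<noteq> \<infinity>"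
    by (intro nn_integral_PInf_AE) auto
  then have conv: "AE \<xi> in lborel. convergent (\<lambda>m. h (\<rho> m) \<xi>)"
  proof eventually_elim
    fix \<xi> assume fin: "(\<Sum>m. ennreal (2 ^ m * (d m \<xi>)\<^sup>2)) \<noteq> \<infinity>"
    define D where "D = enn2real (\<Sum>m. ennreal (2 ^ m * (d m \<xi>)\<^sup>2))"
    have D: "(\<Sum>m. ennreal (2 ^ m * (d m \<xi>)\<^sup>2)) = ennreal D" using fin by (simp add: D_def less_top)
    have D0: "D \<ge> 0" by (simp add: D_def)
    have bd: "d m \<xi> \<le> sqrt D * (sqrt (1 / 2)) ^ m" for m
    proof -
      have "ennreal (2 ^ m * (d m \<xi>)\<^sup>2) \<le> ennreal D"
        using sum_le_suminf[of "\<lambda>m. ennreal (2 ^ m * (d m \<xi>)\<^sup>2)" "{m}"] D by simp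
      then have "2 ^ m * (d m \<xi>)\<^sup>2 \<le> D" using D0 by simp
      then have "(d m \<xi>)\<^sup>2 \<le> D * (1 / 2) ^ m" by (simp add: power_one_over field_simps)
      then have "sqrt ((d m \<xi>)\<^sup>2) \<le> sqrt (D * (1 / 2) ^ m)" by (rule real_sqrt_le_mono)
      then show ?thesis by (simp add: real_sqrt_mult real_sqrt_power d_def)
    qed
    have "summable (\<lambda>m. sqrt D * (sqrt (1 / 2)) ^ m)"
      by (intro summable_mult summable_geometric) (simp add: real_sqrt_divide)
    then have "summable (\<lambda>m. h (\<rho> (Suc m)) \<xi> - h (\<rho> m) \<xi>)"
      by (rule summable_comparison_test[rotated]) (use bd in \<open>auto simp: d_def\<close>)
    then have "convergent (\<lambda>n. \<Sum>m<n. h (\<rho> (Suc m)) \<xi> - h (\<rho> m) \<xi>)" by (simp add: summable_iff_convergent)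
    then have "convergent (\<lambda>n. h (\<rho> n) \<xi> - h (\<rho> 0) \<xi>)" unfolding sum_lessThan_telescope[of "\<lambda>m. h (\<rho> m) \<xi>"] .
    then have "convergent (\<lambda>n. (h (\<rho> n) \<xi> - h (\<rho> 0) \<xi>) + h (\<rho> 0) \<xi>)" by (intro convergent_add convergent_const)
    then show "convergent (\<lambda>m. h (\<rho> m) \<xi>)" by simp
  qed
  define g where "g \<xi> = lim (\<lambda>m. h (\<rho> m) \<xi>)" for \<xi>
  have g[measurable]: "g \<in> borel_measurable borel" unfolding g_def by measurable
  have "L2sq (\<lambda>\<xi>. h R \<xi> - g \<xi>) \<le> L2tail F R" for R
  proof -
    have "L2sq (\<lambda>\<xi>. h R \<xi> - g \<xi>) = (\<integral>\<^sup>+\<xi>. liminf (\<lambda>m. ennreal ((cmod (h R \<xi> - h (\<rho> m) \<xi>))\<^sup>2)) \<partial>lborel)"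
    proof (rule nn_integral_cong_AE, use conv in eventually_elim)
      fix \<xi> assume "convergent (\<lambda>m. h (\<rho> m) \<xi>)"
      then have "(\<lambda>m. h (\<rho> m) \<xi>) \<longlonglongrightarrow> g \<xi>" by (simp add: g_def convergent_LIMSEQ_iff)
      then have "(\<lambda>m. ennreal ((cmod (h R \<xi> - h (\<rho> m) \<xi>))\<^sup>2)) \<longlonglongrightarrow> ennreal ((cmod (h R \<xi> - g \<xi>))\<^sup>2)"
        by (intro tendsto_ennrealI tendsto_intros)
      from lim_imp_Liminf[OF _ this]
      show "ennreal ((cmod (h R \<xi> - g \<xi>))\<^sup>2) = liminf (\<lambda>m. ennreal ((cmod (h R \<xi> - h (\<rho> m) \<xi>))\<^sup>2))"
        by simp
    qed
    also have "\<dots> \<le> liminf (\<lambda>m. \<integral>\<^sup>+\<xi>. ennreal ((cmod (h R \<xi> - h (\<rho> m) \<xi>))\<^sup>2) \<partial>lborel)"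
      by (rule nn_integral_liminf) measurable
    also have "\<dots> \<le> L2tail F R"
    proof (rule Liminf_le)
      obtain M :: nat where M: "real M \<ge> R" using real_arch_simple by blast
      show "\<forall>\<^sub>F m in sequentially. L2sq (\<lambda>\<xi>. h R \<xi> - h (\<rho> m) \<xi>) \<le> L2tail F R"
        using eventually_ge_at_top[of M]
      proof eventually_elim
        case (elim m)
        then have "R \<le> \<rho> m" using M R0(1)[of m] \<rho>R[of m] of_nat_mono[OF elim, where 'a=real] by linarith
        from fourier_L1_trunc_cauchy[OF F I this] show ?case by (simp add: h_def norm_minus_commute)
      qed
    qed simp
    finally show ?thesis .
  qed
  then show ?thesis using g unfolding h_def by blast
qed

lemma L2_borel_rep:
  fixes f :: "real^'n \<Rightarrow> complex"
  assumes "f \<in> L2"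
  obtains F where "F \<in> borel_measurable borel" "AE x in lborel. f x = F x" "L2sq F < \<infinity>"
proof -
  have f: "f \<in> borel_measurable lebesgue" "integrable lebesgue (\<lambda>x. (cmod (f x))\<^sup>2)" using assms by (auto simp: L2_def)
  obtain F where F: "F \<in> borel_measurable borel" "AE x in lborel. f x = F x" using lebesgue_ex_borel_complex[OF f(1)] by blast
  have "L2sq F = L2sq f"
    by (rule nn_integral_cong_AE) (use F(2) in \<open>eventually_elim, simp\<close>)
  also have "\<dots> = (\<integral>\<^sup>+x. ennreal ((cmod (f x))\<^sup>2) \<partial>lebesgue)" by (rule nn_integral_completion[symmetric])
  also have "\<dots> < \<infinity>" using f(2) unfolding integrable_iff_bounded by simp
  finally have I: "L2sq F < \<infinity>" .
  show ?thesis by (rule that[OF F I])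
qed

lemma L2I:
  assumes [measurable]: "F \<in> borel_measurable borel" and ae: "AE x in lborel. F x = f x" and I: "L2sq F < \<infinity>"
  shows "f \<in> L2"
proof -
  have fm: "f \<in> borel_measurable lebesgue"
    by (rule borel_measurable_completion_cong_AE[OF measurable_completion ae]) simp
  have "(\<integral>\<^sup>+x. ennreal ((cmod (f x))\<^sup>2) \<partial>lebesgue) = L2sq F"
    unfolding nn_integral_completion by (rule nn_integral_cong_AE) (use ae in \<open>eventually_elim, simp\<close>)
  with I fm show ?thesis by (auto simp: L2_def integrable_iff_bounded)
qed

text \<open>The choice in \<open>fourier\<close> is made from a nonempty set, as the limit just
  constructed belongs to it. All later facts about the chosen representative come from this
  property.\<close>

lemma fourier_works:
  fixes f :: "real^'n \<Rightarrow> complex"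
  assumes "f \<in> L2"
  shows "is_fourier_transform f (fourier f)"
proof -
  obtain F where F[measurable]: "F \<in> borel_measurable borel" and ae: "AE x in lborel. f x = F x" and I: "L2sq F < \<infinity>"
    using L2_borel_rep[OF assms] .
  have f: "f \<in> borel_measurable lebesgue" using assms by (simp add: L2_def)
  obtain g where g[measurable]: "g \<in> borel_measurable borel" and gR: "\<And>R. L2sq (\<lambda>\<xi>. fourier_L1 (trunc R F) \<xi> - g \<xi>) \<le> L2tail F R"
    using ex_L2_limit[OF F I] by blast
  have "L2sq g < \<infinity>"
  proof -
    have m1: "(\<lambda>\<xi>. g \<xi> - fourier_L1 (trunc 0 F) \<xi>) \<in> borel_measurable lborel" "fourier_L1 (trunc 0 F) \<in> borel_measurable lborel" by measurable
    have "L2sq g \<le> 2 * L2sq (\<lambda>\<xi>. g \<xi> - fourier_L1 (trunc 0 F) \<xi>) + 2 * L2sq (fourier_L1 (trunc 0 F))"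
      using nn_integral_cmod_add_square[OF m1] by simp
    also have "\<dots> \<le> 2 * L2sq F + 2 * L2sq F"
    proof (intro add_mono mult_left_mono)
      have "L2sq (\<lambda>\<xi>. g \<xi> - fourier_L1 (trunc 0 F) \<xi>) \<le> L2tail F 0"
        using gR[of 0] by (simp add: norm_minus_commute)
      also have "L2tail F 0 \<le> L2sq F"
        unfolding L2tail_def by (intro nn_integral_mono) (auto simp: trunc_def split: split_indicator)
      finally show "L2sq (\<lambda>\<xi>. g \<xi> - fourier_L1 (trunc 0 F) \<xi>) \<le> L2sq F" .
      show "L2sq (fourier_L1 (trunc 0 F)) \<le> L2sq F"
        by (rule order_trans[OF bessel_fourier_L1[OF integrable_trunc[OF F I, of 0]] nn_integral_trunc_le])
    qed auto
    also have "\<dots> < \<infinity>" using I by (simp add: ennreal_mult_less_top)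
    finally show ?thesis .
  qed
  then have "g \<in> L2" by (intro L2I[OF g]) auto
  moreover have "((\<lambda>R. \<integral>\<^sup>+\<xi>. ennreal ((cmod (fourier_integral (\<lambda>x. indicator (ball 0 R) x * f x) \<xi> - g \<xi>))\<^sup>2) \<partial>lebesgue) \<longlongrightarrow> 0) at_top"
    unfolding fourier_integral_eq_fourier_L1[OF f F ae] nn_integral_completion
    by (rule tendsto_sandwich[OF _ always_eventually[OF allI[OF gR]] tendsto_const L2tail_tendsto[OF F I]]) simp
  ultimately have "is_fourier_transform f g" by (simp add: is_fourier_transform_def)
  then show ?thesis unfolding fourier_def by (rule someI[of "is_fourier_transform f"])
qed

subsection \<open>Ball averages as limits\<close>

lemma ball_average_diff:
  fixes U V :: "real^'n \<Rightarrow> complex"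
  assumes [measurable]: "U \<in> borel_measurable borel" "V \<in> borel_measurable borel"
    and "set_integrable lborel (ball x r) U" "set_integrable lborel (ball x r) V"
  shows "ball_average (\<lambda>u. U u - V u) x r = ball_average U x r - ball_average V x r"
  using assms(3,4) by (simp add: ball_average_lborel diff_divide_distrib)

lemma set_integrable_square:
  fixes V :: "real^'n \<Rightarrow> complex"
  assumes [measurable]: "V \<in> borel_measurable borel" and I: "L2sq V < \<infinity>"
  shows "set_integrable lborel (ball x r) V"
  unfolding set_integrable_def
proof (rule integrable_square_bounded_support)
  have b[measurable]: "ball x r \<in> sets borel" by simp
  show "(\<lambda>u. indicat_real (ball x r) u *\<^sub>R V u) \<in> borel_measurable borel" by measurable
  have "L2sq (\<lambda>u. indicat_real (ball x r) u *\<^sub>R V u) \<le> L2sq V"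
    by (intro nn_integral_mono) (auto split: split_indicator)
  then show "L2sq (\<lambda>u. indicat_real (ball x r) u *\<^sub>R V u) < \<infinity>" using I by (rule le_less_trans)
  fix u :: "real^'n" assume "u \<notin> ball 0 (norm x + r)"
  then have "u \<notin> ball x r"
    using norm_triangle_ineq[of x "u - x"] by (auto simp: dist_norm norm_minus_commute)
  then show "indicat_real (ball x r) u *\<^sub>R V u = 0" by simp
qed

text \<open>For a fixed ball the squared difference of the averages is at most the squared mean
  distance divided by the volume. Mean square convergence thus controls the averages at every x,
  without exceptional points.\<close>

lemma ball_average_tendsto_L2:
  fixes U :: "real \<Rightarrow> real^'n \<Rightarrow> complex" and V :: "real^'n \<Rightarrow> complex"
  assumes [measurable]: "\<And>R. U R \<in> borel_measurable borel" "V \<in> borel_measurable borel"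
    and si: "\<And>R. set_integrable lborel (ball x r) (U R)" "set_integrable lborel (ball x r) V"
    and lim: "((\<lambda>R. \<integral>\<^sup>+u. ennreal ((cmod (U R u - V u))\<^sup>2) \<partial>lborel) \<longlongrightarrow> 0) at_top" and r: "r > 0"
  shows "((\<lambda>R. ball_average (U R) x r) \<longlongrightarrow> ball_average V x r) at_top"
proof (rule tendstoI)
  fix e :: real assume e: "e > 0"
  define v where "v = measure lebesgue (ball x r)"
  have v: "v > 0" using measure_ball_pos[OF r] by (simp add: v_def)
  have "\<forall>\<^sub>F R in at_top. L2sq (\<lambda>u. U R u - V u) < ennreal ((e / 2)\<^sup>2 * v)"
    using lim by (rule order_tendstoD) (use e v in simp)
  then show "\<forall>\<^sub>F R in at_top. dist (ball_average (U R) x r) (ball_average V x r) < e"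
  proof eventually_elim
    case (elim R)
    have "ennreal ((cmod (ball_average (\<lambda>u. U R u - V u) x r))\<^sup>2) \<le> ennreal ((e / 2)\<^sup>2)"
    proof (rule ball_average_square_le[OF _ r])
      have "(\<integral>\<^sup>+u. ennreal ((cmod (U R u - V u))\<^sup>2) * indicator (ball x r) u \<partial>lborel) \<le> L2sq (\<lambda>u. U R u - V u)"
        by (intro nn_integral_mono) (auto split: split_indicator)
      also have "\<dots> \<le> ennreal ((e / 2)\<^sup>2 * v)" using elim by simp
      also have "\<dots> = ennreal ((e / 2)\<^sup>2) * emeasure lborel (ball x r)"
        using v by (simp add: emeasure_ball_measure v_def ennreal_mult)
      finally show "(\<integral>\<^sup>+u. ennreal ((cmod (U R u - V u))\<^sup>2) * indicator (ball x r) u \<partial>lborel) \<le> ennreal ((e / 2)\<^sup>2) * emeasure lborel (ball x r)" .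
    qed measurable
    then have "(cmod (ball_average (\<lambda>u. U R u - V u) x r))\<^sup>2 \<le> (e / 2)\<^sup>2" by simp
    then have "cmod (ball_average (\<lambda>u. U R u - V u) x r) \<le> e / 2" by (rule power2_le_imp_le) (use e in simp)
    then show ?case using e si by (simp add: dist_norm ball_average_diff)
  qed
qed

lemma ball_average_cong_AE:
  fixes f F :: "real^'n \<Rightarrow> complex"
  assumes [measurable]: "F \<in> borel_measurable borel" and ae: "AE x in lborel. F x = f x"
  shows "ball_average f x r = ball_average F x r"
proof -
  have b[measurable]: "ball x r \<in> sets lebesgue" by simp
  have F[measurable]: "F \<in> borel_measurable lebesgue" by (rule measurable_completion) simp
  have f[measurable]: "f \<in> borel_measurable lebesgue"
    by (rule borel_measurable_completion_cong_AE[OF F ae])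
  have "(LINT y:ball x r|lebesgue. f y) = (LINT y:ball x r|lebesgue. F y)"
    unfolding set_lebesgue_integral_def
  proof (rule integral_cong_AE)
    show "AE y in lebesgue. indicat_real (ball x r) y *\<^sub>R f y = indicat_real (ball x r) y *\<^sub>R F y"
      using AE_completion[OF ae] by eventually_elim simp
  qed measurable
  then show ?thesis by (simp add: ball_average_def)
qed

lemma AE_lborel_uminus:
  fixes Q :: "'a::euclidean_space \<Rightarrow> bool"
  assumes "AE x in lborel. Q x"
  shows "AE x in lborel. Q (- x)"
proof -
  have *: "distr lborel borel (\<lambda>x. - x) = (lborel :: 'a measure)"
    using lborel_affine[of "-1" "0::'a"] by (simp add: density_1)
  obtain N where N: "{x \<in> space lborel. \<not> Q x} \<subseteq> N" "emeasure lborel N = 0" "N \<in> sets lborel" using assms by (rule AE_E)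
  have N'[measurable]: "N \<in> sets borel" using N by simp
  have "AE x in distr lborel borel (\<lambda>x. - x). x \<notin> N"
    unfolding * using N by (intro AE_not_in) (auto simp: null_sets_def)
  then have "AE x in lborel. - x \<notin> N" by (subst (asm) AE_distr_iff) auto
  then show ?thesis by eventually_elim (use N in auto)
qed

text \<open>The representative behind \<open>inverse_fourier g\<close> is arbitrary, but its ball
  averages are not: they are limits of averages of absolutely convergent integrals.\<close>

lemma ball_average_inverse_fourier:
  fixes g G :: "real^'n \<Rightarrow> complex"
  assumes G[measurable]: "G \<in> borel_measurable borel" and ae: "AE \<xi> in lborel. G \<xi> = g \<xi>"
    and I: "L2sq G < \<infinity>" and r: "r > 0"
  shows "((\<lambda>R. ball_average (\<lambda>y. fourier_L1 (trunc R G) (- y)) x r) \<longlongrightarrow> ball_average (inverse_fourier g) x r) at_top"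
proof -
  have g: "g \<in> L2" by (rule L2I[OF G ae I])
  have gm: "g \<in> borel_measurable lebesgue" using g by (simp add: L2_def)
  have ae': "AE \<xi> in lborel. g \<xi> = G \<xi>" using ae by eventually_elim simp
  have ft: "is_fourier_transform g (fourier g)" by (rule fourier_works[OF g])
  then have "fourier g \<in> L2" by (simp add: is_fourier_transform_def)
  then obtain H where H[measurable]: "H \<in> borel_measurable borel" and Hae: "AE x in lborel. fourier g x = H x"
    and HI: "L2sq H < \<infinity>" by (rule L2_borel_rep)
  define V where "V y = H (- y)" for y
  have V[measurable]: "V \<in> borel_measurable borel" unfolding V_def by measurable
  have VI: "L2sq V < \<infinity>"
    using HI nn_integral_lborel_minus[of "\<lambda>x. ennreal ((cmod (H x))\<^sup>2)"] by (simp add: V_def)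
  have "AE y in lborel. V y = inverse_fourier g y"
    using AE_lborel_uminus[OF Hae] by eventually_elim (simp add: V_def inverse_fourier_def)
  then have avg: "ball_average (inverse_fourier g) x r = ball_average V x r" by (rule ball_average_cong_AE[OF V])
  have lim0: "((\<lambda>R. \<integral>\<^sup>+\<xi>. ennreal ((cmod (fourier_L1 (trunc R G) \<xi> - fourier g \<xi>))\<^sup>2) \<partial>lborel) \<longlongrightarrow> 0) at_top"
    using ft unfolding is_fourier_transform_def fourier_integral_eq_fourier_L1[OF gm G ae'] nn_integral_completion by blast
  have eq: "L2sq (\<lambda>\<xi>. fourier_L1 (trunc R G) \<xi> - fourier g \<xi>)
     = L2sq (\<lambda>y. fourier_L1 (trunc R G) (- y) - V y)" for R
  proof -
    have "L2sq (\<lambda>\<xi>. fourier_L1 (trunc R G) \<xi> - fourier g \<xi>) = L2sq (\<lambda>\<xi>. fourier_L1 (trunc R G) \<xi> - H \<xi>)"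
      by (rule nn_integral_cong_AE) (use Hae in \<open>eventually_elim, simp\<close>)
    also have "\<dots> = L2sq (\<lambda>y. fourier_L1 (trunc R G) (- y) - V y)"
      unfolding V_def by (rule nn_integral_lborel_minus[symmetric]) measurable
    finally show ?thesis .
  qed
  have bd: "cmod (fourier_L1 (trunc R G) (- y)) \<le> (LINT x|lborel. cmod (trunc R G x))" for R y
    unfolding fourier_L1_def by (rule order_trans[OF integral_norm_bound]) (simp add: norm_mult)
  show ?thesis
    unfolding avg
  proof (rule ball_average_tendsto_L2[OF _ V _ _ _ r])
    show "(\<lambda>y. fourier_L1 (trunc R G) (- y)) \<in> borel_measurable borel" for R by measurable
    then show "set_integrable lborel (ball x r) (\<lambda>y. fourier_L1 (trunc R G) (- y))" for R
      by (rule set_integrable_ball_bounded[OF _ bd])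
    show "set_integrable lborel (ball x r) V" by (rule set_integrable_square[OF V VI])
    show "((\<lambda>R. \<integral>\<^sup>+y. ennreal ((cmod (fourier_L1 (trunc R G) (- y) - V y))\<^sup>2) \<partial>lborel) \<longlongrightarrow> 0) at_top"
      using lim0 unfolding eq .
  qed
qed

text \<open>The phase \<open>ee (t * P \<xi>)\<close> is unimodular, so it preserves the norm of the
  data, and it commutes with truncation. The limit holds at every x, hence also on sets that only a
  singular \<mu> can see.\<close>

lemma ball_average_T_op:
  fixes f F :: "real^'n \<Rightarrow> complex"
  assumes P[measurable]: "P \<in> borel_measurable borel" and F[measurable]: "F \<in> borel_measurable borel" and ae: "AE \<xi> in lborel. fourier f \<xi> = F \<xi>"
    and I: "L2sq F < \<infinity>" and r: "r > 0"
  shows "((\<lambda>R. ball_average (wave P (trunc R F) t) x r) \<longlongrightarrow> ball_average (T_op P t f) x r) at_top"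
proof -
  define G where "G \<xi> = F \<xi> * ee (t * P \<xi>)" for \<xi>
  have G: "G \<in> borel_measurable borel" unfolding G_def by measurable
  have GI: "L2sq G < \<infinity>" using I by (simp add: G_def norm_mult)
  have Gae: "AE \<xi> in lborel. G \<xi> = fourier f \<xi> * ee (t * P \<xi>)" using ae by eventually_elim (simp add: G_def)
  have "fourier_L1 (trunc R G) (- y) = wave P (trunc R F) t y" for R y
    unfolding fourier_L1_def wave_def by (simp add: trunc_def G_def ee_add inner_commute mult_ac)
  then show ?thesis
    using ball_average_inverse_fourier[OF G Gae GI r] unfolding T_op_def by simp
qed

section \<open>Parseval's identity against indicators of balls\<close>

lemma Cauchy_Schwarz_complex_integral:
  fixes u v :: "'a \<Rightarrow> complex"
  assumes [measurable]: "u \<in> borel_measurable M" "v \<in> borel_measurable M"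
  shows "ennreal ((cmod (LINT x|M. u x * v x))\<^sup>2) \<le> (\<integral>\<^sup>+x. ennreal ((cmod (u x))\<^sup>2) \<partial>M) * (\<integral>\<^sup>+x. ennreal ((cmod (v x))\<^sup>2) \<partial>M)"
proof -
  have "ennreal (cmod (LINT x|M. u x * v x)) \<le> (\<integral>\<^sup>+x. ennreal (cmod (u x)) * ennreal (cmod (v x)) \<partial>M)"
    by (rule order_trans[OF ennreal_norm_integral_le]) (simp add: norm_mult ennreal_mult)
  then have "(ennreal (cmod (LINT x|M. u x * v x)))\<^sup>2 \<le> (\<integral>\<^sup>+x. ennreal (cmod (u x)) * ennreal (cmod (v x)) \<partial>M)\<^sup>2"
    by (rule power_mono) simp
  also have "\<dots> \<le> (\<integral>\<^sup>+x. (ennreal (cmod (u x)))\<^sup>2 \<partial>M) * (\<integral>\<^sup>+x. (ennreal (cmod (v x)))\<^sup>2 \<partial>M)"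
    by (rule Cauchy_Schwarz_nn_integral) measurable
  finally show ?thesis by (simp add: ennreal_power)
qed

lemma integrable_mult_square:
  fixes u v :: "'a \<Rightarrow> complex"
  assumes [measurable]: "u \<in> borel_measurable M" "v \<in> borel_measurable M"
    and u: "(\<integral>\<^sup>+x. ennreal ((cmod (u x))\<^sup>2) \<partial>M) < \<infinity>" and v: "(\<integral>\<^sup>+x. ennreal ((cmod (v x))\<^sup>2) \<partial>M) < \<infinity>"
  shows "integrable M (\<lambda>x. u x * v x)"
proof (rule integrableI_bounded)
  have "(\<integral>\<^sup>+x. ennreal (norm (u x * v x)) \<partial>M) \<le> (\<integral>\<^sup>+x. ennreal ((cmod (u x))\<^sup>2) + ennreal ((cmod (v x))\<^sup>2) \<partial>M)"
  proof (rule nn_integral_mono)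
    fix x
    have "0 \<le> cmod (u x) * cmod (v x)" by simp
    then have "cmod (u x) * cmod (v x) \<le> (cmod (u x))\<^sup>2 + (cmod (v x))\<^sup>2"
      using sum_squares_bound[of "cmod (u x)" "cmod (v x)"] by linarith
    then show "ennreal (norm (u x * v x)) \<le> ennreal ((cmod (u x))\<^sup>2) + ennreal ((cmod (v x))\<^sup>2)"
      by (simp add: norm_mult ennreal_plus[symmetric] ennreal_leI del: ennreal_plus)
  qed
  also have "\<dots> < \<infinity>" using u v by (subst nn_integral_add) auto
  finally show "(\<integral>\<^sup>+x. ennreal (norm (u x * v x)) \<partial>M) < \<infinity>" .
qed measurable

lemma gauss_scale: "\<rho> > 0 \<Longrightarrow> gauss \<rho> ((1 / \<rho>) *\<^sub>R w) = \<rho> ^ DIM('a) * gauss 1 (w :: 'a::euclidean_space)"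
  by (simp add: gauss_def power_divide power_mult_distrib)

lemma integral_gauss_concentrated:
  fixes \<phi> :: "'a::euclidean_space \<Rightarrow> complex"
  assumes [measurable]: "\<phi> \<in> borel_measurable borel" and \<rho>: "\<rho> > 0"
  shows "(LINT v|lborel. \<phi> v * complex_of_real (gauss \<rho> (v - y))) = (LINT w|lborel. \<phi> (y + (1 / \<rho>) *\<^sub>R w) * complex_of_real (gauss 1 w))"
proof -
  define c where "c = 1 / \<rho>"
  have c: "c > 0" using \<rho> by (simp add: c_def)
  have "(LINT v|lborel. \<phi> v * complex_of_real (gauss \<rho> (v - y)))
    = (LINT v|density (distr lborel borel (\<lambda>w. y + c *\<^sub>R w)) (\<lambda>_. ennreal (\<bar>c\<bar> ^ DIM('a))). \<phi> v * complex_of_real (gauss \<rho> (v - y)))"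
    using lborel_affine[of c y] c by simp
  also have "\<dots> = (LINT w|lborel. (\<bar>c\<bar> ^ DIM('a)) *\<^sub>R (\<phi> (y + c *\<^sub>R w) * complex_of_real (gauss \<rho> (c *\<^sub>R w))))"
    by (subst integral_density) (auto simp: integral_distr)
  also have "\<dots> = (LINT w|lborel. \<phi> (y + c *\<^sub>R w) * complex_of_real (gauss 1 w))"
    using \<rho> by (intro Bochner_Integration.integral_cong refl)
      (simp add: c_def gauss_scale scaleR_conv_of_real power_one_over)
  finally show ?thesis by (simp add: c_def)
qed

text \<open>Off the boundary sphere the indicator is locally constant. After rescaling the Gaussian
  to unit width the integrand is, for each w, eventually equal to its limit, and
  \<open>gauss 1\<close> dominates it.\<close>

lemma gauss_approximate_identity_ball:
  fixes x y :: "'a::euclidean_space"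
  assumes y: "dist x y \<noteq> r"
  shows "(\<lambda>n. LINT v|lborel. indicator (ball x r) v * complex_of_real (gauss (real (Suc n)) (v - y))) \<longlonglongrightarrow> indicator (ball x r) y"
proof -
  have b[measurable]: "ball x r \<in> sets borel" by simp
  have ev: "\<forall>\<^sub>F n in sequentially. (indicator (ball x r) (y + (1 / real (Suc n)) *\<^sub>R w) :: complex) = indicator (ball x r) y" for w
  proof -
    have l: "(\<lambda>n. y + (1 / real (Suc n)) *\<^sub>R w) \<longlonglongrightarrow> y + 0 *\<^sub>R w"
      using LIMSEQ_inverse_real_of_nat by (intro tendsto_intros) (simp add: inverse_eq_divide)
    show ?thesis
    proof (cases "dist x y < r")
      case True
      then have "\<forall>\<^sub>F n in sequentially. y + (1 / real (Suc n)) *\<^sub>R w \<in> ball x r"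
        using l by (intro topological_tendstoD[OF l]) auto
      then show ?thesis by eventually_elim (use True in auto)
    next
      case False
      then have "\<forall>\<^sub>F n in sequentially. y + (1 / real (Suc n)) *\<^sub>R w \<in> - cball x r"
        using y by (intro topological_tendstoD[OF l]) auto
      then show ?thesis by eventually_elim (use False in auto)
    qed
  qed
  have "(\<lambda>n. LINT w|lborel. indicator (ball x r) (y + (1 / real (Suc n)) *\<^sub>R w) * complex_of_real (gauss 1 w))
     \<longlonglongrightarrow> (LINT w|lborel. indicator (ball x r) y * complex_of_real (gauss 1 (w::'a)))"
  proof (rule integral_dominated_convergence[where w="\<lambda>w. gauss 1 w"])
    show "integrable lborel (\<lambda>w::'a. gauss 1 w)" by (rule integrable_gauss) simp
    show "AE w in lborel. (\<lambda>n. indicator (ball x r) (y + (1 / real (Suc n)) *\<^sub>R w) * complex_of_real (gauss 1 w)) \<longlonglongrightarrow> indicator (ball x r) y * complex_of_real (gauss 1 w)"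
    proof (rule AE_I2)
      fix w show "(\<lambda>n. indicator (ball x r) (y + (1 / real (Suc n)) *\<^sub>R w) * complex_of_real (gauss 1 w)) \<longlonglongrightarrow> indicator (ball x r) y * complex_of_real (gauss 1 w)"
        by (rule tendsto_eventually) (use ev[of w] in \<open>eventually_elim, simp\<close>)
    qed
    show "AE w in lborel. norm (indicator (ball x r) (y + (1 / real (Suc n)) *\<^sub>R w) * complex_of_real (gauss 1 w)) \<le> gauss 1 w" for n
      by (auto simp: norm_mult split: split_indicator)
  qed measurable
  moreover have "(LINT w|lborel. indicator (ball x r) y * complex_of_real (gauss 1 (w::'a))) = indicator (ball x r) y"
  proof -
    have "(LINT w|lborel. gauss 1 (w::'a)) = 1"
      using integral_eq_nn_integral[of "\<lambda>w::'a. gauss 1 w" lborel] nn_integral_gauss[of 1, where 'a='a] by simp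
    then show ?thesis by simp
  qed
  moreover have "(LINT v|lborel. indicator (ball x r) v * complex_of_real (gauss (real (Suc n)) (v - y)))
    = (LINT w|lborel. indicator (ball x r) (y + (1 / real (Suc n)) *\<^sub>R w) * complex_of_real (gauss 1 w))" for n
    by (rule integral_gauss_concentrated[OF borel_measurable_indicator[OF b]]) simp
  ultimately show ?thesis by (simp only:)
qed

lemma integrable_indicator_ball: "integrable lborel (indicator (ball x r) :: 'a::euclidean_space \<Rightarrow> complex)"
proof -
  have "integrable lborel (\<lambda>u. complex_of_real (indicator (ball x r) u))"
    using integrable_real_indicator[of "ball x r" lborel] emeasure_lborel_ball_finite[of x r] by simp
  moreover have "(\<lambda>u. complex_of_real (indicator (ball x r) u)) = indicator (ball x r)" by (auto split: split_indicator)
  ultimately show ?thesis by simp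
qed

text \<open>Transform of the indicator of a ball, with the kernel of the inverse transform. Up to
  the volume, the ball average of a wave at time 0 is the pairing of its data with this
  function.\<close>

definition ball_ft :: "real^'n \<Rightarrow> real \<Rightarrow> real^'n \<Rightarrow> complex" where
  "ball_ft x r \<xi> = (LINT v|lborel. indicator (ball x r) v * ee (v \<bullet> \<xi>))"

lemma measurable_ball_ft [measurable]: "ball_ft x r \<in> borel_measurable borel"
proof -
  have b[measurable]: "ball x r \<in> sets borel" by simp
  show ?thesis unfolding ball_ft_def[abs_def] by measurable
qed

lemma ball_ft_square:
  "L2sq (ball_ft x r) < \<infinity>"
proof -
  have b[measurable]: "ball x r \<in> sets borel" by simp
  have "ball_ft x r \<xi> = fourier_L1 (indicator (ball x r)) (- \<xi>)" for \<xi>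
    by (simp add: ball_ft_def fourier_L1_def)
  then have "L2sq (ball_ft x r) = L2sq (\<lambda>\<xi>. fourier_L1 (indicator (ball x r)) (- \<xi>))" by simp
  also have "\<dots> = L2sq (fourier_L1 (indicator (ball x r)))"
    by (rule nn_integral_lborel_minus) measurable
  also have "\<dots> \<le> L2sq (indicator (ball x r))"
    by (rule bessel_fourier_L1[OF integrable_indicator_ball])
  also have "\<dots> = (\<integral>\<^sup>+v. indicator (ball x r) v \<partial>lborel)"
    by (intro nn_integral_cong) (auto split: split_indicator)
  also have "\<dots> < \<infinity>" using emeasure_lborel_ball_finite[of x r] by simp
  finally show ?thesis .
qed

lemma cmod_ball_ft_le: "cmod (ball_ft x r \<xi>) \<le> (LINT v|lborel. cmod (indicator (ball x r) v))"
  unfolding ball_ft_def by (rule order_trans[OF integral_norm_bound]) (simp add: norm_mult)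

text \<open>The integrand on the left is integrable through Cauchy-Schwarz, but the underlying
  double integral in y and \<xi> need not converge absolutely; a Gaussian weight is therefore
  inserted before the order is exchanged. It turns into the smoothed indicator \<open>c n\<close> on
  the other side, and dominated convergence removes it from both sides.\<close>

lemma parseval_ball:
  fixes \<phi> :: "real^'n \<Rightarrow> complex"
  assumes \<phi>: "integrable lborel \<phi>" and I: "L2sq \<phi> < \<infinity>"
  shows "(LINT \<xi>|lborel. fourier_L1 \<phi> \<xi> * ball_ft x r \<xi>) = (LINT y|lborel. \<phi> y * indicator (ball x r) y)"
proof -
  have [measurable]: "\<phi> \<in> borel_measurable borel" using \<phi> by auto
  have b[measurable]: "ball x r \<in> sets borel" by simp
  define w where "w n \<xi> = exp (- pi * (1 / real (Suc n))\<^sup>2 * (norm \<xi>)\<^sup>2)" for n and \<xi> :: "real^'n"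
  have [measurable]: "w n \<in> borel_measurable borel" for n unfolding w_def by measurable
  have w1: "\<bar>w n \<xi>\<bar> \<le> 1" for n \<xi> by (simp add: w_def)
  have wi: "integrable lborel (w n)" for n unfolding w_def by (rule integrable_exp_neg_norm_sq) simp
  have wic: "integrable lborel (\<lambda>\<xi>. complex_of_real (w n \<xi>))" for n using wi by simp
  define c where "c n y = (LINT v|lborel. indicator (ball x r) v * complex_of_real (gauss (real (Suc n)) (v - y)))" for n and y :: "real^'n"
  have [measurable]: "c n \<in> borel_measurable borel" for n unfolding c_def by measurable
  have inner: "(LINT \<xi>|lborel. ee (- (y \<bullet> \<xi>)) * (complex_of_real (w n \<xi>) * ball_ft x r \<xi>)) = c n y" for n y
  proof -
    have "(LINT \<xi>|lborel. ee (- (y \<bullet> \<xi>)) * (complex_of_real (w n \<xi>) * ball_ft x r \<xi>))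
       = (LINT \<xi>|lborel. (LINT v|lborel. indicator (ball x r) v * ee (v \<bullet> \<xi>)) * (complex_of_real (w n \<xi>) * ee (- (y \<bullet> \<xi>))))"
      unfolding ball_ft_def by (simp add: mult_ac)
    also have "\<dots> = (LINT v|lborel. indicator (ball x r) v * (LINT \<xi>|lborel. ee (v \<bullet> \<xi>) * (complex_of_real (w n \<xi>) * ee (- (y \<bullet> \<xi>)))))"
      by (rule lborel_pair.Fubini_kernel[where B=1, OF integrable_indicator_ball])
         (auto intro!: integrable_mult_bounded[OF wic, where B=1])
    also have "\<dots> = (LINT v|lborel. indicator (ball x r) v * (LINT \<xi>|lborel. complex_of_real (w n \<xi>) * ee (\<xi> \<bullet> (v - y))))"
    proof -
      have "ee (v \<bullet> \<xi>) * (complex_of_real (w n \<xi>) * ee (- (y \<bullet> \<xi>))) = complex_of_real (w n \<xi>) * ee (\<xi> \<bullet> (v - y))" for v \<xi>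
        using ee_add[of "v \<bullet> \<xi>" "- (y \<bullet> \<xi>)"] by (simp add: inner_diff_right inner_commute mult_ac)
      then show ?thesis by (simp only:)
    qed
    also have "\<dots> = c n y"
    proof -
      have "(LINT \<xi>|lborel. complex_of_real (w n \<xi>) * ee (\<xi> \<bullet> (v - y))) = complex_of_real (gauss (1 / (1 / real (Suc n))) (v - y))" for v
        unfolding w_def by (rule gauss_inverse) simp
      then show ?thesis by (simp add: c_def)
    qed
    finally show ?thesis .
  qed
  have eq: "(LINT \<xi>|lborel. fourier_L1 \<phi> \<xi> * (complex_of_real (w n \<xi>) * ball_ft x r \<xi>)) = (LINT y|lborel. \<phi> y * c n y)" for n
  proof -
    have "(LINT \<xi>|lborel. fourier_L1 \<phi> \<xi> * (complex_of_real (w n \<xi>) * ball_ft x r \<xi>))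
      = (LINT y|lborel. \<phi> y * (LINT \<xi>|lborel. ee (- (y \<bullet> \<xi>)) * (complex_of_real (w n \<xi>) * ball_ft x r \<xi>)))"
      unfolding fourier_L1_def
      by (rule lborel_pair.Fubini_kernel[where B=1, OF \<phi> integrable_mult_bounded[OF wic _ cmod_ball_ft_le]]) auto
    then show ?thesis by (simp only: inner)
  qed
  \<comment> \<open>Bessel's inequality makes both factors square integrable; the norm of their
    product is the dominating function on the frequency side.\<close>
  have FIb: "integrable lborel (\<lambda>\<xi>. fourier_L1 \<phi> \<xi> * ball_ft x r \<xi>)"
    using le_less_trans[OF bessel_fourier_L1[OF \<phi>] I] ball_ft_square by (intro integrable_mult_square) auto
  have lim1: "(\<lambda>n. LINT \<xi>|lborel. fourier_L1 \<phi> \<xi> * (complex_of_real (w n \<xi>) * ball_ft x r \<xi>)) \<longlonglongrightarrow> (LINT \<xi>|lborel. fourier_L1 \<phi> \<xi> * ball_ft x r \<xi>)"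
  proof (rule integral_dominated_convergence[where w="\<lambda>\<xi>. norm (fourier_L1 \<phi> \<xi> * ball_ft x r \<xi>)"])
    show "integrable lborel (\<lambda>\<xi>. norm (fourier_L1 \<phi> \<xi> * ball_ft x r \<xi>))" using FIb by (rule integrable_norm)
    show "AE \<xi> in lborel. (\<lambda>n. fourier_L1 \<phi> \<xi> * (complex_of_real (w n \<xi>) * ball_ft x r \<xi>)) \<longlonglongrightarrow> fourier_L1 \<phi> \<xi> * ball_ft x r \<xi>"
    proof (rule AE_I2)
      fix \<xi> :: "real^'n"
      have "(\<lambda>n. exp (- pi * (1 / real (Suc n))\<^sup>2 * (norm \<xi>)\<^sup>2)) \<longlonglongrightarrow> exp (- pi * 0\<^sup>2 * (norm \<xi>)\<^sup>2)"
        using LIMSEQ_inverse_real_of_nat by (intro tendsto_intros) (simp add: inverse_eq_divide)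
      then have "(\<lambda>n. w n \<xi>) \<longlonglongrightarrow> 1" by (simp add: w_def)
      then have "(\<lambda>n. fourier_L1 \<phi> \<xi> * (complex_of_real (w n \<xi>) * ball_ft x r \<xi>)) \<longlonglongrightarrow> fourier_L1 \<phi> \<xi> * (complex_of_real 1 * ball_ft x r \<xi>)"
        by (intro tendsto_intros)
      then show "(\<lambda>n. fourier_L1 \<phi> \<xi> * (complex_of_real (w n \<xi>) * ball_ft x r \<xi>)) \<longlonglongrightarrow> fourier_L1 \<phi> \<xi> * ball_ft x r \<xi>" by simp
    qed
    show "AE \<xi> in lborel. norm (fourier_L1 \<phi> \<xi> * (complex_of_real (w n \<xi>) * ball_ft x r \<xi>)) \<le> norm (fourier_L1 \<phi> \<xi> * ball_ft x r \<xi>)" for n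
      using w1[of n] by (auto simp: norm_mult intro!: mult_left_mono mult_left_le_one_le)
  qed measurable
  have c1: "cmod (c n y) \<le> 1" for n y
  proof -
    have "ennreal (cmod (c n y)) \<le> (\<integral>\<^sup>+v. ennreal (gauss (real (Suc n)) (y - v)) \<partial>lborel)"
      unfolding c_def by (rule order_trans[OF ennreal_norm_integral_le])
        (auto intro!: nn_integral_mono split: split_indicator simp: norm_mult gauss_minus_commute)
    also have "\<dots> = 1" by (rule nn_integral_gauss_diff) simp
    finally show ?thesis by (simp flip: ennreal_1)
  qed
  have lim2: "(\<lambda>n. LINT y|lborel. \<phi> y * c n y) \<longlonglongrightarrow> (LINT y|lborel. \<phi> y * indicator (ball x r) y)"
  proof (rule integral_dominated_convergence[where w="\<lambda>y. norm (\<phi> y)"])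
    show "integrable lborel (\<lambda>y. norm (\<phi> y))" using \<phi> by (rule integrable_norm)
    \<comment> \<open>The smoothed indicators converge off the boundary sphere, and that sphere is a
      null set.\<close>
    have "negligible (sphere x r)" by (rule negligible_sphere)
    then have "AE y in lebesgue. y \<notin> sphere x r" unfolding negligible_iff_null_sets by (rule AE_not_in)
    then have "AE y in lborel. dist x y \<noteq> r" unfolding AE_completion_iff by eventually_elim simp
    then show "AE y in lborel. (\<lambda>n. \<phi> y * c n y) \<longlonglongrightarrow> \<phi> y * indicator (ball x r) y"
    proof eventually_elim
      fix y assume "dist x y \<noteq> r"
      from gauss_approximate_identity_ball[OF this] show "(\<lambda>n. \<phi> y * c n y) \<longlonglongrightarrow> \<phi> y * indicator (ball x r) y"
        unfolding c_def by (intro tendsto_intros)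
    qed
    show "AE y in lborel. norm (\<phi> y * c n y) \<le> norm (\<phi> y)" for n
      using c1[of n] by (auto simp: norm_mult intro!: mult_left_le)
  qed measurable
  show ?thesis using lim1 lim2 unfolding eq by (rule LIMSEQ_unique)
qed

text \<open>Fourier inversion tested against the indicator of a ball. As soon as the ball of radius
  R about the origin contains \<open>ball x r\<close>, truncation leaves the integral of f over
  \<open>ball x r\<close> unchanged, so Parseval's identity for the truncation already produces it;
  letting R grow identifies it with the pairing of \<open>F\<close> and
  \<open>ball_ft x r\<close>.\<close>

lemma ball_average_fourier_inversion:
  fixes f F :: "real^'n \<Rightarrow> complex"
  assumes P[measurable]: "P \<in> borel_measurable borel" and f: "f \<in> L2"
    and F[measurable]: "F \<in> borel_measurable borel" and ae: "AE \<xi> in lborel. fourier f \<xi> = F \<xi>"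
    and I: "L2sq F < \<infinity>" and r: "r > 0"
  shows "((\<lambda>R. ball_average (wave P (trunc R F) 0) x r) \<longlongrightarrow> ball_average f x r) at_top"
proof -
  have b[measurable]: "ball x r \<in> sets borel" by simp
  obtain f0 where f0[measurable]: "f0 \<in> borel_measurable borel" and f0ae: "AE x in lborel. f x = f0 x"
    and f0I: "L2sq f0 < \<infinity>" using f by (rule L2_borel_rep)
  have fm: "f \<in> borel_measurable lebesgue" using f by (simp add: L2_def)
  have "AE x in lborel. f0 x = f x" using f0ae by eventually_elim simp
  then have avg: "ball_average f x r = ball_average f0 x r" by (rule ball_average_cong_AE[OF f0])
  have avg0: "ball_average U x r = (LINT y|lborel. U y * indicator (ball x r) y) / measure lebesgue (ball x r)"
    if [measurable]: "U \<in> borel_measurable borel" for U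
  proof -
    have "(LINT y:ball x r|lborel. U y) = (LINT y|lborel. U y * indicator (ball x r) y)"
      unfolding set_lebesgue_integral_def by (intro Bochner_Integration.integral_cong refl) (auto split: split_indicator)
    then show ?thesis by (simp add: ball_average_lborel)
  qed
  have W: "(LINT y|lborel. wave P (trunc R F) 0 y * indicator (ball x r) y) = (LINT \<xi>|lborel. trunc R F \<xi> * ball_ft x r \<xi>)" for R
  proof -
    have "(LINT y|lborel. (LINT \<xi>|lborel. trunc R F \<xi> * ee (y \<bullet> \<xi>)) * indicator (ball x r) y)
      = (LINT \<xi>|lborel. trunc R F \<xi> * (LINT y|lborel. ee (y \<bullet> \<xi>) * indicator (ball x r) y))"
      by (rule lborel_pair.Fubini_kernel[where B=1, OF integrable_trunc[OF F I] integrable_indicator_ball]) auto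
    then show ?thesis by (simp add: wave_def ball_ft_def mult.commute)
  qed
  have Fb: "integrable lborel (\<lambda>\<xi>. F \<xi> * ball_ft x r \<xi>)"
    using I ball_ft_square by (intro integrable_mult_square) auto
  have lim: "((\<lambda>R. LINT \<xi>|lborel. trunc R F \<xi> * ball_ft x r \<xi>) \<longlongrightarrow> (LINT \<xi>|lborel. F \<xi> * ball_ft x r \<xi>)) at_top"
  proof (rule integral_dominated_convergence_at_top[where w="\<lambda>\<xi>. norm (F \<xi> * ball_ft x r \<xi>)"])
    show "integrable lborel (\<lambda>\<xi>. norm (F \<xi> * ball_ft x r \<xi>))" using Fb by (rule integrable_norm)
    show "AE \<xi> in lborel. ((\<lambda>R. trunc R F \<xi> * ball_ft x r \<xi>) \<longlongrightarrow> F \<xi> * ball_ft x r \<xi>) at_top"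
    proof (rule AE_I2)
      fix \<xi> show "((\<lambda>R. trunc R F \<xi> * ball_ft x r \<xi>) \<longlongrightarrow> F \<xi> * ball_ft x r \<xi>) at_top"
        by (rule tendsto_eventually) (use eventually_gt_at_top[of "norm \<xi>"] in \<open>eventually_elim, simp add: trunc_def\<close>)
    qed
    show "\<forall>\<^sub>F R in at_top. AE \<xi> in lborel. norm (trunc R F \<xi> * ball_ft x r \<xi>) \<le> norm (F \<xi> * ball_ft x r \<xi>)"
      by (intro always_eventually allI AE_I2) (auto simp: norm_mult intro!: mult_right_mono cmod_trunc_le)
  qed measurable
  define J where "J R = L2sq (\<lambda>\<xi>. fourier_L1 (trunc R f0) \<xi> - F \<xi>)" for R
  have "((\<lambda>R. \<integral>\<^sup>+\<xi>. ennreal ((cmod (fourier_L1 (trunc R f0) \<xi> - fourier f \<xi>))\<^sup>2) \<partial>lborel) \<longlongrightarrow> 0) at_top"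
    using fourier_works[OF f] unfolding is_fourier_transform_def fourier_integral_eq_fourier_L1[OF fm f0 f0ae] nn_integral_completion by blast
  moreover have "L2sq (\<lambda>\<xi>. fourier_L1 (trunc R f0) \<xi> - fourier f \<xi>) = J R" for R
    unfolding J_def by (rule nn_integral_cong_AE) (use ae in \<open>eventually_elim, simp\<close>)
  ultimately have J: "(J \<longlongrightarrow> 0) at_top" by simp
  obtain \<beta> where \<beta>: "\<beta> \<ge> 0" "L2sq (ball_ft x r) = ennreal \<beta>"
    using ball_ft_square[of x r] by (auto simp: less_top_ennreal)
  have FIb: "integrable lborel (\<lambda>\<xi>. fourier_L1 (trunc R f0) \<xi> * ball_ft x r \<xi>)" for R
    using le_less_trans[OF bessel_fourier_L1[OF integrable_trunc[OF f0 f0I]] le_less_trans[OF nn_integral_trunc_le f0I]] ball_ft_square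
    by (intro integrable_mult_square) auto
  have lim2: "((\<lambda>R. LINT \<xi>|lborel. fourier_L1 (trunc R f0) \<xi> * ball_ft x r \<xi>) \<longlongrightarrow> (LINT \<xi>|lborel. F \<xi> * ball_ft x r \<xi>)) at_top"
  proof (rule tendstoI)
    fix e :: real assume e: "e > 0"
    \<comment> \<open>The added 1 avoids division by zero and makes the final inequality
      strict.\<close>
    have "\<forall>\<^sub>F R in at_top. J R < ennreal (e\<^sup>2 / (\<beta> + 1))"
      using J by (rule order_tendstoD) (use e \<beta> in simp)
    then show "\<forall>\<^sub>F R in at_top. dist (LINT \<xi>|lborel. fourier_L1 (trunc R f0) \<xi> * ball_ft x r \<xi>) (LINT \<xi>|lborel. F \<xi> * ball_ft x r \<xi>) < e"
    proof eventually_elim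
      case (elim R)
      have "(LINT \<xi>|lborel. fourier_L1 (trunc R f0) \<xi> * ball_ft x r \<xi>) - (LINT \<xi>|lborel. F \<xi> * ball_ft x r \<xi>)
        = (LINT \<xi>|lborel. (fourier_L1 (trunc R f0) \<xi> - F \<xi>) * ball_ft x r \<xi>)"
        unfolding left_diff_distrib using FIb Fb by (rule Bochner_Integration.integral_diff[symmetric])
      then have "ennreal ((cmod ((LINT \<xi>|lborel. fourier_L1 (trunc R f0) \<xi> * ball_ft x r \<xi>) - (LINT \<xi>|lborel. F \<xi> * ball_ft x r \<xi>)))\<^sup>2)
         \<le> J R * ennreal \<beta>"
        using Cauchy_Schwarz_complex_integral[of "\<lambda>\<xi>. fourier_L1 (trunc R f0) \<xi> - F \<xi>" lborel "ball_ft x r"] by (simp add: J_def \<beta>)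
      also have "\<dots> \<le> ennreal (e\<^sup>2 / (\<beta> + 1)) * ennreal \<beta>" using elim by (intro mult_right_mono) auto
      also have "\<dots> = ennreal (e\<^sup>2 / (\<beta> + 1) * \<beta>)" using \<beta> by (intro ennreal_mult[symmetric]) auto
      finally have "(cmod ((LINT \<xi>|lborel. fourier_L1 (trunc R f0) \<xi> * ball_ft x r \<xi>) - (LINT \<xi>|lborel. F \<xi> * ball_ft x r \<xi>)))\<^sup>2 \<le> e\<^sup>2 / (\<beta> + 1) * \<beta>"
        using \<beta> by (subst (asm) ennreal_le_iff) auto
      also have "\<dots> < e\<^sup>2" using \<beta> e by (simp add: divide_less_eq)
      finally show ?case using e by (auto simp: dist_norm intro: power_less_imp_less_base[of _ 2])
    qed
  qed
  have "\<forall>\<^sub>F R in at_top. (LINT \<xi>|lborel. fourier_L1 (trunc R f0) \<xi> * ball_ft x r \<xi>) = (LINT y|lborel. f0 y * indicator (ball x r) y)"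
    using eventually_ge_at_top[of "norm x + r"]
  proof eventually_elim
    case (elim R)
    have sub: "y \<in> ball 0 R" if "y \<in> ball x r" for y
      using that elim norm_triangle_ineq[of x "y - x"] by (auto simp: dist_norm norm_minus_commute)
    have "(LINT \<xi>|lborel. fourier_L1 (trunc R f0) \<xi> * ball_ft x r \<xi>) = (LINT y|lborel. trunc R f0 y * indicator (ball x r) y)"
      by (rule parseval_ball[OF integrable_trunc[OF f0 f0I] le_less_trans[OF nn_integral_trunc_le f0I]])
    also have "\<dots> = (LINT y|lborel. f0 y * indicator (ball x r) y)"
      using sub by (intro Bochner_Integration.integral_cong refl) (auto simp: trunc_def split: split_indicator)
    finally show ?case .
  qed
  from tendsto_unique[OF _ lim2 tendsto_eventually[OF this]]
  have eq: "(LINT \<xi>|lborel. F \<xi> * ball_ft x r \<xi>) = (LINT y|lborel. f0 y * indicator (ball x r) y)" by simp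
  have "ball_average (wave P (trunc R F) 0) x r = (LINT \<xi>|lborel. trunc R F \<xi> * ball_ft x r \<xi>) / measure lebesgue (ball x r)" for R
    by (subst avg0) (measurable, simp add: W)
  then show ?thesis
    unfolding avg avg0[OF f0] eq[symmetric] using measure_ball_pos[OF r, of x] by (auto intro!: tendsto_divide lim)
qed

subsection \<open>Summation over the dyadic shells\<close>

lemma wave_tendsto:
  fixes F :: "real^'n \<Rightarrow> complex"
  assumes P[measurable]: "P \<in> borel_measurable borel" and F: "integrable lborel F"
    and "t \<longlonglongrightarrow> t0" "x \<longlonglongrightarrow> x0"
  shows "(\<lambda>n. wave P F (t n) (x n)) \<longlonglongrightarrow> wave P F t0 x0"
  unfolding wave_def
proof (rule integral_dominated_convergence[where w="\<lambda>\<xi>. norm (F \<xi>)"])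
  have [measurable]: "F \<in> borel_measurable borel" using F by auto
  show "(\<lambda>\<xi>. F \<xi> * ee (x0 \<bullet> \<xi> + t0 * P \<xi>)) \<in> borel_measurable lborel"
    "(\<lambda>\<xi>. F \<xi> * ee (x n \<bullet> \<xi> + t n * P \<xi>)) \<in> borel_measurable lborel" for n by measurable
  show "integrable lborel (\<lambda>\<xi>. norm (F \<xi>))" using F by (rule integrable_norm)
  show "AE \<xi> in lborel. (\<lambda>n. F \<xi> * ee (x n \<bullet> \<xi> + t n * P \<xi>)) \<longlonglongrightarrow> F \<xi> * ee (x0 \<bullet> \<xi> + t0 * P \<xi>)"
    by (intro AE_I2 tendsto_mult tendsto_const isCont_tendsto_compose[OF isCont_ee] tendsto_intros assms)
qed (simp add: norm_mult)

lemma isCont_wave: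
  fixes F :: "real^'n \<Rightarrow> complex"
  assumes "P \<in> borel_measurable borel" "integrable lborel F"
  shows "isCont (wave P F t) x"
  by (auto simp: continuous_at_sequentially o_def intro!: wave_tendsto[OF assms])

lemma continuous_on_wave_time:
  fixes F :: "real^'n \<Rightarrow> complex"
  assumes "P \<in> borel_measurable borel" "integrable lborel F"
  shows "continuous_on A (\<lambda>t. wave P F t x)"
  by (rule continuous_at_imp_continuous_on)
     (auto simp: continuous_at_sequentially o_def intro!: wave_tendsto[OF assms])

lemma ball_average_const: "r > 0 \<Longrightarrow> ball_average (\<lambda>_. c) x r = c"
proof -
  assume r: "r > 0"
  have "(LINT y:ball x r|lborel. c) = measure lborel (ball x r) *\<^sub>R c"
  proof -
    have "integrable lborel (indicat_real (ball x r))"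
      using integrable_real_indicator[of "ball x r" lborel] emeasure_lborel_ball_finite[of x r] by simp
    then show ?thesis unfolding set_lebesgue_integral_def by (simp add: integral_scaleR_left)
  qed
  moreover have "measure lebesgue (ball x r) = measure lborel (ball x r)" by (rule measure_completion) simp
  ultimately show ?thesis
    using measure_ball_pos[OF r, of x] by (simp add: ball_average_lborel scaleR_conv_of_real)
qed

lemma ball_average_tendsto_isCont:
  fixes U :: "real^'n \<Rightarrow> complex"
  assumes [measurable]: "U \<in> borel_measurable borel" and cont: "isCont U x" and si: "\<And>r. set_integrable lborel (ball x r) U"
  shows "(ball_average U x \<longlongrightarrow> U x) (at_right 0)"
proof (rule tendstoI)
  fix e :: real assume e: "e > 0"
  then obtain d where d: "d > 0" "\<And>u. dist u x < d \<Longrightarrow> dist (U u) (U x) < e / 2"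
    using cont unfolding continuous_at_eps_delta by (meson half_gt_zero)
  have "\<forall>\<^sub>F r in at_right (0::real). r < d" using d(1) by (rule order_tendstoD(2)[OF tendsto_ident_at])
  moreover have "\<forall>\<^sub>F r in at_right (0::real). 0 < r" by (rule eventually_at_right_less)
  ultimately show "\<forall>\<^sub>F r in at_right 0. dist (ball_average U x r) (U x) < e"
  proof eventually_elim
    case (elim r)
    have b[measurable]: "ball x r \<in> sets borel" by simp
    have c: "set_integrable lborel (ball x r) (\<lambda>_. U x)" by (rule set_integrable_ball_bounded[of _ "cmod (U x)"]) auto
    have "ennreal ((cmod (ball_average (\<lambda>u. U u - U x) x r))\<^sup>2) \<le> ennreal ((e / 2)\<^sup>2)"
    proof (rule ball_average_square_le)
      have "(\<integral>\<^sup>+u. ennreal ((cmod (U u - U x))\<^sup>2) * indicator (ball x r) u \<partial>lborel) \<le> (\<integral>\<^sup>+u. ennreal ((e / 2)\<^sup>2) * indicator (ball x r) u \<partial>lborel)"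
      proof (intro nn_integral_mono)
        fix u
        show "ennreal ((cmod (U u - U x))\<^sup>2) * indicator (ball x r) u \<le> ennreal ((e / 2)\<^sup>2) * indicator (ball x r) u"
        proof (cases "u \<in> ball x r")
          case True
          then have "cmod (U u - U x) \<le> e / 2" using d(2)[of u] elim by (auto simp: dist_commute dist_norm[symmetric])
          then have "(cmod (U u - U x))\<^sup>2 \<le> (e / 2)\<^sup>2" by (intro power_mono) auto
          then show ?thesis using True by (simp add: ennreal_leI)
        qed simp
      qed
      then show "(\<integral>\<^sup>+u. ennreal ((cmod (U u - U x))\<^sup>2) * indicator (ball x r) u \<partial>lborel) \<le> ennreal ((e / 2)\<^sup>2) * emeasure lborel (ball x r)"
        by (simp add: nn_integral_cmult_indicator)
    qed (use elim in measurable)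
    then have "(cmod (ball_average (\<lambda>u. U u - U x) x r))\<^sup>2 \<le> (e / 2)\<^sup>2" by simp
    then have "cmod (ball_average (\<lambda>u. U u - U x) x r) \<le> e / 2" by (rule power2_le_imp_le) (use e in simp)
    moreover have "ball_average (\<lambda>u. U u - U x) x r = ball_average U x r - U x"
      using si c elim by (simp add: ball_average_diff ball_average_const)
    ultimately show ?case using e by (simp add: dist_norm)
  qed
qed

text \<open>Uniform convergence refers to the set of radii \<open>{0<..1}\<close>, whereas pointwise
  values are limits along \<open>at_right 0\<close>.\<close>

lemma at_right_0_Ioc: "at 0 within {0<..1} = at_right (0::real)"
  by (rule at_within_nhd[where S="{-1<..<1}"]) auto

text \<open>The Weierstrass test makes the series of averages uniform in r, so the limit as r tends
  to 0 may be taken term by term. The first conclusion hands the bounds \<open>a j\<close> on to the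
  limits, where they serve uniformly in time.\<close>

lemma series_of_averages:
  fixes u :: "nat \<Rightarrow> real \<Rightarrow> complex"
  assumes bd: "\<And>j r. 0 < r \<Longrightarrow> r \<le> 1 \<Longrightarrow> cmod (u j r) \<le> a j" and a: "summable a"
    and u0: "(u0 \<longlongrightarrow> l0) (at_right 0)" and ul: "\<And>j. (u j \<longlongrightarrow> l j) (at_right 0)"
    and conv: "\<And>r. 0 < r \<Longrightarrow> r \<le> 1 \<Longrightarrow> (\<lambda>N. u0 r + (\<Sum>j<N. u j r)) \<longlonglongrightarrow> v r"
  shows "cmod (l j) \<le> a j" "(v \<longlongrightarrow> l0 + (\<Sum>j. l j)) (at_right 0)"
proof -
  have ev: "\<forall>\<^sub>F r in at_right (0::real). 0 < r \<and> r \<le> 1"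
    unfolding at_right_0_Ioc[symmetric] eventually_at_filter by simp
  have la: "cmod (l j) \<le> a j" for j
  proof (rule tendsto_upperbound[OF tendsto_norm[OF ul]])
    show "\<forall>\<^sub>F r in at_right 0. cmod (u j r) \<le> a j" using ev by eventually_elim (auto intro: bd)
  qed simp
  then show "cmod (l j) \<le> a j" .
  have sl: "summable l" using la a by (rule summable_comparison_test'[rotated])
  have ulim: "uniform_limit {0<..1} (\<lambda>N r. \<Sum>j<N. u j r) (\<lambda>r. \<Sum>j. u j r) sequentially"
    using bd a by (intro Weierstrass_m_test_ev[where M=a]) auto
  have "((\<lambda>r. \<Sum>j. u j r) \<longlongrightarrow> (\<Sum>j. l j)) (at 0 within {0<..1})"
    by (rule swap_uniform_limit[OF _ summable_LIMSEQ[OF sl] ulim])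
       (unfold at_right_0_Ioc, intro always_eventually allI tendsto_sum ul, simp)
  then have "((\<lambda>r. u0 r + (\<Sum>j. u j r)) \<longlongrightarrow> l0 + (\<Sum>j. l j)) (at_right 0)"
    unfolding at_right_0_Ioc by (intro tendsto_add u0)
  moreover have "\<forall>\<^sub>F r in at_right 0. u0 r + (\<Sum>j. u j r) = v r"
    using ev
  proof eventually_elim
    case (elim r)
    have "summable (\<lambda>j. u j r)" using bd elim a by (intro summable_comparison_test'[OF a, where N=0]) auto
    then have "(\<lambda>N. u0 r + (\<Sum>j<N. u j r)) \<longlonglongrightarrow> u0 r + (\<Sum>j. u j r)"
      by (intro tendsto_add tendsto_const summable_LIMSEQ)
    then show ?case using conv[of r] elim LIMSEQ_unique by blast
  qed
  ultimately show "(v \<longlongrightarrow> l0 + (\<Sum>j. l j)) (at_right 0)" by (rule Lim_transform_eventually)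
qed

section \<open>Summable majorants for the shells at almost every point\<close>

lemma measurable_M_meas:
  "\<mu> \<in> M_meas \<alpha> \<Longrightarrow> f \<in> borel_measurable borel \<Longrightarrow> f \<in> borel_measurable \<mu>"
  by (auto simp: M_meas_def cong: measurable_cong_sets)

lemma powr_two_power: "(2 ^ j) powr x = (2 powr x :: real) ^ j"
  by (simp add: powr_powr powr_realpow[symmetric] mult.commute)

lemma summable_Suc_Suc_power:
  fixes q :: real
  assumes "0 \<le> q" "q < 1"
  shows "summable (\<lambda>j. real (Suc (Suc j)) * q ^ j)"
proof -
  have "summable (\<lambda>j. real (Suc j) * q ^ j)"
    using geometric_deriv_sums[of q] assms by (auto simp: sums_iff)
  moreover have "summable (\<lambda>j. q ^ j)" using assms by (intro summable_geometric) auto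
  ultimately have "summable (\<lambda>j. real (Suc j) * q ^ j + q ^ j)" by (rule summable_add)
  then show ?thesis by (simp add: algebra_simps)
qed

text \<open>Written as a difference of truncations so that partial sums telescope to
  \<open>trunc (2 ^ N) F\<close> once the low frequencies \<open>trunc 1 F\<close> are
  added.\<close>

definition shell :: "nat \<Rightarrow> (real^'n \<Rightarrow> complex) \<Rightarrow> real^'n \<Rightarrow> complex" where
  "shell j F \<xi> = trunc (2 ^ Suc j) F \<xi> - trunc (2 ^ j) F \<xi>"

lemma shell_eq: "shell j F \<xi> = (if 2 ^ j \<le> norm \<xi> \<and> norm \<xi> < 2 ^ Suc j then F \<xi> else 0)"
proof -
  have "norm \<xi> < 2 ^ j \<Longrightarrow> norm \<xi> < 2 ^ Suc j" by (rule order.strict_trans2) auto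
  then show ?thesis by (auto simp: shell_def trunc_def indicator_def simp del: power_Suc)
qed

lemma measurable_shell [measurable]:
  assumes [measurable]: "F \<in> borel_measurable borel"
  shows "shell j F \<in> borel_measurable borel"
  unfolding shell_def[abs_def] by measurable

text \<open>On the j-th shell \<open>1 + (norm \<xi>)\<^sup>2\<close> is at least
  \<open>(2 ^ j)\<^sup>2\<close>, which trades the Sobolev weight for
  \<open>(2 powr (- 2 * s)) ^ j\<close>.\<close>

lemma nn_integral_shell_le:
  fixes F :: "real^'n \<Rightarrow> complex"
  assumes [measurable]: "F \<in> borel_measurable borel" and s: "s \<ge> 0"
  shows "L2sq (shell j F)
    \<le> ennreal ((2 powr (- 2 * s)) ^ j) * (\<integral>\<^sup>+\<xi>. ennreal ((1 + (norm \<xi>)\<^sup>2) powr s * (cmod (F \<xi>))\<^sup>2) \<partial>lborel)"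
proof -
  have "(cmod (shell j F \<xi>))\<^sup>2 \<le> (2 powr (- 2 * s)) ^ j * ((1 + (norm \<xi>)\<^sup>2) powr s * (cmod (F \<xi>))\<^sup>2)" for \<xi>
  proof (cases "2 ^ j \<le> norm \<xi>")
    case True
    then have "(2 ^ j)\<^sup>2 \<le> (norm \<xi>)\<^sup>2" by (intro power_mono) auto
    then have "(2 ^ j)\<^sup>2 \<le> 1 + (norm \<xi>)\<^sup>2" by linarith
    then have "((2 ^ j)\<^sup>2) powr s \<le> (1 + (norm \<xi>)\<^sup>2) powr s" by (rule powr_mono2[OF s, rotated]) simp
    from mult_left_mono[OF this, of "(2 powr (- 2 * s)) ^ j"]
    have "(2 powr (- 2 * s)) ^ j * ((2 ^ j)\<^sup>2) powr s \<le> (2 powr (- 2 * s)) ^ j * (1 + (norm \<xi>)\<^sup>2) powr s" by simp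
    moreover have "((2 ^ j)\<^sup>2) powr s = ((2 powr (2 * s)) ^ j :: real)"
    proof -
      have "((2 ^ j)\<^sup>2) powr s = (2 ^ j) powr s * (2 ^ j :: real) powr s"
        unfolding power2_eq_square by (rule powr_mult)
      also have "\<dots> = (2 powr s * 2 powr s) ^ j" by (simp only: powr_two_power power_mult_distrib)
      also have "2 powr s * 2 powr s = (2::real) powr (2 * s)" unfolding powr_add[symmetric] by simp
      finally show ?thesis .
    qed
    moreover have "(2 powr (- 2 * s)) ^ j * (2 powr (2 * s)) ^ j = (1::real)"
      by (simp add: power_mult_distrib[symmetric] powr_add[symmetric])
    ultimately have "1 \<le> (2 powr (- 2 * s)) ^ j * (1 + (norm \<xi>)\<^sup>2) powr s"
      by (simp only:)
    then have "1 * (cmod (F \<xi>))\<^sup>2 \<le> (2 powr (- 2 * s)) ^ j * (1 + (norm \<xi>)\<^sup>2) powr s * (cmod (F \<xi>))\<^sup>2"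
      by (rule mult_right_mono) simp
    moreover have "(cmod (shell j F \<xi>))\<^sup>2 \<le> (cmod (F \<xi>))\<^sup>2" by (simp add: shell_eq)
    ultimately show ?thesis unfolding mult.assoc mult_1 by (rule order_trans[rotated])
  qed (simp add: shell_eq)
  then have "L2sq (shell j F)
    \<le> (\<integral>\<^sup>+\<xi>. ennreal ((2 powr (- 2 * s)) ^ j) * ennreal ((1 + (norm \<xi>)\<^sup>2) powr s * (cmod (F \<xi>))\<^sup>2) \<partial>lborel)"
    by (intro nn_integral_mono) (simp add: ennreal_mult[symmetric] ennreal_leI)
  also have "\<dots> = ennreal ((2 powr (- 2 * s)) ^ j) * (\<integral>\<^sup>+\<xi>. ennreal ((1 + (norm \<xi>)\<^sup>2) powr s * (cmod (F \<xi>))\<^sup>2) \<partial>lborel)"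
    by (rule nn_integral_cmult) measurable
  finally show ?thesis .
qed

text \<open>The majorants of the squared maximal functions are summed with growing weights
  \<open>(1 / q) ^ j\<close>. The weighted sum has finite integral, hence is finite almost
  everywhere, and its value D at x bounds the j-th average by \<open>sqrt (D * q ^ j)\<close> for
  all t and r.\<close>

lemma shell_bounds_AE:
  fixes P :: "real^'n \<Rightarrow> real" and \<mu> :: "(real^'n) measure" and F :: "real^'n \<Rightarrow> complex"
  assumes \<mu>: "\<mu> \<in> M_meas \<alpha>" and \<alpha>: "0 \<le> \<alpha>" "\<alpha> \<le> real CARD('n)" and P: "P \<in> borel_measurable borel"
    and sm: "smooth_on (- {0}) P" and hom: "homogeneous k P" and ns: "nonsingular P"
    and s: "s > (real CARD('n) - \<alpha> + 1) / 2"
    and F[measurable]: "F \<in> borel_measurable borel" and I: "L2sq F < \<infinity>"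
    and Is: "(\<integral>\<^sup>+\<xi>. ennreal ((1 + (norm \<xi>)\<^sup>2) powr s * (cmod (F \<xi>))\<^sup>2) \<partial>lborel) < \<infinity>"
  shows "AE x in \<mu>. \<exists>a. summable a \<and> (\<forall>j t r. 0 < r \<longrightarrow> r \<le> 1 \<longrightarrow> cmod (ball_average (wave P (shell j F) t) x r) \<le> a j)"
proof -
  define \<beta> where "\<beta> = real CARD('n) - \<alpha> + 1"
  \<comment> \<open>Half of the room that the strict inequality for s leaves: one half pays for the
    weights, the other makes the integrals summable in spite of the logarithmic factor.\<close>
  define \<delta> where "\<delta> = (2 * s - \<beta>) / 2"
  have \<delta>: "\<delta> > 0" using s by (simp add: \<delta>_def \<beta>_def field_simps)
  have s0: "s \<ge> 0" using s \<alpha> by simp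
  define q :: real where "q = 2 powr (- \<delta>)"
  have q: "0 < q" "q < 1" using \<delta> by (auto simp: q_def powr_less_one)
  define B where "B = enn2real (\<integral>\<^sup>+\<xi>. ennreal ((1 + (norm \<xi>)\<^sup>2) powr s * (cmod (F \<xi>))\<^sup>2) \<partial>lborel)"
  have B: "(\<integral>\<^sup>+\<xi>. ennreal ((1 + (norm \<xi>)\<^sup>2) powr s * (cmod (F \<xi>))\<^sup>2) \<partial>lborel) = ennreal B" "B \<ge> 0"
    using Is by (auto simp: B_def)
  obtain C where C: "C \<ge> 0" and max: "\<forall>j (F :: real^'n \<Rightarrow> complex). integrable lborel F \<longrightarrow> (\<forall>\<xi>. F \<xi> \<noteq> 0 \<longrightarrow> 2 ^ j / 2 \<le> norm \<xi> \<and> norm \<xi> \<le> 2 ^ j) \<longrightarrow>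
     maximal_bound \<mu> P F (ennreal (C * real (Suc j) * (2 ^ j) powr (real CARD('n) - \<alpha> + 1)) * L2sq F)"
    using maximal_dyadic[OF \<mu> \<alpha> P sm hom ns] by (elim exE conjE) (rule that)
  have int: "integrable lborel (shell j F)" for j
    unfolding shell_def[abs_def] by (intro Bochner_Integration.integrable_diff integrable_trunc F I)
  \<comment> \<open>\<open>shell j F\<close> lives on norms from \<open>2 ^ j\<close> to
    \<open>2 ^ Suc j\<close>, so the dyadic estimate is taken at index \<open>Suc j\<close>.\<close>
  have "maximal_bound \<mu> P (shell j F) (ennreal (C * real (Suc (Suc j)) * (2 ^ Suc j) powr (real CARD('n) - \<alpha> + 1)) * L2sq (shell j F))" for j
    by (rule max[rule_format, OF int]) (auto simp: shell_eq split: if_splits)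
  then obtain M where Mm: "\<And>j. M j \<in> borel_measurable borel"
    and M1: "\<And>j r t x. 0 < r \<Longrightarrow> r \<le> 1 \<Longrightarrow> ennreal ((cmod (ball_average (wave P (shell j F) t) x r))\<^sup>2) \<le> M j x"
    and M2: "\<And>j. (\<integral>\<^sup>+x. M j x \<partial>\<mu>) \<le> ennreal (C * real (Suc (Suc j)) * (2 ^ Suc j) powr (real CARD('n) - \<alpha> + 1)) * L2sq (shell j F)"
    by metis
  have Mm'[measurable]: "M j \<in> borel_measurable \<mu>" for j by (rule measurable_M_meas[OF \<mu> Mm])
  define E where "E = C * 2 powr \<beta> * B"
  have E: "E \<ge> 0" using C B by (simp add: E_def)
  have term_le: "ennreal ((1 / q) ^ j) * (\<integral>\<^sup>+x. M j x \<partial>\<mu>) \<le> ennreal (E * (real (Suc (Suc j)) * q ^ j))" for j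
  proof -
    have "(\<integral>\<^sup>+x. M j x \<partial>\<mu>) \<le> ennreal (C * real (Suc (Suc j)) * (2 ^ Suc j) powr \<beta>) * (ennreal ((2 powr (- 2 * s)) ^ j) * ennreal B)"
      unfolding \<beta>_def B(1)[symmetric] by (rule order_trans[OF M2]) (intro mult_left_mono nn_integral_shell_le F s0, simp)
    also have "\<dots> = ennreal (C * real (Suc (Suc j)) * (2 ^ Suc j) powr \<beta> * ((2 powr (- 2 * s)) ^ j * B))"
      using C B by (simp add: ennreal_mult)
    finally have "ennreal ((1 / q) ^ j) * (\<integral>\<^sup>+x. M j x \<partial>\<mu>) \<le> ennreal ((1 / q) ^ j) * ennreal (C * real (Suc (Suc j)) * (2 ^ Suc j) powr \<beta> * ((2 powr (- 2 * s)) ^ j * B))"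
      by (rule mult_left_mono) simp
    also have "\<dots> = ennreal ((1 / q) ^ j * (C * real (Suc (Suc j)) * (2 ^ Suc j) powr \<beta> * ((2 powr (- 2 * s)) ^ j * B)))"
      using q C B by (intro ennreal_mult[symmetric]) auto
    also have "(1 / q) ^ j * (C * real (Suc (Suc j)) * (2 ^ Suc j) powr \<beta> * ((2 powr (- 2 * s)) ^ j * B)) = E * (real (Suc (Suc j)) * q ^ j)"
    proof -
      have "(1 / q) * 2 powr \<beta> * 2 powr (- 2 * s) = q"
      proof -
        have "1 / q = 2 powr \<delta>" by (simp add: q_def powr_minus_divide)
        moreover have "\<delta> + \<beta> + - 2 * s = - \<delta>" by (simp add: \<delta>_def field_simps)
        ultimately show ?thesis by (simp only: powr_add[symmetric] q_def)
      qed
      then have "((1 / q) * 2 powr \<beta> * 2 powr (- 2 * s)) ^ j = q ^ j" by simp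
      then have "(1 / q) ^ j * (2 powr \<beta>) ^ j * (2 powr (- 2 * s)) ^ j = q ^ j" by (simp only: power_mult_distrib)
      note 1 = this
      have 2: "(2 ^ Suc j) powr \<beta> = 2 powr \<beta> * (2 powr \<beta>) ^ j"
        using powr_two_power[of "Suc j" \<beta>] by simp
      show ?thesis unfolding E_def 2 1[symmetric] by (simp only: mult_ac)
    qed
    finally show ?thesis .
  qed
  have sm: "summable (\<lambda>j. E * (real (Suc (Suc j)) * q ^ j))"
    using q by (intro summable_mult summable_Suc_Suc_power) auto
  have "(\<integral>\<^sup>+x. (\<Sum>j. ennreal ((1 / q) ^ j) * M j x) \<partial>\<mu>) = (\<Sum>j. ennreal ((1 / q) ^ j) * (\<integral>\<^sup>+x. M j x \<partial>\<mu>))"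
    by (subst nn_integral_suminf) (auto simp: nn_integral_cmult)
  also have "\<dots> \<le> (\<Sum>j. ennreal (E * (real (Suc (Suc j)) * q ^ j)))"
    by (intro suminf_le term_le summableI)
  also have "\<dots> = ennreal (\<Sum>j. E * (real (Suc (Suc j)) * q ^ j))"
    using sm E q by (intro suminf_ennreal2) auto
  finally have "(\<integral>\<^sup>+x. (\<Sum>j. ennreal ((1 / q) ^ j) * M j x) \<partial>\<mu>) \<noteq> \<infinity>" by (auto simp: top_unique)
  then have "AE x in \<mu>. (\<Sum>j. ennreal ((1 / q) ^ j) * M j x) \<noteq> \<infinity>"
    by (intro nn_integral_PInf_AE) auto
  then show ?thesis
  proof eventually_elim
    case (elim x)
    define D where "D = enn2real (\<Sum>j. ennreal ((1 / q) ^ j) * M j x)"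
    have D: "(\<Sum>j. ennreal ((1 / q) ^ j) * M j x) = ennreal D" "D \<ge> 0" using elim by (auto simp: D_def less_top)
    show ?case
    proof (intro exI[of _ "\<lambda>j. sqrt D * sqrt q ^ j"] conjI allI impI)
      show "summable (\<lambda>j. sqrt D * sqrt q ^ j)"
        using q by (intro summable_mult summable_geometric) auto
      fix j :: nat and t r :: real assume r: "0 < r" "r \<le> 1"
      let ?c = "cmod (ball_average (wave P (shell j F) t) x r)"
      have "ennreal ((1 / q) ^ j) * ennreal (?c\<^sup>2) \<le> ennreal ((1 / q) ^ j) * M j x"
        by (intro mult_left_mono M1 r) simp
      also have "\<dots> \<le> ennreal D"
        using sum_le_suminf[of "\<lambda>j. ennreal ((1 / q) ^ j) * M j x" "{j}"] D(1) by simp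
      finally have "ennreal ((1 / q) ^ j * ?c\<^sup>2) \<le> ennreal D" using q by (simp add: ennreal_mult)
      then have "(1 / q) ^ j * ?c\<^sup>2 \<le> D" using D(2) by (subst (asm) ennreal_le_iff) auto
      then have "?c\<^sup>2 \<le> D * q ^ j" using q by (simp add: power_one_over field_simps)
      then have "sqrt (?c\<^sup>2) \<le> sqrt (D * q ^ j)" by (rule real_sqrt_le_mono)
      then show "?c \<le> sqrt D * sqrt q ^ j" by (simp add: real_sqrt_mult real_sqrt_power)
    qed
  qed
qed

theorem theorem1p1:
  fixes P :: "real^'n \<Rightarrow> real" and f :: "real^'n \<Rightarrow> complex" and \<mu> :: "(real^'n) measure"
    and \<alpha> k s :: real
  assumes "0 \<le> \<alpha>" and "\<alpha> \<le> real CARD('n)"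
    and "k \<ge> 1"
    and "smooth_on (- {0}) P" and "homogeneous k P" and "nonsingular P"
    and "s > (real CARD('n) - \<alpha> + 1) / 2"
    and "\<mu> \<in> M_meas \<alpha>"
    and "f \<in> sobolev s"
  shows "AE x in \<mu>. has_value_at f x \<and>
           (\<forall>\<^sub>F t in at 0. has_value_at (T_op P t f) x) \<and>
           ((\<lambda>t. value_at (T_op P t f) x) \<longlongrightarrow> value_at f x) (at 0)"
proof -
  \<comment> \<open>\<open>P\<close> is continuous off the origin, and a single exceptional point
    does not affect Borel measurability.\<close>
  have P: "P \<in> borel_measurable borel"
    using smooth_on_punctured(1)[OF assms(4)] by (intro borel_measurable_continuous_countable_exceptions[of "{0}"]) auto
  have f: "f \<in> L2" and fs: "(\<lambda>\<xi>. complex_of_real ((1 + (norm \<xi>)\<^sup>2) powr (s / 2)) * fourier f \<xi>) \<in> L2"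
    using assms(9) by (auto simp: sobolev_def)
  have "fourier f \<in> L2" using fourier_works[OF f] by (simp add: is_fourier_transform_def)
  then obtain F where F[measurable]: "F \<in> borel_measurable borel" and ae: "AE \<xi> in lborel. fourier f \<xi> = F \<xi>"
    and I: "L2sq F < \<infinity>" by (rule L2_borel_rep)
  have Is: "(\<integral>\<^sup>+\<xi>. ennreal ((1 + (norm \<xi>)\<^sup>2) powr s * (cmod (F \<xi>))\<^sup>2) \<partial>lborel) < \<infinity>"
  proof -
    have "(\<integral>\<^sup>+\<xi>. ennreal ((1 + (norm \<xi>)\<^sup>2) powr s * (cmod (F \<xi>))\<^sup>2) \<partial>lborel)
      = (\<integral>\<^sup>+\<xi>. ennreal ((cmod (complex_of_real ((1 + (norm \<xi>)\<^sup>2) powr (s / 2)) * fourier f \<xi>))\<^sup>2) \<partial>lborel)"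
    proof (rule nn_integral_cong_AE, use ae in eventually_elim)
      fix \<xi> :: "real^'n" assume "fourier f \<xi> = F \<xi>"
      moreover have "((1 + (norm \<xi>)\<^sup>2) powr (s / 2))\<^sup>2 = (1 + (norm \<xi>)\<^sup>2) powr s"
        by (simp add: power2_eq_square powr_add[symmetric])
      ultimately show "ennreal ((1 + (norm \<xi>)\<^sup>2) powr s * (cmod (F \<xi>))\<^sup>2)
          = ennreal ((cmod (complex_of_real ((1 + (norm \<xi>)\<^sup>2) powr (s / 2)) * fourier f \<xi>))\<^sup>2)"
        by (simp add: norm_mult power_mult_distrib)
    qed
    also have "\<dots> = (\<integral>\<^sup>+\<xi>. ennreal ((cmod (complex_of_real ((1 + (norm \<xi>)\<^sup>2) powr (s / 2)) * fourier f \<xi>))\<^sup>2) \<partial>lebesgue)"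
      by (rule nn_integral_completion[symmetric])
    also have "\<dots> < \<infinity>" using fs unfolding L2_def integrable_iff_bounded by simp
    finally show ?thesis .
  qed
  have int: "integrable lborel (trunc R F)" for R by (rule integrable_trunc[OF F I])
  have ints: "integrable lborel (shell j F)" for j
    unfolding shell_def[abs_def] by (intro Bochner_Integration.integrable_diff int)
  define u where "u j t x r = ball_average (wave P (shell j F) t) x r" for j t x r
  define u0 where "u0 t x r = ball_average (wave P (trunc 1 F) t) x r" for t x r
  have wave_m: "wave P G t \<in> borel_measurable borel" if "integrable lborel G" for G t
    using that P by (intro measurable_wave) auto
  have partial: "ball_average (wave P (trunc (2 ^ N) F) t) x r = u0 t x r + (\<Sum>j<N. u j t x r)" for N t x r
  proof -
    have "wave P (shell j F) t = (\<lambda>y. wave P (trunc (2 ^ Suc j) F) t y - wave P (trunc (2 ^ j) F) t y)" for j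
      unfolding wave_def shell_def left_diff_distrib
      by (intro ext Bochner_Integration.integral_diff integrable_phase P int)
    then have "u j t x r = ball_average (wave P (trunc (2 ^ Suc j) F) t) x r - ball_average (wave P (trunc (2 ^ j) F) t) x r" for j
      unfolding u_def using P by (simp only:) (intro ball_average_diff set_integrable_wave wave_m int measurable_trunc F P)
    then have "(\<Sum>j<N. u j t x r) = (\<Sum>j<N. ball_average (wave P (trunc (2 ^ Suc j) F) t) x r - ball_average (wave P (trunc (2 ^ j) F) t) x r)"
      by (intro sum.cong refl)
    also have "\<dots> = ball_average (wave P (trunc (2 ^ N) F) t) x r - ball_average (wave P (trunc (2 ^ 0) F) t) x r"
      by (rule sum_lessThan_telescope)
    finally show ?thesis by (simp add: u0_def)
  qed
  have pow: "filterlim (\<lambda>N. (2::real) ^ N) at_top sequentially"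
    by (rule filterlim_at_top_mono[OF filterlim_real_sequentially]) (auto intro!: always_eventually less_imp_le of_nat_less_two_power)
  have convT: "(\<lambda>N. u0 t x r + (\<Sum>j<N. u j t x r)) \<longlonglongrightarrow> ball_average (T_op P t f) x r" if "r > 0" for t x r
    using filterlim_compose[OF ball_average_T_op[OF P F ae I that] pow] unfolding partial .
  have convf: "(\<lambda>N. u0 0 x r + (\<Sum>j<N. u j 0 x r)) \<longlonglongrightarrow> ball_average f x r" if "r > 0" for x r
    using filterlim_compose[OF ball_average_fourier_inversion[OF P f F ae I that] pow] unfolding partial .
  have lim: "(ball_average (wave P G t) x \<longlongrightarrow> wave P G t x) (at_right 0)" if "integrable lborel G" for G t x
    using that by (intro ball_average_tendsto_isCont wave_m isCont_wave P set_integrable_wave) auto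
  from shell_bounds_AE[OF assms(8,1,2) P assms(4,5,6,7) F I Is]
  show ?thesis
  proof eventually_elim
    case (elim x)
    then obtain a where a: "summable a" and bd: "\<And>j t r. 0 < r \<Longrightarrow> r \<le> 1 \<Longrightarrow> cmod (u j t x r) \<le> a j"
      unfolding u_def by blast
    \<comment> \<open>The pointwise solution: the value of \<open>T_op P t f\<close> at x for every
      t, and at t = 0 the value of f. The theorem thus becomes continuity of \<open>W\<close> at
      0.\<close>
    define W where "W t = wave P (trunc 1 F) t x + (\<Sum>j. wave P (shell j F) t x)" for t
    note ser = series_of_averages[of "\<lambda>j. u j t x" a "u0 t x" "wave P (trunc 1 F) t x" "\<lambda>j. wave P (shell j F) t x" for t]
    have l: "(u0 t x \<longlongrightarrow> wave P (trunc 1 F) t x) (at_right 0)" "(u j t x \<longlongrightarrow> wave P (shell j F) t x) (at_right 0)" for t j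
      unfolding u0_def u_def using lim[OF int] lim[OF ints] by simp_all
    have T: "(ball_average (T_op P t f) x \<longlongrightarrow> W t) (at_right 0)" for t
      unfolding W_def using bd a l convT by (intro ser(2)) auto
    \<comment> \<open>f enters through Fourier inversion: its averages are limits of the same
      partial sums at t = 0.\<close>
    have fl: "(ball_average f x \<longlongrightarrow> W 0) (at_right 0)"
      unfolding W_def using bd a l convf by (intro ser(2)) auto
    \<comment> \<open>The bound does not depend on t, so the series for \<open>W\<close> converges
      uniformly in time.\<close>
    have wa: "cmod (wave P (shell j F) t x) \<le> a j" for t j
      using bd a l convT by (intro ser(1)[where v = "ball_average (T_op P t f) x"]) auto
    have "continuous_on UNIV (\<lambda>t. \<Sum>j. wave P (shell j F) t x)"
    proof (rule uniform_limit_theorem)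
      show "uniform_limit UNIV (\<lambda>N t. \<Sum>j<N. wave P (shell j F) t x) (\<lambda>t. \<Sum>j. wave P (shell j F) t x) sequentially"
        using wa a by (intro Weierstrass_m_test_ev[where M=a]) auto
      show "\<forall>\<^sub>F N in sequentially. continuous_on UNIV (\<lambda>t. \<Sum>j<N. wave P (shell j F) t x)"
        by (intro always_eventually allI continuous_on_sum continuous_on_wave_time P ints)
    qed simp
    then have "continuous_on UNIV W"
      unfolding W_def by (intro continuous_on_add continuous_on_wave_time P int)
    then have "isCont W 0" by (simp add: continuous_on_eq_continuous_at)
    then have "(W \<longlongrightarrow> W 0) (at 0)" by (simp add: isCont_def)
    moreover have "value_at (T_op P t f) x = W t" for t
      unfolding value_at_def by (rule tendsto_Lim[OF _ T]) simp
    moreover have "value_at f x = W 0"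
      unfolding value_at_def by (rule tendsto_Lim[OF _ fl]) simp
    moreover have "has_value_at f x" using fl by (auto simp: has_value_at_def)
    \<comment> \<open>The exceptional set came from bounds uniform in t, so the value exists for all
      t at once.\<close>
    moreover have "has_value_at (T_op P t f) x" for t using T by (auto simp: has_value_at_def)
    ultimately show ?case by simp
  qed
qed

end
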